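(* Let $\mathfrak{D}^q_{\mathfrak{s}}$ be a quantum cluster scattering diagram of rank $r=2$ such that $b_{12}\neq0$, where $b_{ij}=\{\delta_ie_i,e_j\}$. If $\delta_1\mid\delta_2$ or $\delta_2\mid\delta_1$, then $\mathfrak{D}^q_{\mathfrak{s}}$ is positive up to $G^{\le4}$, that is: there is a scattering diagram $\mathfrak{D}'$ with the same incoming walls $(e_i^\perp,\Psi_{1/\delta_i}[e_i])_{e_i}$ $(i=1,2)$, all of whose wall elements have the form $\Psi_{1/\delta(n),b}[n]^c$ with $n\in N^+$, $b\in(1/\delta_0)\mathbb{Z}$, $c\in\mathbb{Z}_{>0}$, such that $\mathfrak{p}_{\gamma,\mathfrak{D}'}\equiv\mathfrak{p}_{\gamma,\mathfrak{D}^q_{\mathfrak{s}}}$ modulo $G^{>4}$ for every curve $\gamma$ admissible for both $\mathfrak{D}'$ and $\mathfrak{D}^q_{\mathfrak{s}}$.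
   Context: Fixed data: $N$ is a lattice of finite rank $r$ with basis (seed) $\mathfrak{s}=(e_1,\dots,e_r)$; $\{\cdot,\cdot\}:N\times N\to\mathbb{Q}$ is a skew-symmetric bilinear form; $\delta_1,\dots,\delta_r$ are positive integers such that $N^\circ=\bigoplus_i\mathbb{Z}\,\delta_ie_i$ satisfies $\{N^\circ,N\}\subset\mathbb{Z}$. Let $\delta_0=\mathrm{lcm}(\delta_1,\dots,\delta_r)$, $M_{\mathbb{R}}=\mathrm{Hom}(N,\mathbb{Z})\otimes\mathbb{R}$ with canonical pairing $\langle\cdot,\cdot\rangle:N\times M_{\mathbb{R}}\to\mathbb{R}$, and $n^\perp=\{\xi\in M_{\mathbb{R}}\mid\langle n,\xi\rangle=0\}$. Let $N^+=\{\sum_ia_ie_i\mid a_i\in\mathbb{Z}_{\ge0},\sum_ia_i>0\}$, $N^+_{\mathrm{pr}}$ its subset of primitive vectors, $\deg(\sum_ia_ie_i)=\sum_ia_i$. For $n\in N^+$, $\delta(n)$ is the smallest positive rational number with $\delta(n)n\in N^\circ$ (then $1/\delta(n)\in(1/\delta_0)\mathbb{Z}_{>0}$). Structure group: $q$ is an indeterminate, $[\alpha]_q=\frac{q^\alpha-q^{-\alpha}}{q-q^{-1}}$ for $\alpha\in(1/\delta_0)\mathbb{Z}$. $\mathfrak{g}=\bigoplus_{n\in N^+}\mathbb{Q}(q^{1/\delta_0})X_n$ with $[X_n,X_{n'}]=[\{n,n'\}]_qX_{n+n'}$; $\widehat{\mathfrak{g}}$ is its completion with respect to $\deg$; $G=\exp(\widehat{\mathfrak{g}})$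 with the Baker–Campbell–Hausdorff product. $G^{>\ell}$ is the normal subgroup of elements $\exp(\sum_{\deg n>\ell}c_nX_n)$, and $G^{\le\ell}=G/G^{>\ell}$. For $n\in N^+_{\mathrm{pr}}$, $G_n^{\parallel}=\{\exp(\sum_{j\ge1}c_jX_{jn})\}$. Powers: $\exp(X)^c=\exp(cX)$. For $n\in N^+$, $a\in(1/\delta_0)\mathbb{Z}_{>0}$, $b\in(1/\delta_0)\mathbb{Z}$: $\Psi_{a,b}[n]=\exp\bigl(\sum_{j\ge1}\frac{(-1)^{j+1}}{j[ja]_q}q^{jb}X_{jn}\bigr)$, and $\Psi_a[n]=\Psi_{a,0}[n]$. Scattering diagrams: a wall is a triple $(\mathfrak{d},g)_n$ with $n\in N^+_{\mathrm{pr}}$ (normal vector), $\mathfrak{d}\subset n^\perp$ a (convex rational polyhedral) cone of codimension 1 in $M_{\mathbb{R}}$, and $g\in G_n^{\parallel}$ (wall element). It is incoming if $p^*(n):=\{\cdot,n\}\in\mathfrak{d}$. A scattering diagram $\mathfrak{D}=\{(\mathfrak{d}_\lambda,g_\lambda)_{n_\lambda}\}_{\lambda\in\Lambda}$ is a collection of walls such that for each $\ell$ only finitely many $g_\lambda$ are nontrivial in $G^{\le\ell}$. $\mathrm{Supp}(\mathfrak{D})=\bigcup_\lambda\mathfrak{d}_\lambda$; $\mathrm{Sing}(\mathfrak{D})$ is the union of all boundaries $\partial\mathfrak{d}_\lambda$ and all intersections $\mathfrak{d}_\lambda\cap\mathfrak{d}_{\lambda'}$ of dimension $r-2$. A smooth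 curve $\gamma:[0,1]\to M_{\mathbb{R}}$ is admissible if its endpoints are not in $\mathrm{Supp}(\mathfrak{D})$, it meets $\mathrm{Supp}(\mathfrak{D})$ transversally, and it avoids $\mathrm{Sing}(\mathfrak{D})$. The path-ordered product $\mathfrak{p}_{\gamma,\mathfrak{D}}\in G$ is the product of $g_\lambda^{\epsilon_\lambda}$ over walls crossed by $\gamma$, in order of crossing (later crossings written to the left), with $\epsilon_\lambda=1$ if $\langle n_\lambda,\gamma'\rangle<0$ and $-1$ if $\langle n_\lambda,\gamma'\rangle>0$ at the crossing. Two diagrams are equivalent if their path-ordered products agree for every curve admissible for both; a diagram is consistent if $\mathfrak{p}_{\gamma,\mathfrak{D}}=\mathrm{id}$ for every admissible loop. A quantum cluster scattering diagram (QCSD) $\mathfrak{D}^q_{\mathfrak{s}}$ is a consistent scattering diagram whose set of incoming walls is $\{(e_i^\perp,\Psi_{1/\delta_i}[e_i])_{e_i}\mid i=1,\dots,r\}$ (it exists and is unique up to equivalence). A QCSD is positive if it is equivalent to a QCSD in which the wall element of every wall has the form $\Psi_{1/\delta(n),b}[n]^c$ with $n\in N^+$, $b\in(1/\delta_0)\mathbb{Z}$, $c\in\mathbb{Z}_{>0}$. *)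

theory Defs
  imports "HOL-Analysis.Analysis" "HOL-Computational_Algebra.Computational_Algebra"
begin

text \<open>
  The lattice \<open>N\<close> with its seed is \<open>\<int>\<^sup>r\<close> with the standard basis, for a finite index type \<open>'r\<close>.
  \<open>M\<^sub>\<real>\<close> is \<open>\<real>\<^sup>r\<close> in the dual basis.
  The field \<open>\<rat>(q\<^bsup>1/\<delta>\<^sub>0\<^esup>)\<close> is the field of fractions of \<open>\<rat>[t]\<close>, with \<open>t = q\<^bsup>1/\<delta>\<^sub>0\<^esup>\<close>.
  The completed Lie algebra is the product of its (one-dimensional) \<open>N\<^sup>+\<close>-graded pieces, so that an
  element \<open>\<Sum>n. x n X\<^sub>n\<close> is the coefficient function \<open>x\<close>; the group element \<open>exp x\<close> is
  represented by \<open>x\<close> itself.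
\<close>

type_synonym coeff = "rat poly fract"
type_synonym 'r lie = "int ^ 'r \<Rightarrow> coeff"

record ('r::finite) wall =
  wcone :: "(real ^ 'r) set"
  welt :: "'r lie"
  wnormal :: "int ^ 'r"

definition seed :: "'r::finite \<Rightarrow> int ^ 'r" where
  "seed i = axis i 1"

definition Nplus :: "(int ^ 'r::finite) set" where
  "Nplus = {n. (\<forall>i. 0 \<le> n $ i) \<and> 0 < (\<Sum>i\<in>UNIV. n $ i)}"

definition primitive :: "int ^ 'r::finite \<Rightarrow> bool" where
  "primitive n \<longleftrightarrow> (\<forall>(k::int) m. n = k *s m \<longrightarrow> \<bar>k\<bar> = 1)"

definition Nplus_pr :: "(int ^ 'r::finite) set" where
  "Nplus_pr = {n \<in> Nplus. primitive n}"

definition deg :: "int ^ 'r::finite \<Rightarrow> nat" where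
  "deg n = nat (\<Sum>i\<in>UNIV. n $ i)"

definition pairing :: "int ^ 'r::finite \<Rightarrow> real ^ 'r \<Rightarrow> real" where
  "pairing n \<xi> = (\<Sum>i\<in>UNIV. of_int (n $ i) * \<xi> $ i)"

definition perp :: "int ^ 'r::finite \<Rightarrow> (real ^ 'r) set" where
  "perp n = {\<xi>. pairing n \<xi> = 0}"

definition rational_polyhedral_cone :: "(real ^ 'r::finite) set \<Rightarrow> bool" where
  "rational_polyhedral_cone d \<longleftrightarrow>
     (\<exists>V. finite V \<and> (\<forall>v\<in>V. \<forall>i. v $ i \<in> \<int>) \<and>
          d = convex_cone hull V)"

text \<open>\<open>C\<^sup>\<infinity>\<close> on \<open>[0,1]\<close>, with one-sided derivatives at the endpoints.\<close>

definition smooth_curve :: "(real \<Rightarrow> real ^ 'r::finite) \<Rightarrow> bool" where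
  "smooth_curve \<gamma> \<longleftrightarrow>
     (\<exists>D. D 0 = \<gamma> \<and>
       (\<forall>k::nat. \<forall>t\<in>{0..1}. (D k has_vector_derivative D (Suc k) t) (at t within {0..1})))"

definition velocity :: "(real \<Rightarrow> real ^ 'r::finite) \<Rightarrow> real \<Rightarrow> real ^ 'r" where
  "velocity \<gamma> t = vector_derivative \<gamma> (at t within {0..1})"

definition Supp :: "'i set \<Rightarrow> ('i \<Rightarrow> 'r::finite wall) \<Rightarrow> (real ^ 'r) set" where
  "Supp I W = (\<Union>l\<in>I. wcone (W l))"

definition Sing :: "'i set \<Rightarrow> ('i \<Rightarrow> 'r::finite wall) \<Rightarrow> (real ^ 'r) set" where
  "Sing I W = (\<Union>l\<in>I. rel_frontier (wcone (W l))) \<union>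
     \<Union>{wcone (W l) \<inter> wcone (W l') | l l'. l \<in> I \<and> l' \<in> I \<and>
          aff_dim (wcone (W l) \<inter> wcone (W l')) = int CARD('r) - 2}"

definition admissible :: "'i set \<Rightarrow> ('i \<Rightarrow> 'r::finite wall) \<Rightarrow> (real \<Rightarrow> real ^ 'r) \<Rightarrow> bool" where
  "admissible I W \<gamma> \<longleftrightarrow> smooth_curve \<gamma> \<and>
     \<gamma> 0 \<notin> Supp I W \<and> \<gamma> 1 \<notin> Supp I W \<and>
     (\<forall>t\<in>{0..1}. \<forall>l\<in>I. \<gamma> t \<in> wcone (W l) \<longrightarrow> pairing (wnormal (W l)) (velocity \<gamma> t) \<noteq> 0) \<and>
     (\<forall>t\<in>{0..1}. \<gamma> t \<notin> Sing I W)"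

definition crossing_sign :: "(real \<Rightarrow> real ^ 'r::finite) \<Rightarrow> real \<Rightarrow> int ^ 'r \<Rightarrow> int" where
  "crossing_sign \<gamma> t n = (if pairing n (velocity \<gamma> t) < 0 then 1 else - 1)"

definition ghat :: "'r::finite lie set" where
  "ghat = {x. \<forall>n. n \<notin> Nplus \<longrightarrow> x n = 0}"

definition G_gt :: "nat \<Rightarrow> 'r::finite lie set" where
  "G_gt l = {x \<in> ghat. \<forall>n. deg n \<le> l \<longrightarrow> x n = 0}"

definition G_par :: "int ^ 'r::finite \<Rightarrow> 'r lie set" where
  "G_par n = {x. \<forall>m. (\<nexists>j::nat. 1 \<le> j \<and> m = int j *s n) \<longrightarrow> x m = 0}"

definition gone :: "'r::finite lie" where
  "gone = (\<lambda>_. 0)"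

text \<open>\<open>(exp x)\<^sup>c = exp (c x)\<close>; in particular \<open>gpow (- 1)\<close> is the group inverse.\<close>

definition gpow :: "int \<Rightarrow> 'r::finite lie \<Rightarrow> 'r lie" where
  "gpow c x = (\<lambda>n. of_int c * x n)"

definition is_wall :: "'r::finite wall \<Rightarrow> bool" where
  "is_wall w \<longleftrightarrow> wnormal w \<in> Nplus_pr \<and>
     rational_polyhedral_cone (wcone w) \<and> wcone w \<subseteq> perp (wnormal w) \<and>
     aff_dim (wcone w) = int CARD('r) - 1 \<and>
     welt w \<in> G_par (wnormal w)"

text \<open>A diagram is a family of walls \<open>W\<close> over an index set \<open>I\<close>, so walls may be repeated.\<close>

definition scattering_diagram :: "'i set \<Rightarrow> ('i \<Rightarrow> 'r::finite wall) \<Rightarrow> bool" where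
  "scattering_diagram I W \<longleftrightarrow> (\<forall>l\<in>I. is_wall (W l)) \<and>
     (\<forall>d. finite {l \<in> I. welt (W l) \<notin> G_gt d})"

definition crossings ::
  "nat \<Rightarrow> 'i set \<Rightarrow> ('i \<Rightarrow> 'r::finite wall) \<Rightarrow> (real \<Rightarrow> real ^ 'r) \<Rightarrow> (real \<times> 'i) set" where
  "crossings d I W \<gamma> =
     {(t, l). t \<in> {0..1} \<and> l \<in> I \<and> welt (W l) \<notin> G_gt d \<and> \<gamma> t \<in> wcone (W l)}"

definition Ncirc :: "('r::finite \<Rightarrow> nat) \<Rightarrow> (int ^ 'r) set" where
  "Ncirc \<delta> = {n. \<forall>i. int (\<delta> i) dvd n $ i}"

locale fixed_data =
  fixes \<omega> :: "int ^ 'r::finite \<Rightarrow> int ^ 'r \<Rightarrow> rat"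
    and \<delta> :: "'r \<Rightarrow> nat"
  assumes add_left: "\<omega> (a + b) c = \<omega> a c + \<omega> b c"
    and add_right: "\<omega> a (b + c) = \<omega> a b + \<omega> a c"
    and skew: "\<omega> a b = - \<omega> b a"
    and \<delta>_pos: "0 < \<delta> i"
    and integral: "a \<in> Ncirc \<delta> \<Longrightarrow> \<omega> a b \<in> \<int>"
begin

definition bmat :: "'r \<Rightarrow> 'r \<Rightarrow> rat" where
  "bmat i j = \<omega> (int (\<delta> i) *s seed i) (seed j)"

definition \<delta>\<^sub>0 :: nat where
  "\<delta>\<^sub>0 = Lcm (range \<delta>)"

definition frac_lattice :: "rat set" where
  "frac_lattice = {b. of_nat \<delta>\<^sub>0 * b \<in> \<int>}"

definition ndelta :: "int ^ 'r \<Rightarrow> rat" where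
  "ndelta n = (LEAST d. 0 < d \<and> (\<exists>m\<in>Ncirc \<delta>. \<forall>i. of_int (m $ i) = d * of_int (n $ i)))"

definition pstar :: "int ^ 'r \<Rightarrow> real ^ 'r" where
  "pstar n = (\<chi> i. of_rat (\<omega> (seed i) n))"

text \<open>\<open>q\<^sup>\<alpha> = t\<^bsup>\<delta>\<^sub>0 \<alpha>\<^esup>\<close>, meant for \<open>\<alpha> \<in> frac_lattice\<close>, where \<open>\<delta>\<^sub>0 \<alpha>\<close> is an integer.\<close>

definition qpow :: "rat \<Rightarrow> coeff" where
  "qpow \<alpha> = Fract [:0, 1:] 1 powi \<lfloor>of_nat \<delta>\<^sub>0 * \<alpha>\<rfloor>"

definition qnum :: "rat \<Rightarrow> coeff" where
  "qnum \<alpha> = (qpow \<alpha> - qpow (- \<alpha>)) / (qpow 1 - qpow (- 1))"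

definition bracket :: "'r lie \<Rightarrow> 'r lie \<Rightarrow> 'r lie" where
  "bracket x y = (\<lambda>n. \<Sum>(a, b) | a \<in> Nplus \<and> b \<in> Nplus \<and> a + b = n. x a * y b * qnum (\<omega> a b))"

fun nested_bracket :: "'r lie list \<Rightarrow> 'r lie" where
  "nested_bracket [] = (\<lambda>_. 0)"
| "nested_bracket [x] = x"
| "nested_bracket (x # y # zs) = bracket x (nested_bracket (y # zs))"

text \<open>
  The Baker--Campbell--Hausdorff series in Dynkin's form,
  \<open>\<Sum> (-1)\<^bsup>k-1\<^esup>/k \<cdot> [x\<^bsup>r\<^sub>1\<^esup> y\<^bsup>s\<^sub>1\<^esup> \<dots> x\<^bsup>r\<^sub>k\<^esup> y\<^bsup>s\<^sub>k\<^esup>] / ((\<Sum>i. r\<^sub>i + s\<^sub>i) \<Prod>i. r\<^sub>i! s\<^sub>i!)\<close>,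
  summed over all \<open>k \<ge> 1\<close> and all \<open>(r\<^sub>i, s\<^sub>i)\<close> with \<open>r\<^sub>i + s\<^sub>i > 0\<close>, with right-nested brackets.
  Elements of \<open>ghat\<close> start in degree \<open>1\<close>, so words longer than \<open>deg n\<close> have no \<open>X\<^sub>n\<close>-component
  and the sum in each component is finite.
\<close>

definition gmult :: "'r lie \<Rightarrow> 'r lie \<Rightarrow> 'r lie" where
  "gmult x y = (\<lambda>n. \<Sum>ps | ps \<noteq> [] \<and> (\<forall>(r, s)\<in>set ps. 0 < r + s) \<and>
                         (\<Sum>(r, s)\<leftarrow>ps. r + s) \<le> deg n.
     (- 1) ^ (length ps - 1) / of_nat (length ps) *
     nested_bracket (concat (map (\<lambda>(r, s). replicate r x @ replicate s y) ps)) n /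
     (of_nat (\<Sum>(r, s)\<leftarrow>ps. r + s) * (\<Prod>(r, s)\<leftarrow>ps. fact r * fact s)))"

definition gcong :: "nat \<Rightarrow> 'r lie \<Rightarrow> 'r lie \<Rightarrow> bool" where
  "gcong l x y \<longleftrightarrow> gmult (gpow (- 1) x) y \<in> G_gt l"

text \<open>For \<open>n \<noteq> 0\<close> at most one \<open>j\<close> contributes to each component.\<close>

definition Psi :: "rat \<Rightarrow> rat \<Rightarrow> int ^ 'r \<Rightarrow> 'r lie" where
  "Psi a b n = (\<lambda>m. \<Sum>j::nat | 1 \<le> j \<and> m = int j *s n.
     (- 1) ^ (j + 1) / (of_nat j * qnum (of_nat j * a)) * qpow (of_nat j * b))"

definition incoming :: "'r wall \<Rightarrow> bool" where
  "incoming w \<longleftrightarrow> pstar (wnormal w) \<in> wcone w"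

text \<open>
  The path-ordered product in \<open>G\<^bsup>\<le>d\<^esup>\<close> involves the finitely many crossings of walls whose
  element is nontrivial there, listed by increasing time; \<open>fold\<close> puts later factors to the left.
  For an admissible curve the walls crossed at the same time have the same normal vector, hence
  commuting elements, and their order is immaterial.
\<close>

definition path_prod_upto ::
  "nat \<Rightarrow> 'i set \<Rightarrow> ('i \<Rightarrow> 'r wall) \<Rightarrow> (real \<Rightarrow> real ^ 'r) \<Rightarrow> 'r lie" where
  "path_prod_upto d I W \<gamma> =
     fold (\<lambda>(t, l). gmult (gpow (crossing_sign \<gamma> t (wnormal (W l))) (welt (W l))))
       (SOME cs. distinct cs \<and> set cs = crossings d I W \<gamma> \<and> sorted (map fst cs)) gone"

text \<open>
  The element of \<open>G\<close>, the inverse limit of the \<open>G\<^bsup>\<le>d\<^esup>\<close>, with these images: its \<open>X\<^sub>n\<close>-component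
  can be read off in \<open>G\<^bsup>\<le>d\<^esup>\<close> for \<open>d = deg n\<close>.
\<close>

definition path_prod ::
  "'i set \<Rightarrow> ('i \<Rightarrow> 'r wall) \<Rightarrow> (real \<Rightarrow> real ^ 'r) \<Rightarrow> 'r lie" where
  "path_prod I W \<gamma> = (\<lambda>n. path_prod_upto (deg n) I W \<gamma> n)"

definition consistent :: "'i set \<Rightarrow> ('i \<Rightarrow> 'r wall) \<Rightarrow> bool" where
  "consistent I W \<longleftrightarrow> (\<forall>\<gamma>. admissible I W \<gamma> \<and> \<gamma> 0 = \<gamma> 1 \<longrightarrow> path_prod I W \<gamma> = gone)"

definition initial_wall :: "'r \<Rightarrow> 'r wall" where
  "initial_wall i = \<lparr>wcone = perp (seed i), welt = Psi (1 / of_nat (\<delta> i)) 0 (seed i), wnormal = seed i\<rparr>"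

text \<open>Each initial wall occurs exactly once in the family, and no other wall is incoming.\<close>

definition initial_incoming :: "'i set \<Rightarrow> ('i \<Rightarrow> 'r wall) \<Rightarrow> bool" where
  "initial_incoming I W \<longleftrightarrow> bij_betw W {l \<in> I. incoming (W l)} (range initial_wall)"

definition qcsd :: "'i set \<Rightarrow> ('i \<Rightarrow> 'r wall) \<Rightarrow> bool" where
  "qcsd I W \<longleftrightarrow> scattering_diagram I W \<and> consistent I W \<and> initial_incoming I W"

definition positive_element :: "'r lie \<Rightarrow> bool" where
  "positive_element g \<longleftrightarrow>
     (\<exists>n\<in>Nplus. \<exists>b\<in>frac_lattice. \<exists>c>0. g = gpow c (Psi (1 / ndelta n) b n))"

end

end

theory Submission
  imports Defs
begin


text \<open>
  Up to degree 4 the Lie algebra embeds, via \<open>X\<^sub>n \<mapsto> x\<^sup>n / (q - q\<^sup>-\<^sup>1)\<close>, into a quantum torus with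
  \<open>x y = q\<^bsup>2w\<^esup> y x\<close>, where \<open>w = {e\<^sub>i, e\<^sub>j} > 0\<close>, and there the truncated Baker--Campbell--Hausdorff
  product becomes the product of exponentials. In rank 2 every wall is a line or a ray, and consistency
  along one circle around the origin says that
  \<open>\<Psi>[e\<^sub>i] \<Psi>[e\<^sub>j] = \<Psi>[e\<^sub>j] F\<^sub>1\<^sub>3 F\<^sub>1\<^sub>2 F\<^sub>1\<^sub>1 F\<^sub>2\<^sub>1 F\<^sub>3\<^sub>1 \<Psi>[e\<^sub>i]\<close> modulo degree 5, where \<open>F\<^sub>a\<^sub>b\<close> collects the
  outgoing walls with normal vector \<open>a e\<^sub>i + b e\<^sub>j\<close>. In normally ordered monomials \<open>y\<^sup>b x\<^sup>a\<close> this is a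
  triangular system, whose solution is: with \<open>r = q\<^bsup>1/\<delta>\<^sub>i\<^esup>\<close>, \<open>s = q\<^bsup>1/\<delta>\<^sub>j\<^esup>\<close>, \<open>q\<^sup>w = r\<^sup>b = s\<^sup>c\<close>,
  the coefficient of \<open>X\<^bsub>(k,1)\<^esub>\<close> is the quantum binomial \<open>[b, k]\<^sub>r / [1/\<delta>\<^sub>j]\<^sub>q\<close>, symmetrically for
  \<open>(1,k)\<close>, and that of \<open>X\<^bsub>(2,2)\<^esub>\<close> is \<open>([b, 2]\<^sub>r [2c - 1]\<^sub>s - [b]\<^sub>r\<^sup>2 / 2) / [2/\<delta>\<^sub>j]\<^sub>q\<close>.
  If \<open>\<delta>\<^sub>i\<close> divides \<open>\<delta>\<^sub>j\<close>, then after multiplication by \<open>[1/\<delta>(n)]\<^sub>q\<close> (and, for \<open>(2,2)\<close>, after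
  subtraction of the contribution of the walls \<open>\<Psi>[(1,1)]\<close>) these are Laurent polynomials in
  \<open>q\<^bsup>1/\<delta>\<^sub>0\<^esup>\<close> with coefficients in \<open>\<nat>\<close>; each monomial is one wall of the new diagram.
\<close>


section \<open>Truncated skew power series\<close>

text \<open>The group law \<open>gmult\<close> is given only as a Dynkin series. In degrees up to 4
  it is an explicit Lie polynomial, which the truncated exponential, injective on series without
  constant term, turns into the product of a ring; associativity and inverses are then those of the
  ring. A path-ordered product depends only on the sum of the wall elements over each crossed ray,
  and the incoming rays carry the initial walls alone, so a diagram with the right sums on the
  outgoing rays already has the same path-ordered products modulo \<open>G_gt 4\<close>.
  Divisibility makes t = q^(1/\<delta>_0) equal to q^(1/\<delta>_j) or q^(1/\<delta>_i), so the
  denominators are quantum integers in t and in t^m, where m is the quotient of the two \<delta>'s.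
  The normalisation 1/\<delta>(n) cancels a factor [2] or [3] exactly when 2 or 3 divides m;
  otherwise the cancellation is a matter of parity and residues modulo 3. At (2,2) the walls
  Psi[(1,1)] contribute with a negative sign and with t^2 in place of t; taking them out leaves a
  quantum binomial times [2c - 1] - 1.\<close>

text \<open>
  Series \<open>\<Sum> f\<^sub>a\<^sub>b y\<^sup>b x\<^sup>a\<close> modulo total degree 5, multiplied with \<open>x y = c y x\<close>. A type cannot depend on
  \<open>c\<close>, so an element is a family of such series, one for every value of \<open>c\<close>.
\<close>

typedef (overloaded) 'a skew = "{f :: nat \<Rightarrow> nat \<Rightarrow> 'a::field_char_0 \<Rightarrow> 'a. \<forall>i j. 4 < i + j \<longrightarrow> f i j = (\<lambda>_. 0)}"
  morphisms cmp Abs_skew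
  by (rule exI[of _ "\<lambda>_ _ _. 0"]) simp

setup_lifting type_definition_skew

lemma cmp_large: "4 < i + j \<Longrightarrow> cmp f i j c = 0"
  using cmp[of f] by auto

lemma skew_eqI: "(\<And>i j c. i + j \<le> 4 \<Longrightarrow> cmp f i j c = cmp g i j c) \<Longrightarrow> f = g"
  by (metis cmp_large cmp_inject ext not_le)

instantiation skew :: (field_char_0) ring_1
begin

lift_definition zero_skew :: "'a skew" is "\<lambda>_ _ _. 0" by simp
lift_definition one_skew :: "'a skew" is "\<lambda>i j _. if i = 0 \<and> j = 0 then 1 else 0" by auto
lift_definition plus_skew :: "'a skew \<Rightarrow> 'a skew \<Rightarrow> 'a skew" is "\<lambda>f g i j c. f i j c + g i j c" by simp
lift_definition minus_skew :: "'a skew \<Rightarrow> 'a skew \<Rightarrow> 'a skew" is "\<lambda>f g i j c. f i j c - g i j c" by simp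
lift_definition uminus_skew :: "'a skew \<Rightarrow> 'a skew" is "\<lambda>f i j c. - f i j c" by simp
text \<open>Normal ordering: moving x^a to the right past y^(j - b) costs the factor
  \<open>c ^ (a * (j - b))\<close>.\<close>

lift_definition times_skew :: "'a skew \<Rightarrow> 'a skew \<Rightarrow> 'a skew" is
  "\<lambda>f g i j c. if i + j \<le> 4
     then \<Sum>a=0..i. \<Sum>b=0..j. f a b c * g (i - a) (j - b) c * c ^ (a * (j - b)) else 0"
  by auto

instance
proof
  fix f g h :: "'a skew"
  show "f * g * h = f * (g * h)"
  proof (rule skew_eqI)
    fix i j :: nat and c :: 'a assume ij: "i + j \<le> 4"
    \<comment> \<open>Both triple products carry this exponent: one factor \<open>c\<close> for
      every x that stands to the left of a y of a later factor.\<close>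
    define G where "G a1 a2 a3 b1 b2 b3 = cmp f a1 b1 c * cmp g a2 b2 c * cmp h a3 b3 c *
        c ^ (a1 * b2 + a1 * b3 + a2 * b3)" for a1 a2 a3 b1 b2 b3
    have "cmp (f * g * h) i j c = (\<Sum>a=0..i. \<Sum>b=0..j. (\<Sum>a'=0..a. \<Sum>b'=0..b. 
       G a' (a - a') (i - a) b' (b - b') (j - b)))"
    proof -
      have **: "a * (j - b) = a' * (j - b) + (a - a') * (j - b)" if "a' \<le> a" for a a' b
        using that by (simp add: add_mult_distrib[symmetric])
      have *: "b + d - b' = b - b' + d" if "b' \<le> b" for b b' d :: nat using that by simp
      have ***: "x + y \<le> 4" if "x \<le> i" "y \<le> j" for x y using that ij by simp
      show ?thesis
        using ij *** unfolding times_skew.rep_eq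
        by (auto simp: G_def sum_distrib_left sum_distrib_right power_add ** mult_ac intro!: sum.cong)
    qed
    \<comment> \<open>The two indices are reassociated one after the other, each by the one-variable
      lemma for power series.\<close>
    also have "\<dots> = (\<Sum>a=0..i. \<Sum>a'=0..a. \<Sum>b=0..j. \<Sum>b'=0..b. G a' (a - a') (i - a) b' (b - b') (j - b))"
      by (rule sum.cong[OF refl], rule sum.swap)
    also have "\<dots> = (\<Sum>a=0..i. \<Sum>a'=0..i-a. \<Sum>b=0..j. \<Sum>b'=0..b. G a a' (i - a - a') b' (b - b') (j - b))"
      by (rule fps_mult_assoc_lemma[of "\<lambda>x y z. \<Sum>b=0..j. \<Sum>b'=0..b. G x y z b' (b - b') (j - b)"])
    also have "\<dots> = (\<Sum>a=0..i. \<Sum>a'=0..i-a. \<Sum>b=0..j. \<Sum>b'=0..j-b. G a a' (i - a - a') b b' (j - b - b'))"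
      by (intro sum.cong refl fps_mult_assoc_lemma[of "G _ _ _"])
    also have "\<dots> = (\<Sum>a=0..i. \<Sum>b=0..j. \<Sum>a'=0..i-a. \<Sum>b'=0..j-b. G a a' (i - a - a') b b' (j - b - b'))"
      by (rule sum.cong[OF refl], rule sum.swap)
    also have "\<dots> = cmp (f * (g * h)) i j c"
    proof -
      have *: "i - a + (j - b) \<le> 4" for a b using ij by simp
      have **: "a * (j - b) = a * b' + a * (j - b - b')" if "b' \<le> j - b" for a b b'
        using that by (metis add_mult_distrib2 le_add_diff_inverse)
      show ?thesis
        using ij * unfolding times_skew.rep_eq
        by (auto simp: G_def sum_distrib_left sum_distrib_right power_add ** mult_ac intro!: sum.cong)
    qed
    finally show "cmp (f * g * h) i j c = cmp (f * (g * h)) i j c" .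
  qed
  have delta: "(\<Sum>a=0..i. \<Sum>b=0..j. if a = p \<and> b = q then g a b else 0) = g p q"
    if "p \<le> i" "q \<le> j" for i j p q and g :: "nat \<Rightarrow> nat \<Rightarrow> 'a"
  proof -
    have "(\<Sum>a=0..i. \<Sum>b=0..j. if a = p \<and> b = q then g a b else 0) =
        (\<Sum>a=0..i. if a = p then g p q else 0)"
      using that by (intro sum.cong) (auto simp: sum.delta)
    then show ?thesis using that by simp
  qed
  show "1 * f = f"
  proof (rule skew_eqI)
    fix i j :: nat and c :: 'a assume "i + j \<le> 4"
    then have "cmp (1 * f) i j c = (\<Sum>a=0..i. \<Sum>b=0..j. if a = 0 \<and> b = 0 then cmp f i j c else 0)"
      by (auto simp: times_skew.rep_eq one_skew.rep_eq intro!: sum.cong)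
    then show "cmp (1 * f) i j c = cmp f i j c" using delta[of 0 i 0 j] by simp
  qed
  show "f * 1 = f"
  proof (rule skew_eqI)
    fix i j :: nat and c :: 'a assume "i + j \<le> 4"
    then have "cmp (f * 1) i j c = (\<Sum>a=0..i. \<Sum>b=0..j. if a = i \<and> b = j then cmp f a b c else 0)"
      by (auto simp: times_skew.rep_eq one_skew.rep_eq intro!: sum.cong)
    then show "cmp (f * 1) i j c = cmp f i j c" using delta[of i i j j] by simp
  qed
  show "(0::'a skew) \<noteq> 1"
    by (metis one_skew.rep_eq zero_skew.rep_eq zero_neq_one)
qed (auto intro!: skew_eqI simp: plus_skew.rep_eq zero_skew.rep_eq minus_skew.rep_eq uminus_skew.rep_eq
   times_skew.rep_eq algebra_simps sum.distrib)

end

lemmas cmp_simps [simp] = zero_skew.rep_eq one_skew.rep_eq plus_skew.rep_eq minus_skew.rep_eq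
  uminus_skew.rep_eq

lemma cmp_times:
  "i + j \<le> 4 \<Longrightarrow> cmp (f * g) i j c =
     (\<Sum>a=0..i. \<Sum>b=0..j. cmp f a b c * cmp g (i - a) (j - b) c * c ^ (a * (j - b)))"
  by (simp add: times_skew.rep_eq)

lift_definition skscale :: "'a::field_char_0 \<Rightarrow> 'a skew \<Rightarrow> 'a skew" is "\<lambda>k f i j c. k * f i j c"
  by simp

lemmas cmp_skscale [simp] = skscale.rep_eq

lemma skscale_simps [simp]:
  "skscale k f * g = skscale k (f * g)" "f * skscale k g = skscale k (f * g)"
  "skscale k (skscale l f) = skscale (k * l) f" "skscale 1 f = f" "skscale k 0 = 0"
  "skscale (- 1) f = - f" "skscale 0 f = 0"
  by (auto intro!: skew_eqI simp: times_skew.rep_eq sum_distrib_left mult_ac)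

lemma skscale_distribs:
  "skscale k (f + g) = skscale k f + skscale k g" "skscale k (f - g) = skscale k f - skscale k g"
  "skscale k (- f) = - skscale k f"
  by (auto intro!: skew_eqI simp: algebra_simps)

text \<open>Filtration by total degree. Truncation makes \<open>hi 5\<close> zero, so degree
  estimates above 4 become vanishing statements.\<close>

definition hi :: "nat \<Rightarrow> 'a::field_char_0 skew set" where
  "hi k = {f. \<forall>i j c. i + j < k \<longrightarrow> cmp f i j c = 0}"

lemma hi_0 [simp]: "f \<in> hi 0"
  by (simp add: hi_def)

lemma hi_5_iff: "f \<in> hi 5 \<longleftrightarrow> f = 0"
  by (auto simp: hi_def intro!: skew_eqI)

lemma hi_mono: "f \<in> hi k \<Longrightarrow> l \<le> k \<Longrightarrow> f \<in> hi l"
  by (auto simp: hi_def)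

lemma hi_linear [simp]:
  "0 \<in> hi k" "f \<in> hi k \<Longrightarrow> g \<in> hi k \<Longrightarrow> f + g \<in> hi k" "f \<in> hi k \<Longrightarrow> g \<in> hi k \<Longrightarrow> f - g \<in> hi k"
  "f \<in> hi k \<Longrightarrow> - f \<in> hi k" "f \<in> hi k \<Longrightarrow> skscale a f \<in> hi k"
  by (auto simp: hi_def)

lemma hi_times: "f \<in> hi k \<Longrightarrow> g \<in> hi l \<Longrightarrow> f * g \<in> hi (k + l)"
proof -
  assume f: "f \<in> hi k" and g: "g \<in> hi l"
  have "cmp f a b c * cmp g (i - a) (j - b) c = 0" if "i + j < k + l" "a \<le> i" "b \<le> j" for i j a b c
  proof (cases "a + b < k")
    case True then show ?thesis using f by (simp add: hi_def)
  next
    case False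
    then have "i - a + (j - b) < l" using that by linarith
    then show ?thesis using g by (simp add: hi_def)
  qed
  then show ?thesis
    by (auto simp: hi_def times_skew.rep_eq intro!: sum.neutral)
qed

lemma hi_times_ge: "f \<in> hi k \<Longrightarrow> g \<in> hi l \<Longrightarrow> m \<le> k + l \<Longrightarrow> f * g \<in> hi m"
  using hi_times hi_mono by blast

lemma hi_times_0: "f \<in> hi k \<Longrightarrow> g \<in> hi l \<Longrightarrow> 5 \<le> k + l \<Longrightarrow> f * g = 0"
  using hi_times_ge hi_5_iff by blast

section \<open>The truncated exponential and the Baker-Campbell-Hausdorff formula\<close>

text \<open>On \<open>hi 1\<close>, where fifth powers vanish, this is the full exponential.\<close>

definition texp :: "'a::field_char_0 skew \<Rightarrow> 'a skew" where
  "texp u = 1 + u + skscale (1/2) (u * u) + skscale (1/6) (u * (u * u)) +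
     skscale (1/24) (u * (u * (u * u)))"

lemma texp_0 [simp]: "texp 0 = 1"
  by (simp add: texp_def)

text \<open>Simplifier rules for right-nested products: every further factor of positive order
  raises the order by one, and words of length five vanish.\<close>

lemma hi_step_rules:
  assumes "z \<in> hi k" "1 \<le> k"
  shows "f \<in> hi 1 \<Longrightarrow> z * f \<in> hi 2" "f \<in> hi 2 \<Longrightarrow> z * f \<in> hi 3" "f \<in> hi 3 \<Longrightarrow> z * f \<in> hi 4"
    "f \<in> hi 4 \<Longrightarrow> z * f = 0" "z * f \<in> hi 1"
  using assms hi_times_ge[OF assms(1), of f] hi_times_0[OF assms(1), of f] hi_times_ge[OF assms(1) hi_0] by auto

text \<open>Sorts the exponential by order, so that the Baker-Campbell-Hausdorff identity can be
  compared order by order; \<open>z1\<close> to \<open>z4\<close> will be its parts of word length 1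
  to 4.\<close>

lemma texp_graded_sum:
  assumes z1: "z1 \<in> hi 1" and z2: "z2 \<in> hi 2" and z3: "z3 \<in> hi 3" and z4: "z4 \<in> hi 4"
  shows "texp (z1 + z2 + z3 + z4) = 1 + z1 + (z2 + skscale (1/2) (z1 * z1)) +
    (z3 + skscale (1/2) (z1 * z2 + z2 * z1) + skscale (1/6) (z1 * (z1 * z1))) +
    (z4 + skscale (1/2) (z1 * z3 + z3 * z1 + z2 * z2) +
     skscale (1/6) (z1 * (z1 * z2) + z1 * (z2 * z1) + z2 * (z1 * z1)) +
     skscale (1/24) (z1 * (z1 * (z1 * z1))))"
proof -
  note mem = z1 z2 z3 z4 hi_mono[OF z2, of 1] hi_mono[OF z3, of 1]
    hi_mono[OF z3, of 2] hi_mono[OF z4, of 1] hi_mono[OF z4, of 2]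
    hi_mono[OF z4, of 3]
  have up: "f \<in> hi 1 \<Longrightarrow> z2 * f \<in> hi 3" "f \<in> hi 2 \<Longrightarrow> z2 * f \<in> hi 4" "f \<in> hi 1 \<Longrightarrow> z3 * f \<in> hi 4"
    "f \<in> hi 3 \<Longrightarrow> z2 * f = 0" "f \<in> hi 2 \<Longrightarrow> z3 * f = 0" "f \<in> hi 1 \<Longrightarrow> z4 * f = 0" "z2 * f \<in> hi 2" "z3 * f \<in> hi 2" "z3 * f \<in> hi 3"
    "z3 * f \<in> hi 1" for f
    using hi_times_ge[OF z2, of f] hi_times_ge[OF z3, of f] hi_times_ge[OF z2 hi_0] hi_times_ge[OF z3 hi_0]
      hi_times_0[OF z2, of f] hi_times_0[OF z3, of f] hi_times_0[OF z4, of f] by auto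
  show ?thesis
    by (simp add: texp_def distrib_left distrib_right skscale_distribs mem up
        hi_step_rules[OF z1] hi_step_rules[OF z2] add_ac del: One_nat_def)
qed

text \<open>Dynkin's form of the Baker--Campbell--Hausdorff series through degree 4, before using the Jacobi identity.\<close>

definition bch4 :: "'a::field_char_0 skew \<Rightarrow> 'a skew \<Rightarrow> 'a skew" where
  "bch4 u v = (let B = u * v - v * u; C = u * B - B * u; D = v * B - B * v in
     u + v + skscale (1/2) B + skscale (1/12) (C - D) -
     skscale (1/48) ((u * D - D * u) + (v * C - C * v)))"

lemma texp_bch4:
  assumes u: "u \<in> hi 1" and v: "v \<in> hi 1"
  shows "texp (bch4 u v) = texp u * texp v"
proof -
  define B where "B = u * v - v * u"
  define C where "C = u * B - B * u"
  define D where "D = v * B - B * v"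
  have B: "B \<in> hi 2" unfolding B_def by (simp add: u v hi_step_rules[OF u] hi_step_rules[OF v] del: One_nat_def)
  have C: "C \<in> hi 3" unfolding C_def using hi_times_ge[OF u B, of 3] hi_times_ge[OF B u, of 3] by simp
  have D: "D \<in> hi 3" unfolding D_def using hi_times_ge[OF v B, of 3] hi_times_ge[OF B v, of 3] by simp
  have E: "(u * D - D * u) + (v * C - C * v) \<in> hi 4"
    using hi_times_ge[OF v C, of 4] hi_times_ge[OF C v, of 4] hi_times_ge[OF u D, of 4]
      hi_times_ge[OF D u, of 4] by simp
  have bch: "bch4 u v = (u + v) + skscale (1/2) B + skscale (1/12) (C - D) +
     skscale (-1/48) ((u * D - D * u) + (v * C - C * v))"
    by (auto intro!: skew_eqI simp: bch4_def B_def C_def D_def Let_def)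
  have pr: "texp u * texp v = 1 + (u + v) + (skscale (1/2) (u * u) + u * v + skscale (1/2) (v * v)) +
     (skscale (1/6) (u * (u * u)) + skscale (1/2) (u * (u * v)) + skscale (1/2) (u * (v * v)) + skscale (1/6) (v * (v * v)))
     + (skscale (1/24) (u * (u * (u * u))) + skscale (1/6) (u * (u * (u * v))) + skscale (1/4) (u * (u * (v * v))) +
      skscale (1/6) (u * (v * (v * v))) + skscale (1/24) (v * (v * (v * v))))"
    by (simp add: texp_def distrib_left distrib_right mult.assoc u v skscale_distribs hi_step_rules[OF u] hi_step_rules[OF v] add_ac del: One_nat_def)
  show ?thesis
    unfolding bch
    apply (subst texp_graded_sum)
    using u v B C D E apply (auto simp del: mult_minus1_right simp: hi_linear)[4]
    unfolding pr B_def C_def D_def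
    apply (simp add: algebra_simps skscale_distribs)
    \<comment> \<open>Both sides are combinations of the same associative words in \<open>u\<close>
      and \<open>v\<close>; in components the rational multiples become field multiplications that
      can be collected.\<close>
    apply (rule skew_eqI)
    apply (simp add: field_simps)
    done
qed

lemma bch4_commute: "u * v = v * u \<Longrightarrow> bch4 u v = u + v"
  by (simp add: bch4_def)

lemma texp_add: "u \<in> hi 1 \<Longrightarrow> v \<in> hi 1 \<Longrightarrow> u * v = v * u \<Longrightarrow> texp (u + v) = texp u * texp v"
  using texp_bch4 bch4_commute by metis

lemma hi_ideal: "f \<in> hi k \<Longrightarrow> f * g \<in> hi k" "f \<in> hi k \<Longrightarrow> g * f \<in> hi k"
  using hi_times_ge[of f k g 0 k] hi_times_ge[of g 0 f k k] by auto

lemma hi_times_cong: "f - f' \<in> hi k \<Longrightarrow> g - g' \<in> hi k \<Longrightarrow> f * g - f' * g' \<in> hi k"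
proof -
  assume "f - f' \<in> hi k" "g - g' \<in> hi k"
  then have "(f - f') * g + f' * (g - g') \<in> hi k"
    by (intro hi_linear(2) hi_ideal(1)[of "f - f'"] hi_ideal(2)[of "g - g'"])
  then show ?thesis by (simp add: algebra_simps)
qed

lemma texp_diff:
  "texp u - texp v = (u - v) + (skscale (1/2) (u * u - v * v) +
     (skscale (1/6) (u * (u * u) - v * (v * v)) + skscale (1/24) (u * (u * (u * u)) - v * (v * (v * v)))))"
  by (simp add: texp_def skscale_distribs)

lemma texp_cong: "u - v \<in> hi k \<Longrightarrow> texp u - texp v \<in> hi k"
  unfolding texp_diff by (intro hi_linear(2) hi_linear(5) hi_times_cong)

text \<open>Induction on the order: if \<open>u\<close> and \<open>v\<close> agree modulo
  \<open>hi l\<close>, their higher powers agree modulo \<open>hi (Suc l)\<close>, since each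
  additional factor has positive order; the linear terms must then agree there too.\<close>

lemma texp_inj_mod:
  assumes u: "u \<in> hi 1" and v: "v \<in> hi 1" and e: "texp u - texp v \<in> hi k"
  shows "u - v \<in> hi k"
proof -
  have "u - v \<in> hi l" if "l \<le> k" for l
    using that
  proof (induction l)
    case (Suc l)
    then have d: "u - v \<in> hi l" by simp
    have step: "u * f - v * g \<in> hi (Suc l)" if "f - g \<in> hi l" "f \<in> hi 1" for f g
    proof -
      have "(u - v) * f + v * (f - g) \<in> hi (Suc l)"
        using hi_times[OF d that(2)] hi_times[OF v that(1)] by simp
      then show ?thesis by (simp add: algebra_simps)
    qed
    have down: "f \<in> hi (Suc l) \<Longrightarrow> f \<in> hi l" for f :: "'a skew" using hi_mono by fastforce
    have 1: "u * u - v * v \<in> hi (Suc l)" by (rule step[OF d u])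
    have 2: "u * (u * u) - v * (v * v) \<in> hi (Suc l)"
      by (rule step[OF down[OF 1]]) (rule hi_ideal(1)[OF u])
    have 3: "u * (u * (u * u)) - v * (v * (v * v)) \<in> hi (Suc l)"
      by (rule step[OF down[OF 2]]) (rule hi_ideal(1)[OF u])
    have "texp u - texp v \<in> hi (Suc l)" using e Suc.prems hi_mono by blast
    then have "(texp u - texp v) - (skscale (1/2) (u * u - v * v) + (skscale (1/6) (u * (u * u) - v * (v * v)) +
        skscale (1/24) (u * (u * (u * u)) - v * (v * (v * v))))) \<in> hi (Suc l)"
      using 1 2 3 by simp
    then show ?case unfolding texp_diff by simp
  qed simp
  then show ?thesis by blast
qed

lemma texp_inj: "u \<in> hi 1 \<Longrightarrow> v \<in> hi 1 \<Longrightarrow> texp u = texp v \<Longrightarrow> u = v"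
  using texp_inj_mod[of u v 5] hi_5_iff[of "u - v"] by simp

section \<open>Products of exponentials along a list of crossing times\<close>

lemma hi_sum: "(\<And>p. p \<in> S \<Longrightarrow> f p \<in> hi k) \<Longrightarrow> sum f S \<in> hi k"
  by (induction S rule: infinite_finite_induct) auto

lemma fold_texp_commuting:
  assumes "distinct L" and "\<And>p. p \<in> set L \<Longrightarrow> A p \<in> hi 1"
    and "\<And>p q. p \<in> set L \<Longrightarrow> q \<in> set L \<Longrightarrow> A p * A q = A q * A p"
  shows "fold (\<lambda>p acc. texp (A p) * acc) L z = texp (sum A (set L)) * z"
  using assms
proof (induction L arbitrary: z)
  case (Cons p L)
  have "sum A (set L) * A p = A p * sum A (set L)"
    unfolding sum_distrib_left sum_distrib_right using Cons.prems by (intro sum.cong) auto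
  moreover have "sum A (set L) \<in> hi 1" using Cons.prems by (intro hi_sum) auto
  ultimately have "texp (sum A (set L) + A p) = texp (sum A (set L)) * texp (A p)"
    using Cons.prems by (intro texp_add) auto
  then show ?case using Cons by (simp add: mult.assoc add.commute)
qed simp

lemma sorted_split_first:
  assumes "sorted (map f cs)" "\<forall>p\<in>set cs. t \<le> f p"
  shows "cs = filter (\<lambda>p. f p = t) cs @ filter (\<lambda>p. f p \<noteq> t) cs"
  using assms
proof (induction cs)
  case (Cons p cs)
  show ?case
  proof (cases "f p = t")
    case False
    then have "\<forall>q\<in>set cs. f q \<noteq> t" using Cons.prems by fastforce
    then show ?thesis using False by (simp add: filter_empty_conv filter_id_conv)
  qed (use Cons in simp)
qed simp

text \<open>\<open>ts\<close> may list more times than occur in \<open>cs\<close>: an empty sum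
  contributes \<open>texp 0\<close>, which is 1. Thus several diagrams and truncation levels can
  share one list of times.\<close>

lemma fold_texp_group_by_time:
  fixes f :: "'p \<Rightarrow> 't::linorder"
  assumes "sorted (map f cs)" "distinct cs" "sorted ts" "distinct ts" "f ` set cs \<subseteq> set ts"
    and "\<And>p. p \<in> set cs \<Longrightarrow> A p \<in> hi 1"
    and "\<And>p q. p \<in> set cs \<Longrightarrow> q \<in> set cs \<Longrightarrow> f p = f q \<Longrightarrow> A p * A q = A q * A p"
  shows "fold (\<lambda>p acc. texp (A p) * acc) cs z =
    fold (\<lambda>t acc. texp (\<Sum>p | p \<in> set cs \<and> f p = t. A p) * acc) ts z"
  using assms
proof (induction ts arbitrary: cs z)
  case (Cons t ts)
  let ?L = "filter (\<lambda>p. f p = t) cs" and ?R = "filter (\<lambda>p. f p \<noteq> t) cs"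
  have "\<forall>p\<in>set cs. t \<le> f p" using Cons.prems(3,5) by (auto simp: image_subset_iff)
  then have cs: "cs = ?L @ ?R" using sorted_split_first Cons.prems(1) by blast
  have L: "fold (\<lambda>p acc. texp (A p) * acc) ?L z = texp (sum A (set ?L)) * z"
    using Cons.prems by (intro fold_texp_commuting) auto
  have "fold (\<lambda>p acc. texp (A p) * acc) ?R z' =
      fold (\<lambda>t acc. texp (\<Sum>p | p \<in> set ?R \<and> f p = t. A p) * acc) ts z'" for z'
    using Cons.prems by (intro Cons.IH) (auto simp: sorted_filter)
  also have "\<dots> z' = fold (\<lambda>t acc. texp (\<Sum>p | p \<in> set cs \<and> f p = t. A p) * acc) ts z'" for z'
  proof (rule fold_cong[OF refl refl])
    fix x assume "x \<in> set ts"
    then have "{p. p \<in> set ?R \<and> f p = x} = {p. p \<in> set cs \<and> f p = x}" using Cons.prems(4) by auto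
    then show "(\<lambda>acc. texp (\<Sum>p | p \<in> set ?R \<and> f p = x. A p) * acc) =
      (\<lambda>acc. texp (\<Sum>p | p \<in> set cs \<and> f p = x. A p) * acc)" by simp
  qed
  finally show ?case by (subst cs) (simp add: L)
qed simp

lemma fold_times_cong_mod:
  assumes "\<And>t. t \<in> set ts \<Longrightarrow> g t - h t \<in> hi k" "z - z' \<in> hi k"
  shows "fold (\<lambda>t acc. g t * acc) ts z - fold (\<lambda>t acc. h t * acc) ts z' \<in> hi k"
  using assms by (induction ts arbitrary: z z') (auto intro: hi_times_cong)

section \<open>Positivity of quantum integers and binomials\<close>

locale generic_parameter =
  fixes t :: "'a::field_char_0"
  assumes nonzero: "t \<noteq> 0" and not_root_of_unity: "0 < n \<Longrightarrow> t ^ n \<noteq> 1"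
begin

text \<open>The quantum integer \<open>[n]\<close> in \<open>t\<^sup>k\<close> is \<open>br (k * n) / br k\<close>.\<close>

definition br :: "nat \<Rightarrow> 'a" where
  "br n = t ^ n - inverse (t ^ n)"

text \<open>Laurent polynomials with natural coefficients are kept as lists of exponents with
  repetition, because every list entry later becomes one wall.\<close>

definition laurent_sum :: "int list \<Rightarrow> 'a" where
  "laurent_sum es = (\<Sum>e\<leftarrow>es. t powi e)"

definition laurent_pos :: "'a set" where
  "laurent_pos = range laurent_sum"

lemma br_0 [simp]: "br 0 = 0"
  by (simp add: br_def)

lemma br_nonzero [simp]: "0 < n \<Longrightarrow> br n \<noteq> 0"
proof
  assume n: "0 < n" and "br n = 0"
  then have "t ^ n * t ^ n = 1" using nonzero by (simp add: br_def field_simps)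
  then have "t ^ (n + n) = 1" by (simp add: power_add)
  then show False using not_root_of_unity[of "n + n"] n by simp
qed

lemma br_add: "br (a + b) = t ^ a * t ^ b - 1 / (t ^ a * t ^ b)"
  by (simp add: br_def power_add divide_inverse)

lemma br_diff: "b \<le> a \<Longrightarrow> br (a - b) = t ^ a / t ^ b - t ^ b / t ^ a"
  using nonzero by (simp add: br_def power_diff)

lemma br_double: "br (2 * m) = t ^ m * t ^ m - 1 / (t ^ m * t ^ m)"
  by (simp add: br_def mult_2 power_add divide_inverse)

lemma br_triple: "br (3 * m) = t ^ m * t ^ m * t ^ m - 1 / (t ^ m * t ^ m * t ^ m)"
  by (simp add: br_def numeral_3_eq_3 power_add divide_inverse mult_ac)

lemma laurent_pos_add: "x \<in> laurent_pos \<Longrightarrow> y \<in> laurent_pos \<Longrightarrow> x + y \<in> laurent_pos"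
proof -
  assume "x \<in> laurent_pos" "y \<in> laurent_pos"
  then obtain es es' where "x = laurent_sum es" "y = laurent_sum es'" by (auto simp: laurent_pos_def)
  then have "x + y = laurent_sum (es @ es')" by (simp add: laurent_sum_def)
  then show ?thesis by (simp add: laurent_pos_def)
qed

lemma laurent_pos_0 [simp]: "0 \<in> laurent_pos"
  by (auto simp: laurent_pos_def laurent_sum_def intro!: range_eqI[of _ _ "[]"])

lemma laurent_pos_powi [simp]: "t powi e \<in> laurent_pos"
  by (auto simp: laurent_pos_def laurent_sum_def intro!: range_eqI[of _ _ "[e]"])

lemma laurent_pos_power [simp]: "t ^ n \<in> laurent_pos" "inverse (t ^ n) \<in> laurent_pos"
  using laurent_pos_powi[of "int n"] laurent_pos_powi[of "- int n"] by (simp_all add: power_int_minus)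

lemma laurent_pos_mult:
  assumes "x \<in> laurent_pos" "y \<in> laurent_pos"
  shows "x * y \<in> laurent_pos"
proof -
  obtain es es' where xy: "x = laurent_sum es" "y = laurent_sum es'"
    using assms by (auto simp: laurent_pos_def)
  have shift: "t powi e * laurent_sum es' = laurent_sum (map ((+) e) es')" for e
    using nonzero by (simp add: laurent_sum_def sum_list_const_mult[symmetric] power_int_add o_def)
  have "laurent_sum es * laurent_sum es' \<in> laurent_pos"
  proof (induction es)
    case (Cons e es)
    have "laurent_sum (e # es) * laurent_sum es' = t powi e * laurent_sum es' + laurent_sum es * laurent_sum es'"
      by (simp add: laurent_sum_def distrib_right)
    then show ?case using Cons shift laurent_pos_add by (metis laurent_pos_def rangeI)
  qed (simp add: laurent_sum_def)
  then show ?thesis using xy by simp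
qed

lemma br_multiple_Suc: "br (k * Suc n) = t ^ k * br (k * n) + inverse (t ^ (k * n)) * br k"
  using nonzero by (simp add: br_def power_add field_simps)

text \<open>The same list has to give both expansions: the walls Psi[(1,1)] built from
  \<open>es\<close> contribute at (2,2) with \<open>t\<close> replaced by its square.\<close>

lemma quantum_integer_expansion:
  assumes "0 < k"
  obtains es where "laurent_sum es = br (k * n) / br k"
    "(\<Sum>e\<leftarrow>es. t powi (2 * e)) = br (2 * k * n) / br (2 * k)"
proof -
  have "\<exists>es. laurent_sum es = br (k * n) / br k \<and>
      (\<Sum>e\<leftarrow>es. t powi (2 * e)) = br (2 * k * n) / br (2 * k)"
  proof (induction n)
    case 0
    show ?case by (rule exI[of _ "[]"]) (simp add: laurent_sum_def)
  next
    case (Suc n)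
    then obtain es where es: "laurent_sum es = br (k * n) / br k"
      "(\<Sum>e\<leftarrow>es. t powi (2 * e)) = br (2 * k * n) / br (2 * k)" by blast
    \<comment> \<open>[n + 1] is [n] shifted by \<open>k\<close> plus its lowest monomial, of
      exponent \<open>- k * n\<close>.\<close>
    let ?es = "- int (k * n) # map ((+) (int k)) es"
    have "laurent_sum ?es = inverse (t ^ (k * n)) + t ^ k * laurent_sum es"
      using nonzero
      by (simp add: laurent_sum_def power_int_minus power_int_add o_def sum_list_const_mult del: of_nat_mult)
    also have "\<dots> = br (k * Suc n) / br k"
      unfolding es br_multiple_Suc using assms by (simp add: field_simps)
    finally have 1: "laurent_sum ?es = br (k * Suc n) / br k" .
    have "(\<Sum>e\<leftarrow>?es. t powi (2 * e)) = t powi (- int (2 * k * n)) + t powi int (2 * k) * (\<Sum>e\<leftarrow>es. t powi (2 * e))"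
      using nonzero by (simp add: o_def distrib_left power_int_add sum_list_const_mult mult.assoc)
    also have "\<dots> = br (2 * k * Suc n) / br (2 * k)"
      unfolding es br_multiple_Suc[of "2 * k"] using assms
      by (simp only: power_int_minus power_int_of_nat) (simp add: field_simps)
    finally show ?case using 1 by blast
  qed
  then show ?thesis using that by blast
qed

lemma quantum_integer_pos: "k dvd n \<Longrightarrow> 0 < k \<Longrightarrow> br n / br k \<in> laurent_pos"
  by (metis dvdE laurent_pos_def quantum_integer_expansion rangeI)

text \<open>One of \<open>n\<close> and \<open>n - 1\<close> is even and absorbs
  \<open>br (2 * p)\<close>; the other absorbs \<open>br p\<close>.\<close>

lemma quantum_binomial2_pos:
  assumes "0 < p"
  shows "br (p * n) * br (p * (n - 1)) / (br p * br (2 * p)) \<in> laurent_pos"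
proof (cases "even n")
  case True
  then have "br (p * n) / br (2 * p) * (br (p * (n - 1)) / br p) \<in> laurent_pos"
    using assms by (intro laurent_pos_mult quantum_integer_pos) (auto simp: mult.commute)
  then show ?thesis by (simp add: mult_ac)
next
  case False
  then have "br (p * n) / br p * (br (p * (n - 1)) / br (2 * p)) \<in> laurent_pos"
    using assms by (intro laurent_pos_mult quantum_integer_pos) (auto simp: mult.commute)
  then show ?thesis by (simp add: mult_ac)
qed

lemma quantum_binomial3_pos:
  assumes "0 < p"
  shows "br (p * n) * br (p * (n - 1)) * br (p * (n - 2)) / (br p * br (2 * p) * br (3 * p)) \<in> laurent_pos"
proof (induction n)
  case (Suc n)
  show ?case
  proof (cases "n < 2")
    \<comment> \<open>A factor \<open>br 0\<close> occurs here. In the other case the truncated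
      subtractions are genuine and the Pascal rule applies.\<close>
    case True
    then have "n = 0 \<or> n = 1" by auto
    then show ?thesis by auto
  next
    case False
    define x where "x = t ^ p"
    define y where "y = t ^ (p * (n - 2))"
    have xy: "x \<noteq> 0" "y \<noteq> 0" using nonzero by (auto simp: x_def y_def)
    have n: "p * Suc n = p * (n - 2) + (p + p + p)"
    proof -
      obtain k where "n = k + 2" using False by (metis add.commute le_Suc_ex not_less)
      then show ?thesis by (simp add: algebra_simps)
    qed
    \<comment> \<open>This is the balanced Pascal rule [n + 1, 3] = x^3 [n, 3] + y^-1 [n, 2] with
      the common factors removed.\<close>
    have key: "br (p * Suc n) = x ^ 3 * br (p * (n - 2)) + inverse y * br (3 * p)"
      unfolding n br_add br_triple power_add x_def[symmetric] y_def[symmetric]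
        br_def[of "p * (n - 2)"] using xy by (simp add: power3_eq_cube field_simps)
    have "br (p * Suc n) * br (p * n) * br (p * (n - 1)) / (br p * br (2 * p) * br (3 * p)) =
      t ^ (p * 3) * (br (p * n) * br (p * (n - 1)) * br (p * (n - 2)) / (br p * br (2 * p) * br (3 * p))) +
      inverse (t ^ (p * (n - 2))) * (br (p * n) * br (p * (n - 1)) / (br p * br (2 * p)))"
      unfolding key using assms by (simp add: x_def y_def field_simps power_mult)
    also have "\<dots> \<in> laurent_pos"
      by (intro laurent_pos_add laurent_pos_mult laurent_pos_power Suc.IH quantum_binomial2_pos assms)
    finally show ?thesis by simp
  qed
qed simp

text \<open>\<open>br (2 * m) / br m\<close> is t^m + t^-m, and multiplying \<open>br n\<close> by
  it gives \<open>br (n + m) + br (n - m)\<close>. Both indices are even, and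
  \<open>m \<le> n\<close> makes the difference genuine.\<close>

lemma odd_pair_pos:
  assumes "odd m" "odd n" "m \<le> n"
  shows "br (2 * m) * br n / (br m * br 2) \<in> laurent_pos"
proof -
  have m: "0 < m" using assms(1) odd_pos by blast
  have "br (2 * m) * br n = br m * (br (n + m) + br (n - m))"
    using nonzero unfolding br_add br_diff[OF assms(3)] br_double
    by (simp add: br_def field_simps)
  then have "br (2 * m) * br n / (br m * br 2) = br (n + m) / br 2 + br (n - m) / br 2"
    using m by (simp add: add_divide_distrib)
  also have "\<dots> \<in> laurent_pos"
    using assms by (intro laurent_pos_add quantum_integer_pos) auto
  finally show ?thesis .
qed

text \<open>For odd \<open>b\<close> the number \<open>m * b - 1\<close> is even and the two
  quotients split. For even \<open>b\<close>, \<open>br (2 * m)\<close> divides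
  \<open>br (m * b)\<close> and \<open>odd_pair_pos\<close> treats the rest.\<close>

lemma rational_binomial2_pos:
  assumes "odd m"
  shows "br (m * b) * br (m * b - 1) / (br m * br 2) \<in> laurent_pos"
proof (cases "even b")
  case False
  then have "br (m * b) / br m * (br (m * b - 1) / br 2) \<in> laurent_pos"
    using assms odd_pos by (intro laurent_pos_mult quantum_integer_pos) auto
  then show ?thesis by simp
next
  case True
  show ?thesis
  proof (cases "b = 0")
    case False
    have m: "0 < m" using assms odd_pos by blast
    have b: "b \<ge> 2" using True False by (metis dvd_imp_le neq0_conv)
    then have "m * 2 \<le> m * b" by simp
    then have "m \<le> m * b - 1" using m by linarith
    moreover have "odd (m * b - 1)" using True False m by simp
    ultimately have "br (m * b) / br (2 * m) * (br (2 * m) * br (m * b - 1) / (br m * br 2)) \<in> laurent_pos"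
      using assms True m by (intro laurent_pos_mult quantum_integer_pos odd_pair_pos) (auto simp: mult.commute)
    then show ?thesis using m by simp
  qed simp
qed

text \<open>An odd \<open>a\<close> leaves \<open>b\<close> even, so \<open>br 3\<close> and
  \<open>br 2\<close> divide separately. A nonzero even \<open>a\<close> is divisible by 6, and
  \<open>odd_pair_pos\<close> is applied to 3 and \<open>b\<close>.\<close>

lemma pair_over_2_3_pos:
  assumes "3 dvd a" "odd (a + b)" "a = 0 \<or> 3 \<le> b \<or> odd a"
  shows "br a * br b / (br 2 * br 3) \<in> laurent_pos"
proof (cases "odd a")
  case True
  then have "br a / br 3 * (br b / br 2) \<in> laurent_pos"
    using assms by (intro laurent_pos_mult quantum_integer_pos) auto
  then show ?thesis by (simp add: mult_ac)
next
  case False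
  show ?thesis
  proof (cases "a = 0")
    case a: False
    have "6 dvd a" using assms(1) False by presburger
    then have "br a / br 6 * (br (2 * 3) * br b / (br 3 * br 2)) \<in> laurent_pos"
      using assms a False by (intro laurent_pos_mult quantum_integer_pos odd_pair_pos) auto
    then show ?thesis by (simp add: mult_ac)
  qed simp
qed

text \<open>\<open>c\<close> witnesses the opposite parity of \<open>a\<close> and \<open>b\<close>;
  the last hypothesis excludes the bad case \<open>b = 1\<close> with \<open>a\<close> even and
  nonzero.\<close>

lemma pair_over_2_3_pos':
  assumes "3 dvd a" "a + b + 1 = 2 * c" "a \<le> b + 1 \<or> 3 dvd b"
  shows "br a * br b / (br 2 * br 3) \<in> laurent_pos"
proof (rule pair_over_2_3_pos[OF assms(1)])
  have "even (a + b + 1)" unfolding assms(2) by simp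
  then show o: "odd (a + b)" by simp
  obtain d where d: "a = 3 * d" using assms(1) by blast
  show "a = 0 \<or> 3 \<le> b \<or> odd a"
  proof (cases "d \<le> 1")
    case True
    then have "d = 0 \<or> d = 1" by auto
    then show ?thesis using d by auto
  next
    case False
    show ?thesis using assms(3)
    proof
      assume "3 dvd b"
      then have "b = 0 \<or> 3 \<le> b" by (auto dest: dvd_imp_le)
      then show ?thesis using o by auto
    qed (use False d in linarith)
  qed
qed

text \<open>If 3 does not divide \<open>b\<close>, it does not divide \<open>m * b\<close>, hence
  divides one of the two numbers below it, and \<open>br (m * b) / br m\<close> splits off. If 3
  divides \<open>b\<close>, then \<open>br (3 * m)\<close> divides \<open>br (m * b)\<close>, and
  the factor \<open>br (3 * m) / br m\<close> = x^2 + 1 + x^-2 has to be combined with the two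
  remaining ones.\<close>

lemma rational_binomial3_pos:
  assumes "\<not> 3 dvd m"
  shows "br (m * b) * br (m * b - 1) * br (m * b - 2) / (br m * br 2 * br 3) \<in> laurent_pos"
proof (cases "3 dvd b")
  case False
  have m: "0 < m" using assms by (metis dvd_0_right neq0_conv)
  define n where "n = m * b"
  have n3: "\<not> 3 dvd n" using assms False by (simp add: n_def prime_dvd_mult_iff)
  have "br (n - 1) * br (n - 2) / (br 2 * br 3) \<in> laurent_pos"
  proof (cases "n = 1")
    case n1: False
    show ?thesis
    proof (cases "3 dvd n - 1")
      case True
      have "n \<noteq> 0" using n3 by (metis dvd_0_right)
      then show ?thesis using n1 by (intro pair_over_2_3_pos'[OF True, of _ "n - 1"]) auto
    next
      case False
      then have "3 dvd n - 2" using n3 by presburger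
      moreover have "n \<noteq> 0" using n3 by (metis dvd_0_right)
      ultimately have "br (n - 2) * br (n - 1) / (br 2 * br 3) \<in> laurent_pos"
        using n1 by (intro pair_over_2_3_pos'[of "n - 2" "n - 1" "n - 1"]) auto
      then show ?thesis by (simp add: mult.commute)
    qed
  qed simp
  then have "br n / br m * (br (n - 1) * br (n - 2) / (br 2 * br 3)) \<in> laurent_pos"
    using m by (intro laurent_pos_mult quantum_integer_pos) (auto simp: n_def)
  then show ?thesis by (simp add: n_def mult_ac)
next
  case True
  show ?thesis
  proof (cases "b = 0")
    case False
    have m: "0 < m" using assms by (metis dvd_0_right neq0_conv)
    define N where "N = m * b - 1"
    have b3: "3 \<le> b" using True False by (simp add: dvd_imp_le)
    then have "m * 3 \<le> m * b" by simp
    then have N: "3 * m \<le> N + 1" "m * b = N + 1" using m by (auto simp: N_def)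
    have "3 dvd m * b" using True by simp
    then have N3: "3 dvd N + 1" using N by simp
    define x where "x = t ^ m"
    define y where "y = t ^ N"
    have xy: "x \<noteq> 0" "y \<noteq> 0" using nonzero by (auto simp: x_def y_def)
    have b1: "br (3 * m) = br m * (x ^ 2 + 1 + 1 / x ^ 2)"
      using xy by (simp add: br_def x_def power_mult mult.commute[of 3] field_simps power2_eq_square power3_eq_cube)
    have le: "1 \<le> N" "2 * m \<le> N" "m \<le> N" "1 + m \<le> N" using N m by linarith+
    have f: "br (N + m) = y * x - 1 / (y * x)" "br (N - (1 + m)) = y / (t * x) - t * x / y"
      "br (N + m - 1) = y * x / t - t / (y * x)" "br (N - 2 * m) = y / (x * x) - x * x / y"
      "br (N - 1) = y / t - t / y" "br N = y - 1 / y" "br (N - m) = y / x - x / y"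
      using br_diff[OF le(1)] br_diff[OF le(2)] br_diff[OF le(3)] br_diff[OF le(4)] br_diff[of 1 "N + m"] le(1)
      by (simp_all add: br_add br_def[of N] x_def y_def power_add mult_2 inverse_eq_divide)
    \<comment> \<open>\<open>br a * br b = C (a + b) - C (a - b)\<close> with \<open>C k = t^k + t^-k\<close>: expand the product into three
      positive and three negative \<open>C\<close>'s and pair them up so that every pair is some
      \<open>br a * br b\<close> with \<open>a\<close> divisible by 3.\<close>
    have "(x ^ 2 + 1 + 1 / x ^ 2) * (br N * br (N - 1)) / (br 2 * br 3) \<in> laurent_pos"
    proof (cases "3 dvd m + 2")
      \<comment> \<open>\<open>N\<close> is 2 modulo 3 and \<open>m\<close> is 1, so 3 divides
        \<open>N + m\<close>, \<open>N - 2 * m\<close> and \<open>N - (1 + m)\<close>; each of the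
        three products contains one of these.\<close>
      case m1: True
      have "(x ^ 2 + 1 + 1 / x ^ 2) * (br N * br (N - 1)) =
        br (N + m) * br (N - (1 + m)) + br (N + m) * br (N + m - 1) + br (N - 2 * m) * br (N - 1)"
        unfolding f using xy nonzero by (simp add: field_simps power2_eq_square)
      moreover have "br (N + m) * br (N - (1 + m)) / (br 2 * br 3) \<in> laurent_pos"
        "br (N + m) * br (N + m - 1) / (br 2 * br 3) \<in> laurent_pos"
        "br (N - 2 * m) * br (N - 1) / (br 2 * br 3) \<in> laurent_pos"
      proof -
        obtain k where k: "m + 2 = 3 * k" using m1 by blast
        obtain l where l: "N + 1 = 3 * l" using N3 by blast
        have "N + m = 3 * (k + l - 1)" "N - 2 * m = 3 * (l + 1 - 2 * k)" "N - (1 + m) = 3 * (l - k)"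
          using k l le m by linarith+
        then have d: "3 dvd N + m" "3 dvd N - 2 * m" "3 dvd N - (1 + m)" by auto
        show "br (N + m) * br (N - (1 + m)) / (br 2 * br 3) \<in> laurent_pos"
          by (rule pair_over_2_3_pos'[OF d(1), of _ N]) (use d le in auto)
        show "br (N + m) * br (N + m - 1) / (br 2 * br 3) \<in> laurent_pos"
          by (rule pair_over_2_3_pos'[OF d(1), of _ "N + m"]) (use le in auto)
        show "br (N - 2 * m) * br (N - 1) / (br 2 * br 3) \<in> laurent_pos"
          by (rule pair_over_2_3_pos'[OF d(2), of _ "N - m"]) (use le in auto)
      qed
      ultimately show ?thesis by (simp add: add_divide_distrib laurent_pos_add)
    next
      case m1: False
      \<comment> \<open>Now \<open>m\<close> is 2 modulo 3, and the multiples of 3 are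
        \<open>N - m\<close>, \<open>N + m - 1\<close> and \<open>N - (1 + 2 * m)\<close>. The last
        difference is genuine because \<open>m\<close> is at least 2.\<close>
      have m2: "3 dvd m + 1" using assms m1 by presburger
      have l: "1 + 2 * m \<le> N" using le(2,4) m2 m N(1) by presburger
      have "(x ^ 2 + 1 + 1 / x ^ 2) * (br N * br (N - 1)) =
        br (N - m) * br (N + m - 1) + br (N + m - 1) * br (N + m) + br (N - (1 + 2 * m)) * br N"
      proof -
        have g: "br (N - (1 + 2 * m)) = y / (t * x * x) - t * x * x / y"
          using br_diff[OF l] by (simp add: x_def y_def power_add mult_2 mult.assoc)
        show ?thesis unfolding f g using xy nonzero by (simp add: field_simps power2_eq_square)
      qed
      moreover have "br (N - m) * br (N + m - 1) / (br 2 * br 3) \<in> laurent_pos"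
        "br (N + m - 1) * br (N + m) / (br 2 * br 3) \<in> laurent_pos"
        "br (N - (1 + 2 * m)) * br N / (br 2 * br 3) \<in> laurent_pos"
      proof -
        obtain k where k: "m + 1 = 3 * k" using m2 by blast
        obtain l' where l': "N + 1 = 3 * l'" using N3 by blast
        have "N - m = 3 * (l' - k)" "N + m - 1 = 3 * (k + l' - 1)" "N - (1 + 2 * m) = 3 * (l' - 2 * k)"
          using k l' l le m by linarith+
        then have d: "3 dvd N - m" "3 dvd N + m - 1" "3 dvd N - (1 + 2 * m)" by auto
        show "br (N - m) * br (N + m - 1) / (br 2 * br 3) \<in> laurent_pos"
          by (rule pair_over_2_3_pos'[OF d(1), of _ N]) (use l in auto)
        show "br (N + m - 1) * br (N + m) / (br 2 * br 3) \<in> laurent_pos"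
          by (rule pair_over_2_3_pos'[OF d(2), of _ "N + m"]) (use le in auto)
        show "br (N - (1 + 2 * m)) * br N / (br 2 * br 3) \<in> laurent_pos"
          by (rule pair_over_2_3_pos'[OF d(3), of _ "N - m"]) (use l in auto)
      qed
      ultimately show ?thesis by (simp add: add_divide_distrib laurent_pos_add)
    qed
    then have "br (m * b) / br (3 * m) * ((x ^ 2 + 1 + 1 / x ^ 2) * (br N * br (N - 1)) / (br 2 * br 3)) \<in> laurent_pos"
      using True m by (intro laurent_pos_mult quantum_integer_pos) (auto simp: mult.commute)
    also have "br (m * b) / br (3 * m) * ((x ^ 2 + 1 + 1 / x ^ 2) * (br N * br (N - 1)) / (br 2 * br 3)) =
       br (m * b) * br (m * b - 1) * br (m * b - 2) / (br m * br 2 * br 3)"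
    proof -
      have "br m * (x ^ 2 + 1 + 1 / x ^ 2) \<noteq> 0" unfolding b1[symmetric] using m by simp
      then show ?thesis unfolding b1 by (simp add: N_def numeral_2_eq_2 mult.assoc)
    qed
    finally show ?thesis .
  qed simp
qed

text \<open>The difference factors as (t^c + t^-c) [c - 1].\<close>

lemma quantum_odd_minus_one_pos:
  assumes "0 < c"
  shows "br (2 * c - 1) / br 1 - 1 \<in> laurent_pos"
proof -
  have c: "1 \<le> 2 * c" "1 \<le> c" using assms by auto
  have "br (2 * c - 1) - br 1 = (t ^ c + inverse (t ^ c)) * br (c - 1)"
    unfolding br_diff[OF c(1)] br_diff[OF c(2)] unfolding mult_2 power_add using nonzero by (simp add: br_def field_simps)
  then have "br (2 * c - 1) / br 1 - 1 = (t ^ c + inverse (t ^ c)) * (br (c - 1) / br 1)"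
    by (simp add: field_simps)
  also have "\<dots> \<in> laurent_pos"
    by (intro laurent_pos_mult laurent_pos_add laurent_pos_power quantum_integer_pos) auto
  finally show ?thesis .
qed

end

section \<open>The Baker--Campbell--Hausdorff product up to degree 4\<close>

lemma Nplus_add: "a \<in> Nplus \<Longrightarrow> b \<in> Nplus \<Longrightarrow> a + b \<in> Nplus"
  by (auto simp: Nplus_def sum.distrib)

lemma deg_add: "a \<in> Nplus \<Longrightarrow> b \<in> Nplus \<Longrightarrow> deg (a + b) = deg a + deg b"
  by (auto simp: Nplus_def deg_def sum.distrib nat_add_distrib)

lemma deg_pos: "a \<in> Nplus \<Longrightarrow> 0 < deg a"
  by (auto simp: Nplus_def deg_def)

section \<open>Enumeration of the Dynkin words\<close>

text \<open>Index lists of Dynkin's series with word length at most \<open>k\<close>. The empty list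
  is kept for the recursion; its Dynkin term is 0.\<close>

definition weighted_lists :: "nat \<Rightarrow> (nat \<times> nat) list set" where
  "weighted_lists k = {ps. (\<forall>(r, s)\<in>set ps. 0 < r + s) \<and> (\<Sum>(r, s)\<leftarrow>ps. r + s) \<le> k}"

definition weighted_pairs :: "nat \<Rightarrow> (nat \<times> nat) set" where
  "weighted_pairs k = {(r, s). 0 < r + s \<and> r + s \<le> k}"

lemma finite_weighted_pairs [simp]: "finite (weighted_pairs k)"
  by (rule finite_subset[of _ "{..k} \<times> {..k}"]) (auto simp: weighted_pairs_def)

lemma weighted_lists_unfold:
  "weighted_lists k = insert [] (\<Union>p\<in>weighted_pairs k. (#) p ` weighted_lists (k - (fst p + snd p)))"
proof (rule set_eqI)
  fix ps show "ps \<in> weighted_lists k \<longleftrightarrow>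
    ps \<in> insert [] (\<Union>p\<in>weighted_pairs k. (#) p ` weighted_lists (k - (fst p + snd p)))"
    by (cases ps) (auto simp: weighted_lists_def weighted_pairs_def image_iff)
qed

lemma finite_weighted_lists [simp]: "finite (weighted_lists k)"
proof (induction k rule: less_induct)
  case (less k)
  have "finite (weighted_lists (k - (fst p + snd p)))" if "p \<in> weighted_pairs k" for p
    using that by (intro less) (auto simp: weighted_pairs_def)
  then show ?case by (subst weighted_lists_unfold) auto
qed

text \<open>Recursion on the first pair, by which the simplifier enumerates the terms.\<close>

lemma sum_weighted_lists:
  "sum f (weighted_lists k) =
     f [] + (\<Sum>p\<in>weighted_pairs k. \<Sum>ps\<in>weighted_lists (k - (fst p + snd p)). f (p # ps))"
proof -
  have "sum f (weighted_lists k) = f [] + sum f (\<Union>p\<in>weighted_pairs k. (#) p ` weighted_lists (k - (fst p + snd p)))"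
    by (subst weighted_lists_unfold, subst sum.insert) auto
  also have "sum f (\<Union>p\<in>weighted_pairs k. (#) p ` weighted_lists (k - (fst p + snd p))) =
    (\<Sum>p\<in>weighted_pairs k. sum f ((#) p ` weighted_lists (k - (fst p + snd p))))"
    by (rule sum.UNION_disjoint) auto
  finally show ?thesis by (simp add: sum.reindex)
qed

lemma weighted_pairs_Suc:
  "weighted_pairs (Suc k) = weighted_pairs k \<union> (\<lambda>r. (r, Suc k - r)) ` {..Suc k}"
  by (auto simp: weighted_pairs_def image_iff)

lemma weighted_pairs_numerals:
  "weighted_pairs 0 = {}" "weighted_pairs 1 = {(0,1),(1,0)}"
  "weighted_pairs 2 = {(0,1),(1,0),(0,2),(1,1),(2,0)}"
  "weighted_pairs 3 = {(0,1),(1,0),(0,2),(1,1),(2,0),(0,3),(1,2),(2,1),(3,0)}"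
  "weighted_pairs 4 = {(0,1),(1,0),(0,2),(1,1),(2,0),(0,3),(1,2),(2,1),(3,0),(0,4),(1,3),(2,2),(3,1),(4,0)}" (is ?g1)
proof -
  show 0: "weighted_pairs 0 = {}" by (auto simp: weighted_pairs_def)
  show 1: "weighted_pairs 1 = {(0,1),(1,0)}"
    using weighted_pairs_Suc[of 0] 0 by (auto simp: atMost_Suc)
  have "weighted_pairs 2 = weighted_pairs 1 \<union> {(0,2),(1,1),(2,0)}"
    using weighted_pairs_Suc[of 1] by (simp add: atMost_Suc numeral_2_eq_2 insert_commute)
  then show 2: "weighted_pairs 2 = {(0,1),(1,0),(0,2),(1,1),(2,0)}" using 1 by auto
  have "weighted_pairs 3 = weighted_pairs 2 \<union> {(0,3),(1,2),(2,1),(3,0)}"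
    using weighted_pairs_Suc[of 2] by (simp add: atMost_Suc numeral_eq_Suc insert_commute)
  then show 3: "weighted_pairs 3 = {(0,1),(1,0),(0,2),(1,1),(2,0),(0,3),(1,2),(2,1),(3,0)}" using 2 by auto
  have "weighted_pairs 4 = weighted_pairs 3 \<union> {(0,4),(1,3),(2,2),(3,1),(4,0)}"
    using weighted_pairs_Suc[of 3] by (simp add: atMost_Suc numeral_eq_Suc insert_commute)
  then show ?g1
    using 3 by auto
qed

lemma length_dynkin_word:
  "length (concat (map (\<lambda>(r, s). replicate r x @ replicate s y) ps)) = (\<Sum>(r, s)\<leftarrow>ps. r + s)"
  by (induction ps) auto

lemma set_dynkin_word:
  assumes "x \<in> A" "y \<in> A"
  shows "set (concat (map (\<lambda>(r, s). replicate r x @ replicate s y) ps)) \<subseteq> A"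
proof -
  have "set (replicate r x) \<subseteq> A" "set (replicate r y) \<subseteq> A" for r
    using assms by (induction r) auto
  then show ?thesis
    by (induction ps) (simp_all only: list.map concat.simps case_prod_beta set_append Un_subset_iff
        list.set empty_subsetI simp_thms)
qed

context fixed_data
begin

lemma omega_self: "\<omega> a a = 0"
  using skew[of a a] by simp

lemma qnum_0 [simp]: "qnum 0 = 0"
  by (simp add: qnum_def)

lemma qnum_minus: "qnum (- a) = - qnum a"
  by (simp add: qnum_def minus_divide_left)

lemma bracket_skew: "bracket y x = (\<lambda>n. - bracket x y n)"
proof
  fix n
  have "bracket y x n = (\<Sum>(a, b) | b \<in> Nplus \<and> a \<in> Nplus \<and> b + a = n. y b * x a * qnum (\<omega> b a))"
    unfolding bracket_def
    by (rule sum.reindex_bij_witness[of _ prod.swap prod.swap]) (auto simp: prod.swap_def)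
  also have "\<dots> = (\<Sum>(a, b) | a \<in> Nplus \<and> b \<in> Nplus \<and> a + b = n. - (x a * y b * qnum (\<omega> a b)))"
    by (rule sum.cong) (auto simp: add.commute skew[of _ "fst _"] qnum_minus[symmetric] mult_ac,
       metis mult_minus_right qnum_minus skew)
  finally show "bracket y x n = - bracket x y n" by (simp add: bracket_def sum_negf case_prod_unfold)
qed

lemma bracket_self: "bracket x x = (\<lambda>_. 0)"
proof
  fix n show "bracket x x n = 0" using fun_cong[OF bracket_skew[of x x], of n] by simp
qed

lemma bracket_zero: "bracket x (\<lambda>_. 0) = (\<lambda>_. 0)" "bracket (\<lambda>_. 0) x = (\<lambda>_. 0)"
  by (auto simp: bracket_def)

lemma bracket_in_ghat: "bracket x y \<in> ghat"
  unfolding ghat_def bracket_def by (auto intro!: sum.neutral simp: Nplus_add)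

lemma nested_bracket_in_ghat: "set ws \<subseteq> ghat \<Longrightarrow> nested_bracket ws \<in> ghat"
  by (cases ws rule: nested_bracket.cases) (auto simp: bracket_in_ghat, simp add: ghat_def)

text \<open>Brackets add degrees, and every entry starts in degree 1.\<close>

lemma nested_bracket_degree:
  assumes "set ws \<subseteq> ghat" "deg n < length ws"
  shows "nested_bracket ws n = 0"
  using assms
proof (induction ws arbitrary: n rule: nested_bracket.induct)
  case (2 x)
  then have "n \<notin> Nplus" using deg_pos by fastforce
  then show ?case using 2 by (simp add: ghat_def)
next
  case (3 x y zs)
  have "nested_bracket (y # zs) b = 0" if "a \<in> Nplus" "b \<in> Nplus" "a + b = n" for a b
    using that 3(2,3) deg_add[OF that(1,2)] deg_pos[OF that(1)] by (intro "3.IH") auto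
  then show ?case by (auto simp: bracket_def intro!: sum.neutral)
qed simp

definition dynkin_term :: "'r lie \<Rightarrow> 'r lie \<Rightarrow> int ^ 'r \<Rightarrow> (nat \<times> nat) list \<Rightarrow> coeff" where
  "dynkin_term x y n ps = (- 1) ^ (length ps - 1) / of_nat (length ps) *
     nested_bracket (concat (map (\<lambda>(r, s). replicate r x @ replicate s y) ps)) n /
     (of_nat (\<Sum>(r, s)\<leftarrow>ps. r + s) * (\<Prod>(r, s)\<leftarrow>ps. fact r * fact s))"

text \<open>Words longer than \<open>deg n\<close> contribute 0, so one index set serves all
  components of degree at most \<open>k\<close>.\<close>

lemma gmult_dynkin_terms:
  assumes "x \<in> ghat" "y \<in> ghat" "deg n \<le> k"
  shows "gmult x y n = sum (dynkin_term x y n) (weighted_lists k)"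
proof -
  let ?S = "{ps. ps \<noteq> [] \<and> (\<forall>(r, s)\<in>set ps. 0 < r + s) \<and> (\<Sum>(r, s)\<leftarrow>ps. r + s) \<le> deg n}"
  have "dynkin_term x y n ps = 0" if "ps \<in> weighted_lists k - ?S" for ps
  proof -
    have "ps = [] \<or> deg n < (\<Sum>(r, s)\<leftarrow>ps. r + s)" using that by (auto simp: weighted_lists_def)
    moreover have "nested_bracket (concat (map (\<lambda>(r, s). replicate r x @ replicate s y) ps)) n = 0"
      if "deg n < (\<Sum>(r, s)\<leftarrow>ps. r + s)"
      by (rule nested_bracket_degree) (simp_all only: length_dynkin_word set_dynkin_word[OF assms(1,2)] that)
    ultimately show ?thesis by (auto simp: dynkin_term_def)
  qed
  moreover have "?S \<subseteq> weighted_lists k" using assms(3) by (auto simp: weighted_lists_def)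
  ultimately have "sum (dynkin_term x y n) ?S = sum (dynkin_term x y n) (weighted_lists k)"
    by (intro sum.mono_neutral_left) auto
  then show ?thesis by (simp add: gmult_def dynkin_term_def)
qed

lemma gmult_in_ghat:
  assumes "x \<in> ghat" "y \<in> ghat"
  shows "gmult x y \<in> ghat"
proof -
  have "nested_bracket (concat (map (\<lambda>(r, s). replicate r x @ replicate s y) ps)) \<in> ghat" for ps
    by (intro nested_bracket_in_ghat set_dynkin_word assms)
  then have "dynkin_term x y n ps = 0" if "n \<notin> Nplus" for n ps
    using that by (simp add: dynkin_term_def ghat_def)
  then show ?thesis using gmult_dynkin_terms[OF assms order.refl] by (simp add: ghat_def)
qed

lemma replicate_numerals: "replicate 2 x = [x, x]" "replicate 3 x = [x, x, x]" "replicate 4 x = [x, x, x, x]"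
  by (simp_all add: numeral_eq_Suc)

lemma fact_numerals: "fact 3 = (6::coeff)" "fact 4 = (24::coeff)"
  by (simp_all add: fact_numeral)

lemma gmult_degree_4:
  assumes "x \<in> ghat" "y \<in> ghat" "deg n \<le> 4"
  shows "gmult x y n = x n + y n + 1/2 * bracket x y n +
    1/12 * (bracket x (bracket x y) n - bracket y (bracket x y) n) -
    1/48 * (bracket x (bracket y (bracket x y)) n + bracket y (bracket x (bracket x y)) n)"
proof -
  have m: "bracket z (\<lambda>m. - f m) = (\<lambda>m. - bracket z f m)" for z f
    by (auto simp: bracket_def sum_negf case_prod_unfold)
  have sk: "bracket y x = (\<lambda>m. - bracket x y m)" by (rule bracket_skew)
  have *: "gmult x y n = sum (dynkin_term x y n) (weighted_lists 4)"
    by (rule gmult_dynkin_terms[OF assms])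
  have w0: "sum f (weighted_lists 0) = f []" for f :: "(nat\<times>nat) list \<Rightarrow> coeff"
    by (subst sum_weighted_lists) (simp add: weighted_pairs_numerals)
  have w1: "sum f (weighted_lists 1) = f [] + f [(1,0)] + f [(0,1)]" for f :: "(nat\<times>nat) list \<Rightarrow> coeff"
    by (subst sum_weighted_lists) (simp add: weighted_pairs_numerals w0 del: One_nat_def)
  note w2 = sum_weighted_lists[of _ 2] and w3 = sum_weighted_lists[of _ 3] and w4 = sum_weighted_lists[of _ 4]
  show ?thesis
    unfolding *
    apply (simp add: w4 w3 w2 w1 w1[unfolded One_nat_def] w0 weighted_pairs_numerals del: One_nat_def)
    \<comment> \<open>Words with innermost bracket [x, x] or [y, y] vanish, and [y, x] becomes -
      [x, y]; a rational combination of brackets nested around [x, y] remains.\<close>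
    apply (simp add: dynkin_term_def replicate_numerals bracket_self bracket_zero sk m fact_numerals)
    apply (simp add: field_simps)
    done
qed

end

section \<open>Rank 2: the image in the quantum torus\<close>

definition tvar :: coeff where
  "tvar = Fract [:0, 1:] 1"

lemma tvar_power: "tvar ^ n = Fract (monom 1 n) 1"
  by (induction n) (simp_all add: tvar_def One_fract_def monom_Suc one_pCons)

global_interpretation tq: generic_parameter tvar
proof
  show "tvar \<noteq> 0" by (simp add: tvar_def Zero_fract_def eq_fract)
  fix n :: nat assume "0 < n"
  then have "monom (1::rat) n \<noteq> 1" by (metis degree_1 degree_monom_eq less_irrefl zero_neq_one)
  then show "tvar ^ n \<noteq> 1" by (simp add: tvar_power One_fract_def eq_fract)
qed

abbreviation "qbr \<equiv> tq.br"

lemma (in fixed_data) omega_zsmult: "\<omega> (k *s a) b = of_int k * \<omega> a b"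
proof -
  have z: "\<omega> 0 b = 0" for b using add_left[of 0 0 b] by simp
  have m: "\<omega> (- a) b = - \<omega> a b" for a b using add_left[of "- a" a b] z by (simp add: eq_neg_iff_add_eq_0)
  have nat: "\<omega> (int n *s a) b = of_nat n * \<omega> a b" for n a b
  proof (induction n)
    case 0
    have "int 0 *s a = 0" by (simp add: vec_eq_iff)
    then show ?case using z by simp
  next
    case (Suc n)
    have "int (Suc n) *s a = int n *s a + a" by (simp add: vec_eq_iff algebra_simps)
    then show ?case using Suc by (simp add: add_left algebra_simps)
  qed
  show ?thesis
  proof (cases "0 \<le> k")
    case True
    then show ?thesis using nat[of "nat k" a b] by simp
  next
    case False
    have "k *s a = - (int (nat (- k)) *s a)" using False by (simp add: vec_eq_iff)
    then show ?thesis using m nat[of "nat (- k)" a b] False by simp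
  qed
qed

lemma (in fixed_data) omega_zsmult_right: "\<omega> a (k *s b) = of_int k * \<omega> a b"
  using omega_zsmult[of k b a] skew[of a "k *s b"] skew[of b a] by simp

text \<open>The two indices are ordered by the sign of the form, so that outgoing rays always lie in one quadrant.\<close>

locale rank2_data = fixed_data \<omega> \<delta> for \<omega> :: "int ^ 2 \<Rightarrow> int ^ 2 \<Rightarrow> rat" and \<delta> :: "2 \<Rightarrow> nat" +
  fixes i j :: 2
  assumes ij: "i \<noteq> j" and omega_pos: "0 < \<omega> (seed i) (seed j)"
begin

abbreviation w :: rat where "w \<equiv> \<omega> (seed i) (seed j)"

lemma index_cases: "k = i \<or> k = j"
  using ij exhaust_2[of i] exhaust_2[of j] exhaust_2[of k] by auto

lemma UNIV_ij: "(UNIV :: 2 set) = {i, j}"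
  using index_cases by auto

lemma sum_ij: "(\<Sum>k\<in>UNIV. f k) = f i + f j"
  unfolding UNIV_ij using ij by simp

lemma all_ij: "(\<forall>k. P k) \<longleftrightarrow> P i \<and> P j"
  using index_cases by metis

definition mk :: "int \<Rightarrow> int \<Rightarrow> int ^ 2" where
  "mk a b = (\<chi> k. if k = i then a else b)"

abbreviation nvec :: "nat \<Rightarrow> nat \<Rightarrow> int ^ 2" where
  "nvec a b \<equiv> mk (int a) (int b)"

lemma mk_nth [simp]: "mk a b $ i = a" "mk a b $ j = b"
  using ij by (auto simp: mk_def)

lemma vec_eq_ij: "x = y \<longleftrightarrow> x $ i = y $ i \<and> x $ j = y $ j"
  by (simp add: vec_eq_iff all_ij)

lemma mk_eq_iff [simp]: "mk a b = mk a' b' \<longleftrightarrow> a = a' \<and> b = b'"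
  by (simp add: vec_eq_ij)

lemma mk_surj: "n = mk (n $ i) (n $ j)"
  by (simp add: vec_eq_ij)

lemma mk_arith [simp]: "mk a b + mk a' b' = mk (a + a') (b + b')" "k *s mk a b = mk (k * a) (k * b)"
  by (simp_all add: vec_eq_ij)

lemma seed_mk: "seed i = mk 1 0" "seed j = mk 0 1"
  using ij by (simp_all add: vec_eq_ij seed_def axis_def)

lemma mk_Nplus [simp]: "mk a b \<in> Nplus \<longleftrightarrow> 0 \<le> a \<and> 0 \<le> b \<and> 0 < a + b"
  by (simp add: Nplus_def all_ij sum_ij)

lemma Nplus_mk: "n \<in> Nplus \<Longrightarrow> \<exists>a b :: nat. n = nvec a b \<and> 0 < a + b"
  by (rule exI[of _ "nat (n $ i)"], rule exI[of _ "nat (n $ j)"])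
     (auto simp: Nplus_def all_ij sum_ij vec_eq_ij)

lemma deg_mk [simp]: "deg (nvec a b) = a + b"
  by (simp add: deg_def sum_ij)

lemma omega_mk: "\<omega> (mk a b) (mk c d) = of_int (a * d - b * c) * w"
proof -
  have "mk a b = a *s seed i + b *s seed j" "mk c d = c *s seed i + d *s seed j"
    by (simp_all add: seed_mk)
  then show ?thesis
    by (simp add: add_left add_right omega_zsmult omega_zsmult_right omega_self
        skew[of "seed j" "seed i"] algebra_simps)
qed

section \<open>Integral exponents of the parameter\<close>

lemma delta0_pos: "0 < \<delta>\<^sub>0"
proof -
  have "Lcm (range \<delta>) \<noteq> 0" using \<delta>_pos by (subst Lcm_0_iff) (auto, metis less_irrefl)
  then show ?thesis unfolding \<delta>\<^sub>0_def by (rule neq0_conv[THEN iffD1])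
qed

lemma delta_dvd_delta0: "\<delta> k dvd \<delta>\<^sub>0"
  by (auto simp: \<delta>\<^sub>0_def)

lemma delta_w_nat: "\<exists>b. 0 < b \<and> of_nat (\<delta> i) * w = of_nat b" (is ?g1) "\<exists>b. 0 < b \<and> of_nat (\<delta> j) * w = of_nat b" (is ?g2)
proof -
  have nat: "\<exists>b. 0 < b \<and> x = of_nat b" if "x \<in> \<int>" "0 < x" for x :: rat
    using that by (metis Ints_cases of_int_0_less_iff of_int_of_nat_eq of_nat_0_less_iff pos_int_cases)
  have "\<omega> (int (\<delta> i) *s seed i) (seed j) \<in> \<int>"
    by (rule integral) (auto simp: Ncirc_def seed_def axis_def)
  then show ?g1
    using omega_pos \<delta>_pos[of i] by (intro nat) (simp_all add: omega_zsmult)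
  have "\<omega> (int (\<delta> j) *s seed j) (seed i) \<in> \<int>"
    by (rule integral) (auto simp: Ncirc_def seed_def axis_def)
  then have "of_nat (\<delta> j) * w \<in> \<int>" by (simp add: omega_zsmult skew[of "seed j" "seed i"])
  then show ?g2
    using omega_pos \<delta>_pos[of j] by (intro nat) simp_all
qed

text \<open>\<open>bi\<close> and \<open>bj\<close> are the absolute values of the off-diagonal
  entries of \<open>bmat\<close>. The powers of \<open>tvar\<close> with exponents
  \<open>Ai\<close>, \<open>Aj\<close>, \<open>wn\<close> are q^(1/\<delta>_i), q^(1/\<delta>_j) and
  q^w.\<close>

definition bi :: nat where "bi = (SOME b. 0 < b \<and> of_nat (\<delta> i) * w = of_nat b)"
definition bj :: nat where "bj = (SOME b. 0 < b \<and> of_nat (\<delta> j) * w = of_nat b)"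
definition Ai :: nat where "Ai = \<delta>\<^sub>0 div \<delta> i"
definition Aj :: nat where "Aj = \<delta>\<^sub>0 div \<delta> j"
definition wn :: nat where "wn = Ai * bi"

lemma bi: "0 < bi" "of_nat (\<delta> i) * w = of_nat bi"
  using someI_ex[OF delta_w_nat(1)] by (simp_all add: bi_def)

lemma bj: "0 < bj" "of_nat (\<delta> j) * w = of_nat bj"
  using someI_ex[OF delta_w_nat(2)] by (simp_all add: bj_def)

lemma Ai: "\<delta>\<^sub>0 = \<delta> i * Ai" "0 < Ai" and Aj: "\<delta>\<^sub>0 = \<delta> j * Aj" "0 < Aj"
  using delta_dvd_delta0 delta0_pos by (auto simp: Ai_def Aj_def div_greater_zero_iff dvd_imp_le \<delta>_pos)

lemma delta0_w: "of_nat \<delta>\<^sub>0 * w = of_nat wn" "of_nat \<delta>\<^sub>0 * w = of_nat (Aj * bj)" (is ?g1)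
proof -
  have "of_nat \<delta>\<^sub>0 * w = of_nat Ai * (of_nat (\<delta> i) * w)" by (simp add: Ai(1))
  then show "of_nat \<delta>\<^sub>0 * w = of_nat wn" by (simp add: bi wn_def)
  have "of_nat \<delta>\<^sub>0 * w = of_nat Aj * (of_nat (\<delta> j) * w)" by (subst Aj(1)) simp
  then show ?g1 by (simp add: bj)
qed

lemma wn_alt: "wn = Aj * bj"
  using delta0_w by (metis of_nat_eq_iff)

lemma qpow_eq: "of_nat \<delta>\<^sub>0 * \<alpha> = of_int e \<Longrightarrow> qpow \<alpha> = tvar powi e"
  by (simp add: qpow_def tvar_def)

lemma qnum_eq: "of_nat \<delta>\<^sub>0 * \<alpha> = of_nat e \<Longrightarrow> qnum \<alpha> = qbr e / qbr \<delta>\<^sub>0"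
  using qpow_eq[of \<alpha> "int e"] qpow_eq[of "- \<alpha>" "- int e"] qpow_eq[of 1 "int \<delta>\<^sub>0"] qpow_eq[of "- 1" "- int \<delta>\<^sub>0"]
  by (simp add: qnum_def tq.br_def power_int_minus)

text \<open>This is q - q^-1, the denominator of every \<open>qnum\<close>.\<close>

definition kap :: coeff where "kap = qbr \<delta>\<^sub>0"
definition Q :: coeff where "Q = tvar ^ wn"

lemma kap_nonzero [simp]: "kap \<noteq> 0"
  using delta0_pos by (simp add: kap_def)

lemma Q_nonzero [simp]: "Q \<noteq> 0"
  using tq.nonzero by (simp add: Q_def)

lemma qnum_w: "qnum (of_int k * w) = (Q powi k - Q powi (- k)) / kap"
proof -
  have "qpow (of_int k * w) = Q powi k" for k
    using delta0_w(1) by (subst qpow_eq[of _ "int wn * k"])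
      (simp_all only: Q_def power_int_mult power_int_of_nat of_int_mult of_int_of_nat_eq, simp add: mult_ac)
  from this[of k] this[of "- k"] show ?thesis
    using qpow_eq[of 1 "int \<delta>\<^sub>0"] qpow_eq[of "- 1" "- int \<delta>\<^sub>0"]
    by (simp add: qnum_def kap_def tq.br_def power_int_minus)
qed

text \<open>
  \<open>X\<^bsub>(a,b)\<^esub>\<close> is sent to \<open>x\<^bsup>(a,b)\<^esup> / (q - q\<^sup>-\<^sup>1)\<close> with \<open>x\<^bsup>(a,b)\<^esup> = Q\<^bsup>ab\<^esup> y\<^sup>b x\<^sup>a\<close>. All series with parameter
  \<open>c \<noteq> Q\<^sup>2\<close> are set to 0, so that equations between images hold in the whole ring.
\<close>

definition th :: "2 lie \<Rightarrow> coeff skew" where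
  "th x = Abs_skew (\<lambda>a b c. if a + b \<le> 4 \<and> c = Q ^ 2 then x (nvec a b) / kap * Q ^ (a * b) else 0)"

lemma cmp_th: "cmp (th x) a b c =
    (if a + b \<le> 4 \<and> c = Q ^ 2 then x (nvec a b) / kap * Q ^ (a * b) else 0)"
  unfolding th_def by (subst Abs_skew_inverse) auto

lemma th_linear: "th (\<lambda>n. x n + y n) = th x + th y" "th (\<lambda>n. x n - y n) = th x - th y"
  "th (\<lambda>n. k * x n) = skscale k (th x)" "th (\<lambda>_. 0) = 0"
  by (auto intro!: skew_eqI simp: cmp_th algebra_simps add_divide_distrib diff_divide_distrib)

lemma th_sum: "th (\<lambda>n. \<Sum>l\<in>S. f l n) = (\<Sum>l\<in>S. th (f l))"
  by (induction S rule: infinite_finite_induct) (simp_all add: th_linear)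

lemma th_cong: "(\<And>a b. a + b \<le> 4 \<Longrightarrow> x (nvec a b) = y (nvec a b)) \<Longrightarrow> th x = th y"
  by (auto intro!: skew_eqI simp: cmp_th)

lemma th_eqD: "th x = th y \<Longrightarrow> a + b \<le> 4 \<Longrightarrow> x (nvec a b) = y (nvec a b)"
  using cmp_th[of x a b "Q ^ 2"] cmp_th[of y a b "Q ^ 2"] by simp

lemma th_diff_hi:
  "(\<And>a b. a + b < k \<Longrightarrow> a + b \<le> 4 \<Longrightarrow> x (nvec a b) = y (nvec a b)) \<Longrightarrow> th x - th y \<in> hi k"
  by (auto simp: hi_def cmp_th)

lemma th_hi_1: "x \<in> ghat \<Longrightarrow> th x \<in> hi 1"
  by (auto simp: hi_def cmp_th ghat_def)

lemma bracket_mk: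
  assumes x: "x \<in> ghat" and y: "y \<in> ghat"
  shows "bracket x y (nvec p q) = (\<Sum>a=0..p. \<Sum>b=0..q.
     x (nvec a b) * y (nvec (p - a) (q - b)) *
     ((Q powi (int (a * q) - int (b * p)) - Q powi (int (b * p) - int (a * q))) / kap))"
proof -
  let ?g = "\<lambda>(a, b). (nvec a b, nvec (p - a) (q - b))"
  let ?h = "\<lambda>(m, n). x m * y n * qnum (\<omega> m n)"
  let ?S = "{(m, n). m \<in> Nplus \<and> n \<in> Nplus \<and> m + n = nvec p q}"
  have sub: "?S \<subseteq> ?g ` ({0..p} \<times> {0..q})"
  proof clarify
    fix m n assume "m \<in> Nplus" "n \<in> Nplus" and s: "m + n = nvec p q"
    then obtain a b c d where mn: "m = nvec a b" "n = nvec c d" using Nplus_mk by meson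
    then have "p = a + c" "q = b + d" using s by (auto simp flip: of_nat_add)
    then show "(m, n) \<in> ?g ` ({0..p} \<times> {0..q})" using mn by (intro image_eqI[of _ _ "(a, b)"]) auto
  qed
  have "bracket x y (nvec p q) = sum ?h ?S"
    unfolding bracket_def by simp
  \<comment> \<open>The box also contains pairs with a zero vector; there \<open>x\<close> or
    \<open>y\<close> vanishes, being in \<open>ghat\<close>.\<close>
  also have "\<dots> = sum ?h (?g ` ({0..p} \<times> {0..q}))"
    using sub x y by (intro sum.mono_neutral_left) (auto simp: ghat_def of_nat_diff)
  also have "\<dots> = (\<Sum>(a, b)\<in>{0..p} \<times> {0..q}. ?h (?g (a, b)))"
    by (subst sum.reindex) (simp_all add: inj_on_def case_prod_unfold comp_def del: of_nat_diff)
  also have "\<dots> = (\<Sum>a=0..p. \<Sum>b=0..q. ?h (?g (a, b)))"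
    by (simp only: sum.cartesian_product)
  also have "\<dots> = (\<Sum>a=0..p. \<Sum>b=0..q.
     x (nvec a b) * y (nvec (p - a) (q - b)) *
     ((Q powi (int (a * q) - int (b * p)) - Q powi (int (b * p) - int (a * q))) / kap))"
  proof (intro sum.cong refl)
    fix a b assume "a \<in> {0..p}" "b \<in> {0..q}"
    then have "int a * int (q - b) - int b * int (p - a) = int (a * q) - int (b * p)"
      by (simp add: of_nat_diff algebra_simps)
    then show "?h (?g (a, b)) = x (nvec a b) * y (nvec (p - a) (q - b)) *
     ((Q powi (int (a * q) - int (b * p)) - Q powi (int (b * p) - int (a * q))) / kap)"
      by (simp only: case_prod_conv omega_mk qnum_w minus_diff_eq)
  qed
  finally show ?thesis .
qed

text \<open>The weight \<open>Q ^ (a * b)\<close> in \<open>th\<close> symmetrises the normal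
  ordering: a b + a' b' + 2 a b' = (a + a') (b + b') + (a b' - a' b), so beside the weight of the
  sum only the determinant remains.\<close>

lemma cmp_th_times:
  assumes "p + q \<le> 4"
  shows "cmp (th x * th y) p q (Q ^ 2) = Q ^ (p * q) / kap ^ 2 * (\<Sum>a=0..p. \<Sum>b=0..q.
     x (nvec a b) * y (nvec (p - a) (q - b)) * Q powi (int (a * q) - int (b * p)))"
proof -
  have *: "Q ^ (a * b) * Q ^ ((p - a) * (q - b)) * (Q\<^sup>2) ^ (a * (q - b)) =
      Q ^ (p * q) * Q powi (int (a * q) - int (b * p))" if "a \<le> p" "b \<le> q" for a b
  proof -
    have "Q ^ (a * b) * Q ^ ((p - a) * (q - b)) * (Q\<^sup>2) ^ (a * (q - b)) =
        Q powi (int (a * b + (p - a) * (q - b) + 2 * (a * (q - b))))"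
      by (simp only: power_int_of_nat power_add power_mult)
    also have "int (a * b + (p - a) * (q - b) + 2 * (a * (q - b))) = int (p * q) + (int (a * q) - int (b * p))"
      using that by (simp only: of_nat_add of_nat_mult of_nat_diff) (simp add: algebra_simps)
    finally show ?thesis by (simp only: power_int_add[OF disjI1[OF Q_nonzero]] power_int_of_nat)
  qed
  have "cmp (th x * th y) p q (Q ^ 2) = (\<Sum>a=0..p. \<Sum>b=0..q.
     x (nvec a b) * y (nvec (p - a) (q - b)) / kap ^ 2 *
     (Q ^ (a * b) * Q ^ ((p - a) * (q - b)) * (Q\<^sup>2) ^ (a * (q - b))))"
    unfolding cmp_times[OF assms] using assms
    by (intro sum.cong refl) (simp add: cmp_th power2_eq_square mult_ac)
  also have "\<dots> = (\<Sum>a=0..p. \<Sum>b=0..q. Q ^ (p * q) / kap ^ 2 *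
     (x (nvec a b) * y (nvec (p - a) (q - b)) * Q powi (int (a * q) - int (b * p))))"
    by (intro sum.cong refl) (simp only: atLeastAtMost_iff *, simp add: mult_ac)
  finally show ?thesis by (simp add: sum_distrib_left)
qed

text \<open>Two monomials with determinant d have commutator factor Q^d - Q^-d. Divided by
  \<open>kap\<close> this is the structure constant; the second \<open>kap\<close> belongs to the
  normalisation of \<open>th\<close>.\<close>

lemma th_bracket:
  assumes x: "x \<in> ghat" and y: "y \<in> ghat"
  shows "th (bracket x y) = th x * th y - th y * th x"
proof (rule skew_eqI)
  fix p q c assume pq: "p + q \<le> (4::nat)"
  show "cmp (th (bracket x y)) p q c = cmp (th x * th y - th y * th x) p q c"
  proof (cases "c = Q ^ 2")
    case False
    then show ?thesis by (simp add: cmp_th times_skew.rep_eq)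
  next
    case True
    define f where "f a b = x (nvec a b) * y (nvec (p - a) (q - b))" for a b
    have rev: "(\<Sum>a=0..p. \<Sum>b=0..q. y (nvec a b) * x (nvec (p - a) (q - b)) *
        Q powi (int (a * q) - int (b * p))) =
      (\<Sum>a=0..p. \<Sum>b=0..q. f a b * Q powi (int (b * p) - int (a * q)))"
    proof -
      have "(\<Sum>a=0..p. \<Sum>b=0..q. f a b * Q powi (int (b * p) - int (a * q))) =
        (\<Sum>(a, b)\<in>{0..p} \<times> {0..q}. f a b * Q powi (int (b * p) - int (a * q)))"
        by (simp add: sum.cartesian_product)
      also have "\<dots> = (\<Sum>(a, b)\<in>{0..p} \<times> {0..q}. y (nvec a b) * x (nvec (p - a) (q - b)) *
        Q powi (int (a * q) - int (b * p)))"
        by (rule sum.reindex_bij_witness[of _ "\<lambda>(a, b). (p - a, q - b)" "\<lambda>(a, b). (p - a, q - b)"])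
          (auto simp: f_def of_nat_diff algebra_simps)
      finally show ?thesis by (simp only: sum.cartesian_product)
    qed
    have "cmp (th (bracket x y)) p q c = bracket x y (nvec p q) / kap * Q ^ (p * q)"
      using pq True by (simp add: cmp_th)
    also have "\<dots> = Q ^ (p * q) / kap ^ 2 * (\<Sum>a=0..p. \<Sum>b=0..q.
       f a b * Q powi (int (a * q) - int (b * p)) - f a b * Q powi (int (b * p) - int (a * q)))"
      unfolding bracket_mk[OF x y] f_def[symmetric] sum_distrib_left sum_divide_distrib sum_distrib_right
      by (intro sum.cong refl) (simp add: power2_eq_square field_simps)
    also have "\<dots> = cmp (th x * th y - th y * th x) p q c"
      unfolding True minus_skew.rep_eq cmp_th_times[OF pq] rev
      by (simp add: f_def sum_subtractf algebra_simps)
    finally show ?thesis .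
  qed
qed

lemma th_gmult:
  assumes x: "x \<in> ghat" and y: "y \<in> ghat"
  shows "th (gmult x y) = bch4 (th x) (th y)"
proof -
  have "th (gmult x y) = th (\<lambda>n. x n + y n + 1/2 * bracket x y n +
    1/12 * (bracket x (bracket x y) n - bracket y (bracket x y) n) -
    1/48 * (bracket x (bracket y (bracket x y)) n + bracket y (bracket x (bracket x y)) n))"
    by (rule th_cong, rule gmult_degree_4) (use assms in auto)
  then show ?thesis
    by (simp only: th_linear th_bracket bracket_in_ghat x y bch4_def Let_def)
qed

text \<open>From here on group elements are multiplied inside the ring.\<close>

lemma texp_th_gmult: "x \<in> ghat \<Longrightarrow> y \<in> ghat \<Longrightarrow> texp (th (gmult x y)) = texp (th x) * texp (th y)"
  by (simp only: th_gmult texp_bch4 th_hi_1)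

end

section \<open>Path-ordered products\<close>

lemma linear_pairing: "linear (pairing n)"
  by (rule linearI) (simp_all add: pairing_def algebra_simps sum.distrib sum_distrib_left)

lemma smooth_curve_velocity:
  assumes "smooth_curve \<gamma>" "t \<in> {0..1}"
  shows "(\<gamma> has_vector_derivative velocity \<gamma> t) (at t within {0..1})"
proof -
  obtain D where "D 0 = \<gamma>" "(D 0 has_vector_derivative D (Suc 0) t) (at t within {0..1})"
    using assms unfolding smooth_curve_def by blast
  then show ?thesis
    using assms(2) vector_derivative_within_closed_interval[of 0 1 t \<gamma>] by (auto simp: velocity_def)
qed

text \<open>Infinitely many crossing times would accumulate at some time on the wall. Near it the
  linear form along the curve has no further zeros, because its derivative there is nonzero by
  transversality.\<close>

lemma finite_transversal_times:
  assumes smooth: "smooth_curve \<gamma>" and closed: "closed C" and C: "C \<subseteq> perp n"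
    and trans: "\<And>t. t \<in> {0..1} \<Longrightarrow> \<gamma> t \<in> C \<Longrightarrow> pairing n (velocity \<gamma> t) \<noteq> 0"
  shows "finite {t \<in> {0..1}. \<gamma> t \<in> C}"
proof (rule ccontr)
  let ?T = "{t \<in> {0..1}. \<gamma> t \<in> C}"
  assume inf: "infinite ?T"
  have "?T \<subseteq> {0..1}" by auto
  then obtain x where x: "x islimpt ?T"
    using inf iffD1[OF compact_eq_Bolzano_Weierstrass compact_Icc[of 0 "1::real"], rule_format, of ?T] that by blast
  have "continuous_on {0..1} \<gamma>"
    unfolding continuous_on_eq_continuous_within
    using has_vector_derivative_continuous[OF smooth_curve_velocity[OF smooth]] by blast
  then have "closed ({0..1} \<inter> \<gamma> -` C)"
    using closed by (intro continuous_closed_preimage) auto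
  moreover have "{0..1} \<inter> \<gamma> -` C = ?T" by auto
  ultimately have xT: "x \<in> ?T" using x closed_limpt by metis
  then have x01: "x \<in> {0..1}" and gx: "\<gamma> x \<in> C" by auto
  let ?f = "\<lambda>s. pairing n (\<gamma> s)"
  have "(?f has_vector_derivative pairing n (velocity \<gamma> x)) (at x within {0..1})"
    by (rule bounded_linear.has_vector_derivative[OF linear_pairing[unfolded linear_conv_bounded_linear]
          smooth_curve_velocity[OF smooth x01]])
  then have "((\<lambda>y. (?f y - ?f x) / (y - x)) \<longlongrightarrow> pairing n (velocity \<gamma> x)) (at x within {0..1})"
    by (simp add: has_field_derivative_iff flip: has_real_derivative_iff_has_vector_derivative)
  moreover have "?f x = 0" using gx C by (auto simp: perp_def)
  ultimately have "eventually (\<lambda>y. ?f y / (y - x) \<noteq> 0) (at x within {0..1})"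
    using trans[OF x01 gx] by (intro tendsto_imp_eventually_ne[where c = "pairing n (velocity \<gamma> x)"]) auto
  then have "eventually (\<lambda>y. y \<in> {0..1} \<longrightarrow> ?f y \<noteq> 0) (at x)"
    unfolding eventually_at_filter by (auto elim: eventually_mono)
  then have "eventually (\<lambda>y. y \<notin> ?T) (at x)"
    by (rule eventually_mono) (use C in \<open>auto simp: perp_def\<close>)
  then show False using x by (simp add: islimpt_iff_eventually)
qed

lemma wall_cone:
  assumes "is_wall w"
  shows "convex_cone (wcone w)" "closed (wcone w)" "wcone w \<subseteq> perp (wnormal w)"
  using assms closed_convex_cone_hull convex_cone_convex_cone_hull
  by (auto simp: is_wall_def rational_polyhedral_cone_def)

lemma wall_normal: "is_wall w \<Longrightarrow> wnormal w \<in> Nplus"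
  by (auto simp: is_wall_def Nplus_pr_def)

lemma finite_crossings:
  assumes "scattering_diagram I W" "admissible I W \<gamma>"
  shows "finite (crossings d I W \<gamma>)"
proof -
  let ?L = "{l \<in> I. welt (W l) \<notin> G_gt d}"
  have "finite ?L" using assms by (auto simp: scattering_diagram_def)
  moreover have "finite {t \<in> {0..1}. \<gamma> t \<in> wcone (W l)}" if "l \<in> I" for l
    using assms that wall_cone[of "W l"]
    by (intro finite_transversal_times[where n = "wnormal (W l)"])
       (auto simp: scattering_diagram_def admissible_def)
  ultimately have "finite (\<Union>l\<in>?L. (\<lambda>t. (t, l)) ` {t \<in> {0..1}. \<gamma> t \<in> wcone (W l)})" by auto
  then show ?thesis by (rule rev_finite_subset) (auto simp: crossings_def)
qed

lemma Nplus_zsmult: "n \<in> Nplus \<Longrightarrow> 1 \<le> k \<Longrightarrow> int k *s n \<in> Nplus"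
  by (auto simp: Nplus_def sum_distrib_left[symmetric])

lemma G_par_subset_ghat: "n \<in> Nplus \<Longrightarrow> G_par n \<subseteq> ghat"
  by (auto simp: G_par_def ghat_def) (metis Nplus_zsmult One_nat_def)

lemma welt_multiple: "is_wall w \<Longrightarrow> welt w m \<noteq> 0 \<Longrightarrow> \<exists>k\<ge>1. m = int k *s wnormal w"
  by (auto simp: is_wall_def G_par_def)

lemma welt_ghat: "is_wall w \<Longrightarrow> welt w \<in> ghat"
  using G_par_subset_ghat[of "wnormal w"] wall_normal[of w] by (auto simp: is_wall_def)

lemma gpow_ghat: "x \<in> ghat \<Longrightarrow> gpow c x \<in> ghat"
  by (auto simp: ghat_def gpow_def)

lemma pairing_zsmult: "pairing (k *s n) v = of_int k * pairing n v"
  by (simp add: pairing_def sum_distrib_left mult_ac)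

lemma crossing_sign_multiple: "1 \<le> k \<Longrightarrow> crossing_sign \<gamma> t (int k *s n) = crossing_sign \<gamma> t n"
  by (auto simp: crossing_sign_def pairing_zsmult mult_less_0_iff)

text \<open>All that a path-ordered product modulo \<open>G_gt d\<close> sees at a crossing point
  \<open>v\<close>; for a scattering diagram the restriction to nontrivial walls makes the sum
  finite.\<close>

definition direction_sum :: "nat \<Rightarrow> 'i set \<Rightarrow> ('i \<Rightarrow> 'r::finite wall) \<Rightarrow> real ^ 'r \<Rightarrow> 'r lie" where
  "direction_sum d I W v m = (\<Sum>l | l \<in> I \<and> welt (W l) \<notin> G_gt d \<and> v \<in> wcone (W l). welt (W l) m)"

text \<open>The sign is taken from the component \<open>m\<close> instead of a wall: if a wall has a
  component at \<open>m\<close>, then \<open>m\<close> is a positive multiple of its normal.\<close>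

definition crossing_sum :: "nat \<Rightarrow> 'i set \<Rightarrow> ('i \<Rightarrow> 'r::finite wall) \<Rightarrow> (real \<Rightarrow> real ^ 'r) \<Rightarrow> real \<Rightarrow> 'r lie" where
  "crossing_sum d I W \<gamma> t m = of_int (crossing_sign \<gamma> t m) * direction_sum d I W (\<gamma> t) m"

context rank2_data
begin

abbreviation diagram :: "'i set \<Rightarrow> ('i \<Rightarrow> 2 wall) \<Rightarrow> bool" where
  "diagram I W \<equiv> scattering_diagram I W \<and> initial_incoming I W"

lemma pairing_ij: "pairing n v = of_int (n $ i) * v $ i + of_int (n $ j) * v $ j"
  by (simp add: pairing_def sum_ij)

text \<open>The two initial lines meet in the origin alone, in dimension 0 = r - 2. Hence admissible
  curves avoid the only point where walls of different directions meet.\<close>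

lemma zero_in_Sing:
  assumes "diagram I W"
  shows "0 \<in> Sing I W"
proof -
  have "\<exists>l\<in>I. W l = initial_wall k" for k
  proof -
    have "initial_wall k \<in> W ` {l \<in> I. incoming (W l)}"
      using assms by (simp add: initial_incoming_def bij_betw_def)
    then show ?thesis by force
  qed
  then obtain l l' where l: "l \<in> I" "W l = initial_wall i" "l' \<in> I" "W l' = initial_wall j" by metis
  have "wcone (W l) \<inter> wcone (W l') = {0}"
    using l by (auto simp: initial_wall_def perp_def pairing_ij seed_mk vec_eq_ij)
  moreover have "aff_dim {0::real ^ 2} = int CARD(2) - 2" by simp
  ultimately have "{0} \<in> {wcone (W l) \<inter> wcone (W l') | l l'. l \<in> I \<and> l' \<in> I \<and>
      aff_dim (wcone (W l) \<inter> wcone (W l')) = int CARD(2) - 2}"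
    using l(1,3) by (intro CollectI exI[of _ l] exI[of _ l'] conjI) (simp_all only:)
  then show ?thesis unfolding Sing_def by blast
qed

lemma bracket_parallel:
  assumes "x \<in> G_par n" "y \<in> G_par n'" "n $ i * n' $ j = n $ j * n' $ i"
  shows "bracket x y = (\<lambda>_. 0)"
proof -
  have "x a * y b * qnum (\<omega> a b) = 0" for a b
  proof (cases "x a = 0 \<or> y b = 0")
    case False
    then obtain k l where "a = int k *s n" "b = int l *s n'" using assms(1,2) by (auto simp: G_par_def) metis
    moreover have "\<omega> n n' = 0"
      using assms(3) omega_mk[of "n $ i" "n $ j" "n' $ i" "n' $ j"] by (simp flip: mk_surj)
    ultimately show ?thesis by (simp add: omega_zsmult omega_zsmult_right)
  qed auto
  then show ?thesis unfolding bracket_def case_prod_unfold by (intro ext sum.neutral ballI)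
qed

text \<open>Cramer's rule: a common nonzero solution forces the determinant to vanish.\<close>

lemma normals_parallel:
  assumes "v \<in> perp n" "v \<in> perp n'" "v \<noteq> 0"
  shows "n $ i * n' $ j = n $ j * n' $ i"
proof -
  let ?a = "real_of_int (n $ i)" and ?b = "real_of_int (n $ j)" and ?c = "real_of_int (n' $ i)" and ?d = "real_of_int (n' $ j)"
  have 1: "?a * v $ i + ?b * v $ j = 0" "?c * v $ i + ?d * v $ j = 0" using assms by (auto simp: perp_def pairing_ij)
  have "(?a * ?d - ?b * ?c) * v $ i = ?d * (?a * v $ i + ?b * v $ j) - ?b * (?c * v $ i + ?d * v $ j)"
    "(?a * ?d - ?b * ?c) * v $ j = ?a * (?c * v $ i + ?d * v $ j) - ?c * (?a * v $ i + ?b * v $ j)"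
    by (simp_all add: algebra_simps)
  then have "(?a * ?d - ?b * ?c) * v $ i = 0" "(?a * ?d - ?b * ?c) * v $ j = 0" using 1 by auto
  moreover have "v $ i \<noteq> 0 \<or> v $ j \<noteq> 0" using assms(3) by (auto simp: vec_eq_ij)
  ultimately have "?a * ?d - ?b * ?c = 0" by auto
  then show ?thesis by (simp flip: of_int_mult)
qed

lemma th_crossing_sum:
  assumes sd: "scattering_diagram I W" and fin: "finite (crossings d I W \<gamma>)" and t: "t \<in> {0..1}"
  shows "(\<Sum>p | p \<in> crossings d I W \<gamma> \<and> fst p = t.
      th (gpow (crossing_sign \<gamma> (fst p) (wnormal (W (snd p)))) (welt (W (snd p))))) = th (crossing_sum d I W \<gamma> t)"
proof -
  let ?S = "{l. l \<in> I \<and> welt (W l) \<notin> G_gt d \<and> \<gamma> t \<in> wcone (W l)}"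
  have "(\<Sum>p | p \<in> crossings d I W \<gamma> \<and> fst p = t.
      th (gpow (crossing_sign \<gamma> (fst p) (wnormal (W (snd p)))) (welt (W (snd p))))) =
    (\<Sum>l\<in>?S. th (gpow (crossing_sign \<gamma> t (wnormal (W l))) (welt (W l))))"
    by (rule sum.reindex_bij_witness[of _ "\<lambda>l. (t, l)" snd]) (use t in \<open>auto simp: crossings_def\<close>)
  also have "\<dots> = th (\<lambda>m. \<Sum>l\<in>?S. gpow (crossing_sign \<gamma> t (wnormal (W l))) (welt (W l)) m)"
    by (rule th_sum[symmetric])
  also have "(\<lambda>m. \<Sum>l\<in>?S. gpow (crossing_sign \<gamma> t (wnormal (W l))) (welt (W l)) m) = crossing_sum d I W \<gamma> t"
  proof
    fix m
    have "gpow (crossing_sign \<gamma> t (wnormal (W l))) (welt (W l)) m = of_int (crossing_sign \<gamma> t m) * welt (W l) m"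
      if "l \<in> I" for l
    proof (cases "welt (W l) m = 0")
      case False
      then obtain k where "1 \<le> k" "m = int k *s wnormal (W l)"
        using welt_multiple[of "W l" m] sd \<open>l \<in> I\<close> unfolding scattering_diagram_def by fast
      then show ?thesis by (simp only: gpow_def crossing_sign_multiple)
    qed (simp add: gpow_def)
    then show "(\<Sum>l\<in>?S. gpow (crossing_sign \<gamma> t (wnormal (W l))) (welt (W l)) m) = crossing_sum d I W \<gamma> t m"
      unfolding crossing_sum_def direction_sum_def sum_distrib_left by (intro sum.cong) auto
  qed
  finally show ?thesis .
qed

text \<open>
  Walls crossed at the same time have parallel normal vectors, so their images commute and only the
  sum of the wall elements over each crossed ray matters.
\<close>

lemma path_prod_upto_product:
  assumes D: "diagram I W" and adm: "admissible I W \<gamma>"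
    and ts: "sorted ts" "distinct ts" "fst ` crossings d I W \<gamma> \<subseteq> set ts" "set ts \<subseteq> {0..1}"
  shows "path_prod_upto d I W \<gamma> \<in> ghat"
    "texp (th (path_prod_upto d I W \<gamma>)) = fold (\<lambda>t acc. texp (th (crossing_sum d I W \<gamma> t)) * acc) ts 1" (is ?g1)
proof -
  have sd: "scattering_diagram I W" using D by simp
  define C where "C = crossings d I W \<gamma>"
  have fin: "finite C" unfolding C_def by (rule finite_crossings[OF sd adm])
  define cs where "cs = (SOME cs. distinct cs \<and> set cs = C \<and> sorted (map fst cs))"
  have "\<exists>cs. distinct cs \<and> set cs = C \<and> sorted (map fst cs)"
  proof -
    obtain xs where "set xs = C" "distinct xs" using fin finite_distinct_list by blast
    then show ?thesis by (intro exI[of _ "sort_key fst xs"]) simp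
  qed
  then have cs: "distinct cs" "set cs = C" "sorted (map fst cs)"
    using someI_ex[of "\<lambda>cs. distinct cs \<and> set cs = C \<and> sorted (map fst cs)"] by (auto simp: cs_def)
  define X where "X p = gpow (crossing_sign \<gamma> (fst p) (wnormal (W (snd p)))) (welt (W (snd p)))" for p
  have wall: "is_wall (W (snd p))" if "p \<in> C" for p
    using that sd by (auto simp: C_def crossings_def scattering_diagram_def)
  have X: "X p \<in> ghat" if "p \<in> C" for p
    unfolding X_def using wall[OF that] by (intro gpow_ghat welt_ghat)
  have pp: "path_prod_upto d I W \<gamma> = fold (\<lambda>p. gmult (X p)) cs gone"
    unfolding path_prod_upto_def cs_def C_def X_def by (simp add: case_prod_unfold)
  have fold: "fold (\<lambda>p. gmult (X p)) L z \<in> ghat \<and> texp (th (fold (\<lambda>p. gmult (X p)) L z)) =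
      fold (\<lambda>p acc. texp (th (X p)) * acc) L (texp (th z))" if "set L \<subseteq> C" "z \<in> ghat" for L z
    using that
  proof (induction L arbitrary: z)
    case (Cons p L)
    then show ?case using X gmult_in_ghat by (simp add: texp_th_gmult)
  qed simp
  have z: "gone \<in> ghat" "th gone = 0" by (simp_all add: gone_def ghat_def th_linear)
  show "path_prod_upto d I W \<gamma> \<in> ghat" unfolding pp using fold[of cs gone] z cs(2) by auto
  have "texp (th (path_prod_upto d I W \<gamma>)) = fold (\<lambda>p acc. texp (th (X p)) * acc) cs 1"
    unfolding pp using fold[of cs gone] z cs(2) by auto
  also have "\<dots> = fold (\<lambda>t acc. texp (\<Sum>p | p \<in> set cs \<and> fst p = t. th (X p)) * acc) ts 1"
  proof (rule fold_texp_group_by_time)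
    fix p q assume p: "p \<in> set cs" and q: "q \<in> set cs" and pq: "fst p = fst q"
    have "\<gamma> (fst p) \<noteq> 0"
    proof -
      have "fst p \<in> {0..1}" using p cs(2) by (auto simp: C_def crossings_def)
      then have "\<gamma> (fst p) \<notin> Sing I W" using adm by (simp add: admissible_def)
      then show ?thesis using zero_in_Sing[OF D] by (auto simp only:)
    qed
    moreover have "\<gamma> (fst p) \<in> perp (wnormal (W (snd p)))" "\<gamma> (fst p) \<in> perp (wnormal (W (snd q)))"
    proof -
      have c: "\<gamma> (fst r) \<in> perp (wnormal (W (snd r)))" if "r \<in> C" for r
        using that wall_cone(3)[OF wall[OF that]] by (auto simp: C_def crossings_def)
      show "\<gamma> (fst p) \<in> perp (wnormal (W (snd p)))" "\<gamma> (fst p) \<in> perp (wnormal (W (snd q)))"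
        using c[of p] c[of q] p q cs(2) pq by simp_all
    qed
    ultimately have par: "wnormal (W (snd p)) $ i * wnormal (W (snd q)) $ j = wnormal (W (snd p)) $ j * wnormal (W (snd q)) $ i"
      by (intro normals_parallel)
    have "X r \<in> G_par (wnormal (W (snd r)))" if "r \<in> C" for r
      using wall[OF that] by (auto simp: X_def is_wall_def G_par_def gpow_def)
    then have "bracket (X p) (X q) = (\<lambda>_. 0)" using p q cs par by (intro bracket_parallel) auto
    then have "th (X p) * th (X q) - th (X q) * th (X p) = 0"
      using th_bracket[of "X p" "X q"] X p q cs by (simp add: th_linear)
    then show "th (X p) * th (X q) = th (X q) * th (X p)" by simp
  qed (use cs ts X th_hi_1 in \<open>auto simp: C_def\<close>)
  also have "\<dots> = fold (\<lambda>t acc. texp (th (crossing_sum d I W \<gamma> t)) * acc) ts 1"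
  proof (rule fold_cong[OF refl refl])
    fix t assume "t \<in> set ts"
    then have "(\<Sum>p | p \<in> set cs \<and> fst p = t. th (X p)) = th (crossing_sum d I W \<gamma> t)"
      unfolding cs(2) X_def C_def using ts(4) fin by (intro th_crossing_sum sd) (auto simp: C_def)
    then show "(\<lambda>acc. texp (\<Sum>p | p \<in> set cs \<and> fst p = t. th (X p)) * acc) =
      (\<lambda>acc. texp (th (crossing_sum d I W \<gamma> t)) * acc)" by simp
  qed
  finally show ?g1 .
qed

text \<open>The walls added at the higher level have no component in degrees up to
  \<open>d\<close>.\<close>

lemma direction_sum_level:
  assumes sd: "scattering_diagram I W" and "deg m \<le> d" "d \<le> e"
  shows "direction_sum d I W v m = direction_sum e I W v m"
  unfolding direction_sum_def
proof (rule sum.mono_neutral_left)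
  have "finite {l \<in> I. welt (W l) \<notin> G_gt e}" using sd by (simp add: scattering_diagram_def)
  then show "finite {l. l \<in> I \<and> welt (W l) \<notin> G_gt e \<and> v \<in> wcone (W l)}" by (rule rev_finite_subset) auto
  show "{l. l \<in> I \<and> welt (W l) \<notin> G_gt d \<and> v \<in> wcone (W l)} \<subseteq> {l. l \<in> I \<and> welt (W l) \<notin> G_gt e \<and> v \<in> wcone (W l)}"
    using assms(3) order.trans by (fastforce simp: G_gt_def)
qed (use assms in \<open>auto simp: G_gt_def\<close>)

text \<open>\<open>path_prod\<close> reads a component of degree d from the product truncated at
  level d, whereas the ring equation is wanted at level 4. The two truncations agree modulo
  \<open>hi (Suc d)\<close>, and injectivity of \<open>texp\<close> modulo that order carries this
  back to components.\<close>

lemma path_prod_product: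
  assumes D: "diagram I W" and adm: "admissible I W \<gamma>"
    and ts: "sorted ts" "distinct ts" "fst ` crossings 4 I W \<gamma> \<subseteq> set ts" "set ts \<subseteq> {0..1}"
  shows "path_prod I W \<gamma> \<in> ghat"
    "texp (th (path_prod I W \<gamma>)) = fold (\<lambda>t acc. texp (th (crossing_sum 4 I W \<gamma> t)) * acc) ts 1" (is ?g1)
proof -
  have sd: "scattering_diagram I W" using D by simp
  have ghat: "path_prod_upto d I W \<gamma> \<in> ghat" for d
  proof -
    have "finite (fst ` crossings d I W \<gamma>)" using finite_crossings[OF sd adm] by simp
    then show ?thesis
      by (intro path_prod_upto_product(1)[OF D adm, of "sorted_list_of_set (fst ` crossings d I W \<gamma>)"])
        (auto simp: crossings_def)
  qed
  then show "path_prod I W \<gamma> \<in> ghat" by (auto simp: path_prod_def ghat_def)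
  have "path_prod_upto d I W \<gamma> (nvec a b) = path_prod_upto 4 I W \<gamma> (nvec a b)"
    if "d \<le> 4" "a + b = d" for d a b
  proof -
    have sub: "fst ` crossings d I W \<gamma> \<subseteq> set ts"
    proof -
      have "G_gt 4 \<subseteq> G_gt d" using that(1) by (auto simp: G_gt_def)
      then have "crossings d I W \<gamma> \<subseteq> crossings 4 I W \<gamma>" unfolding crossings_def by blast
      then show ?thesis using ts(3) by blast
    qed
    have "texp (th (path_prod_upto d I W \<gamma>)) - texp (th (path_prod_upto 4 I W \<gamma>)) \<in> hi (Suc d)"
      unfolding path_prod_upto_product(2)[OF D adm ts(1,2) sub ts(4)] path_prod_upto_product(2)[OF D adm ts]
    proof (rule fold_times_cong_mod)
      fix t show "texp (th (crossing_sum d I W \<gamma> t)) - texp (th (crossing_sum 4 I W \<gamma> t)) \<in> hi (Suc d)"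
      proof (intro texp_cong th_diff_hi)
        fix a b assume "a + b < Suc d"
        then have "direction_sum d I W (\<gamma> t) (nvec a b) = direction_sum 4 I W (\<gamma> t) (nvec a b)"
          using that(1) by (intro direction_sum_level[OF sd]) simp_all
        then show "crossing_sum d I W \<gamma> t (nvec a b) = crossing_sum 4 I W \<gamma> t (nvec a b)"
          by (simp only: crossing_sum_def)
      qed
    qed simp
    then have "th (path_prod_upto d I W \<gamma>) - th (path_prod_upto 4 I W \<gamma>) \<in> hi (Suc d)"
      by (rule texp_inj_mod[OF th_hi_1[OF ghat] th_hi_1[OF ghat]])
    then have "cmp (th (path_prod_upto d I W \<gamma>) - th (path_prod_upto 4 I W \<gamma>)) a b (Q ^ 2) = 0"
      unfolding hi_def using that(2) by simp
    then show ?thesis using that by (simp add: cmp_th)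
  qed
  then have "th (path_prod I W \<gamma>) = th (path_prod_upto 4 I W \<gamma>)"
    by (intro th_cong) (simp add: path_prod_def)
  then show ?g1
    using path_prod_upto_product(2)[OF D adm ts] by simp
qed

text \<open>Both products run over the union of the two sets of crossing times and agree factor by
  factor. Nonzero \<open>v\<close> suffice, because admissible curves avoid the origin.\<close>

lemma gcong_4_if_direction_sums_agree:
  assumes D: "diagram I W" "diagram I' W'" and adm: "admissible I W \<gamma>" "admissible I' W' \<gamma>"
    and eq: "\<And>v a b. v \<noteq> 0 \<Longrightarrow> a + b \<le> 4 \<Longrightarrow>
       direction_sum 4 I W v (nvec a b) = direction_sum 4 I' W' v (nvec a b)"
  shows "gcong 4 (path_prod I' W' \<gamma>) (path_prod I W \<gamma>)"
proof -
  define T where "T = fst ` crossings 4 I W \<gamma> \<union> fst ` crossings 4 I' W' \<gamma>"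
  have fin: "finite T" using finite_crossings[of I W \<gamma> 4] finite_crossings[of I' W' \<gamma> 4] D adm by (auto simp: T_def)
  have T01: "T \<subseteq> {0..1}" by (auto simp: T_def crossings_def)
  let ?ts = "sorted_list_of_set T"
  have ts: "sorted ?ts" "distinct ?ts" "fst ` crossings 4 I W \<gamma> \<subseteq> set ?ts"
    "fst ` crossings 4 I' W' \<gamma> \<subseteq> set ?ts" "set ?ts \<subseteq> {0..1}"
    using fin T01 by (auto simp: T_def)
  have g: "path_prod I W \<gamma> \<in> ghat" "path_prod I' W' \<gamma> \<in> ghat"
    using path_prod_product(1) D adm ts by blast+
  have "texp (th (path_prod I W \<gamma>)) = texp (th (path_prod I' W' \<gamma>))"
    unfolding path_prod_product(2)[OF D(1) adm(1) ts(1,2,3,5)] path_prod_product(2)[OF D(2) adm(2) ts(1,2,4,5)]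
  proof (rule fold_cong[OF refl refl])
    fix t assume "t \<in> set ?ts"
    then have "\<gamma> t \<noteq> 0" 
    proof -
      have "\<gamma> t \<notin> Sing I W" using adm(1) ts(5) \<open>t \<in> set ?ts\<close> unfolding admissible_def by blast
      then show ?thesis using zero_in_Sing[OF D(1)] by (auto simp only:)
    qed
    then have "th (crossing_sum 4 I W \<gamma> t) = th (crossing_sum 4 I' W' \<gamma> t)"
      by (intro th_cong) (simp add: crossing_sum_def eq)
    then show "(\<lambda>acc. texp (th (crossing_sum 4 I W \<gamma> t)) * acc) = (\<lambda>acc. texp (th (crossing_sum 4 I' W' \<gamma> t)) * acc)"
      by simp
  qed
  then have eq: "th (path_prod I W \<gamma>) = th (path_prod I' W' \<gamma>)" 
    by (rule texp_inj[OF th_hi_1[OF g(1)] th_hi_1[OF g(2)]])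
  have m: "th (gpow (- 1) x) = - th x" for x using th_linear(3)[of "- 1" x] by (simp add: gpow_def[abs_def])
  have gm: "gmult (gpow (- 1) (path_prod I' W' \<gamma>)) (path_prod I W \<gamma>) \<in> ghat"
    using g by (intro gmult_in_ghat gpow_ghat)
  \<comment> \<open>The images of the two factors are - u and u, which commute, so the
    Baker-Campbell-Hausdorff sum is 0.\<close>
  have "th (gmult (gpow (- 1) (path_prod I' W' \<gamma>)) (path_prod I W \<gamma>)) = th (\<lambda>_. 0)"
    using g by (simp add: th_gmult gpow_ghat m eq bch4_commute th_linear)
  then have z: "gmult (gpow (- 1) (path_prod I' W' \<gamma>)) (path_prod I W \<gamma>) (nvec a b) = 0" if "a + b \<le> 4" for a b
    using th_eqD[of _ "\<lambda>_. 0", OF _ that] by simp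
  have "gmult (gpow (- 1) (path_prod I' W' \<gamma>)) (path_prod I W \<gamma>) n = 0" if "deg n \<le> 4" for n
  proof (cases "n \<in> Nplus")
    case True
    then obtain a b where "n = nvec a b" using Nplus_mk by blast
    then show ?thesis using z that by simp
  qed (use gm in \<open>simp add: ghat_def\<close>)
  then show ?thesis using gm by (simp add: gcong_def G_gt_def)
qed

end

section \<open>The circle around the origin\<close>

context rank2_data
begin

abbreviation wr :: real where "wr \<equiv> of_rat w"

lemma wr_pos: "0 < wr"
  using omega_pos by simp

lemma pstar_nth: "pstar n $ i = of_int (n $ j) * wr" "pstar n $ j = - of_int (n $ i) * wr"
proof -
  have "\<omega> (seed i) n = of_int (n $ j) * w" "\<omega> (seed j) n = - of_int (n $ i) * w"
    using omega_mk[of 1 0 "n $ i" "n $ j"] omega_mk[of 0 1 "n $ i" "n $ j"] by (simp_all add: seed_mk flip: mk_surj)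
  then show "pstar n $ i = of_int (n $ j) * wr" "pstar n $ j = - of_int (n $ i) * wr"
    by (simp_all add: pstar_def of_rat_mult of_rat_minus)
qed

lemma pstar_zsmult: "pstar (k *s n) = of_int k *\<^sub>R pstar n"
  by (simp add: vec_eq_ij pstar_nth)

text \<open>The form is nondegenerate, so \<open>pstar n\<close> spans the line
  \<open>perp n\<close>; the sign of \<open>s\<close> separates the incoming half from the outgoing
  one.\<close>

lemma perp_multiple_pstar:
  assumes "v \<in> perp n" "n \<noteq> 0"
  obtains s where "v = s *\<^sub>R pstar n"
proof -
  let ?a = "real_of_int (n $ i)" and ?b = "real_of_int (n $ j)"
  have e: "?a * v $ i + ?b * v $ j = 0" using assms by (simp add: perp_def pairing_ij)
  have "\<exists>s. v = s *\<^sub>R pstar n"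
  proof (cases "n $ j = 0")
    case True
    then have "?a \<noteq> 0" using assms(2) by (auto simp: vec_eq_ij)
    then show ?thesis using True e wr_pos
      by (intro exI[of _ "- v $ j / (?a * wr)"]) (auto simp: vec_eq_ij pstar_nth)
  next
    case False
    then have "v $ j = - ?a * v $ i / ?b" using e by (simp add: field_simps)
    then show ?thesis using False wr_pos
      by (intro exI[of _ "v $ i / (?b * wr)"]) (auto simp: vec_eq_ij pstar_nth)
  qed
  then show ?thesis using that by blast
qed

lemma direction_sum_scale:
  assumes "scattering_diagram I W" "0 < s"
  shows "direction_sum d I W (s *\<^sub>R v) m = direction_sum d I W v m"
proof -
  have "s *\<^sub>R v \<in> wcone (W l) \<longleftrightarrow> v \<in> wcone (W l)" if "l \<in> I" for l
  proof -
    have cc: "convex_cone (wcone (W l))" using assms that wall_cone(1) by (auto simp: scattering_diagram_def)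
    have "v = (1 / s) *\<^sub>R (s *\<^sub>R v)" using assms by simp
    then show ?thesis using convex_cone_scaleR[OF cc, of s v] convex_cone_scaleR[OF cc, of "1/s" "s *\<^sub>R v"] assms(2)
      by auto
  qed
  then show ?thesis unfolding direction_sum_def by (intro sum.cong) auto
qed

lemma welt_zero_off_perp:
  assumes "is_wall u" "v \<in> wcone u" "v \<notin> perp m"
  shows "welt u m = 0"
proof (rule ccontr)
  assume "welt u m \<noteq> 0"
  then obtain k where "m = int k *s wnormal u" using welt_multiple assms(1) by metis
  moreover have "v \<in> perp (wnormal u)" using wall_cone(3)[OF assms(1)] assms(2) by auto
  ultimately show False using assms(3) by (simp add: perp_def pairing_zsmult)
qed

lemma direction_sum_off_perp:
  assumes "scattering_diagram I W" "v \<notin> perp m"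
  shows "direction_sum d I W v m = 0"
  unfolding direction_sum_def using assms welt_zero_off_perp
  by (intro sum.neutral) (auto simp: scattering_diagram_def)

lemma inj_initial_wall: "inj initial_wall"
proof (rule injI)
  fix k l assume "initial_wall k = initial_wall l"
  then have "seed k = seed l" unfolding initial_wall_def by (metis wall.ext_inject)
  then have "seed k $ k = seed l $ k" by simp
  then show "k = l" by (simp add: seed_def axis_def split: if_splits)
qed

lemma pstar_in_cone_iff_incoming:
  assumes "is_wall u" "welt u m \<noteq> 0"
  shows "pstar m \<in> wcone u \<longleftrightarrow> incoming u"
proof -
  obtain k where k: "1 \<le> k" "m = int k *s wnormal u" using welt_multiple assms by blast
  have cc: "convex_cone (wcone u)" using wall_cone(1)[OF assms(1)] .
  have "pstar m = real k *\<^sub>R pstar (wnormal u)" "pstar (wnormal u) = (1 / real k) *\<^sub>R pstar m"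
    using k by (simp_all add: pstar_zsmult)
  then show ?thesis
    using convex_cone_scaleR[OF cc, of "real k" "pstar (wnormal u)"] convex_cone_scaleR[OF cc, of "1 / real k" "pstar m"]
    by (auto simp: incoming_def)
qed

text \<open>A wall with a component at \<open>m\<close> contains \<open>pstar m\<close> exactly if
  it is incoming, and the incoming walls are the initial ones. The unknown part of a diagram
  therefore sits on the outgoing rays.\<close>

lemma direction_sum_incoming:
  assumes D: "diagram I W" and m: "deg m \<le> d"
  shows "direction_sum d I W (pstar m) m = Psi (1 / of_nat (\<delta> i)) 0 (seed i) m + Psi (1 / of_nat (\<delta> j)) 0 (seed j) m"
proof -
  have wall: "is_wall (W l)" if "l \<in> I" for l using D that by (simp add: scattering_diagram_def)
  let ?S = "{l. l \<in> I \<and> welt (W l) \<notin> G_gt d \<and> pstar m \<in> wcone (W l)}"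
  let ?N = "{l \<in> I. incoming (W l)}"
  have bij: "bij_betw W ?N (range initial_wall)" using D by (simp add: initial_incoming_def)
  then have finN: "finite ?N" using bij_betw_finite by fastforce
  have "finite {l \<in> I. welt (W l) \<notin> G_gt d}" using D by (simp add: scattering_diagram_def)
  then have finS: "finite ?S" by (rule rev_finite_subset) auto
  have "direction_sum d I W (pstar m) m = (\<Sum>l\<in>?S \<inter> ?N. welt (W l) m)"
    unfolding direction_sum_def using finS wall pstar_in_cone_iff_incoming
    by (intro sum.mono_neutral_right) auto
  also have "\<dots> = (\<Sum>l\<in>?N. welt (W l) m)"
  proof (rule sum.mono_neutral_left[OF finN])
    show "\<forall>l\<in>?N - ?S \<inter> ?N. welt (W l) m = 0"
    proof
      fix l assume l: "l \<in> ?N - ?S \<inter> ?N"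
      show "welt (W l) m = 0"
      proof (rule ccontr)
        assume nz: "welt (W l) m \<noteq> 0"
        then have "welt (W l) \<notin> G_gt d" using m by (auto simp: G_gt_def)
        moreover have "pstar m \<in> wcone (W l)" using pstar_in_cone_iff_incoming[OF wall nz] l by auto
        ultimately show False using l by auto
      qed
    qed
  qed auto
  also have "\<dots> = (\<Sum>u\<in>range initial_wall. welt u m)"
    by (rule sum.reindex_bij_betw[OF bij, of "\<lambda>u. welt u m"])
  also have "\<dots> = (\<Sum>k\<in>UNIV. welt (initial_wall k) m)"
    using inj_initial_wall by (simp add: sum.reindex)
  finally show ?thesis by (simp add: sum_ij initial_wall_def)
qed

abbreviation angle :: "real \<Rightarrow> real" where
  "angle t \<equiv> 2 * pi * t - pi / 4"

text \<open>The circle starts in the open quadrant that meets no \<open>perp n\<close> with \<open>n \<in> Nplus\<close>.\<close>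

definition circ :: "real \<Rightarrow> real ^ 2" where
  "circ t = (- sin (angle t)) *\<^sub>R axis i 1 + cos (angle t) *\<^sub>R axis j 1"

lemma axis_nth_ij: "(x *\<^sub>R axis i 1 + y *\<^sub>R axis j 1 :: real ^ 2) $ i = x" "(x *\<^sub>R axis i 1 + y *\<^sub>R axis j 1 :: real ^ 2) $ j = y"
  using ij by (simp_all add: axis_def)

lemma smooth_circ: "smooth_curve circ"
proof -
  \<comment> \<open>Every derivative contributes a factor 2 pi and a phase shift by pi / 2.\<close>
  define D :: "nat \<Rightarrow> real \<Rightarrow> real ^ 2" where
    "D k t = ((2 * pi) ^ k * - sin (2 * pi * t - pi / 4 + real k * (pi / 2))) *\<^sub>R axis i 1 +
       ((2 * pi) ^ k * cos (2 * pi * t - pi / 4 + real k * (pi / 2))) *\<^sub>R axis j 1" for k t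
  have "(D k has_vector_derivative D (Suc k) t) (at t within {0..1})" for k t
  proof -
    have s: "sin (x + real (Suc k) * (pi / 2)) = cos (x + real k * (pi / 2))"
      "cos (x + real (Suc k) * (pi / 2)) = - sin (x + real k * (pi / 2))" for x
    proof -
      have "x + real (Suc k) * (pi / 2) = (x + real k * (pi / 2)) + pi / 2" by (simp add: algebra_simps)
      then show "sin (x + real (Suc k) * (pi / 2)) = cos (x + real k * (pi / 2))"
        "cos (x + real (Suc k) * (pi / 2)) = - sin (x + real k * (pi / 2))"
        by (simp_all only: sin_add[of "x + real k * (pi / 2)"] cos_add[of "x + real k * (pi / 2)"]) simp_all
    qed
    show ?thesis unfolding D_def s
      by (auto intro!: derivative_eq_intros simp: algebra_simps)
  qed
  moreover have "D 0 = circ" by (auto simp: D_def circ_def)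
  ultimately show ?thesis unfolding smooth_curve_def by blast
qed

lemma velocity_circ:
  assumes "t \<in> {0..1}"
  shows "velocity circ t = (2 * pi) *\<^sub>R ((- cos (angle t)) *\<^sub>R axis i 1 - sin (angle t) *\<^sub>R axis j 1)"
proof -
  have "(circ has_vector_derivative (2 * pi) *\<^sub>R ((- cos (angle t)) *\<^sub>R axis i 1 - sin (angle t) *\<^sub>R axis j 1))
    (at t within {0..1})"
    unfolding circ_def by (auto intro!: derivative_eq_intros simp: algebra_simps)
  then show ?thesis unfolding velocity_def
    using assms by (intro vector_derivative_within_closed_interval) auto
qed

lemma pairing_circ: "pairing n (circ t) = - of_int (n $ i) * sin (angle t) + of_int (n $ j) * cos (angle t)"
  unfolding pairing_ij circ_def axis_nth_ij by simp

lemma pairing_velocity_circ: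
  "t \<in> {0..1} \<Longrightarrow> pairing n (velocity circ t) = - (2 * pi) * (of_int (n $ i) * cos (angle t) + of_int (n $ j) * sin (angle t))"
  using ij by (simp add: velocity_circ pairing_ij axis_def algebra_simps)

text \<open>The cone has dimension 1, so for a nonzero \<open>v\<close> in it the segment from 0 to
  \<open>2 *\<^sub>R v\<close> has the same affine hull and contains \<open>v\<close> in its
  relative interior.\<close>

lemma cone_frontier:
  fixes u :: "2 wall"
  assumes "is_wall u"
  shows "rel_frontier (wcone u) \<subseteq> {0}"
proof
  fix v assume v: "v \<in> rel_frontier (wcone u)"
  let ?C = "wcone u"
  have cl: "closed ?C" and cc: "convex_cone ?C" using wall_cone[OF assms] by auto
  have vC: "v \<in> ?C" and vr: "v \<notin> rel_interior ?C" using v cl by (auto simp: rel_frontier_def)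
  show "v \<in> {0}"
  proof (rule ccontr)
    assume "v \<notin> {0}"
    then have v0: "v \<noteq> 0" by simp
    let ?S = "closed_segment 0 (2 *\<^sub>R v)"
    have sub: "?S \<subseteq> ?C"
      using convex_cone_scaleR[OF cc _ vC] by (auto simp: closed_segment_def)
    have "aff_dim ?S = 1" using v0 by (simp add: segment_convex_hull aff_dim_convex_hull aff_dim_2)
    then have "affine hull ?S = affine hull ?C"
      using assms hull_mono[OF sub, of affine]
      by (intro affine_dim_equal affine_affine_hull) (simp_all only: is_wall_def aff_dim_affine_hull, auto)
    then have "rel_interior ?S \<subseteq> rel_interior ?C" using sub by (intro subset_rel_interior)
    moreover have "v \<in> rel_interior ?S"
      using v0 by (auto simp: rel_interior_closed_segment in_segment intro!: exI[of _ "1/2"])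
    ultimately show False using vr by auto
  qed
qed

text \<open>In rank 2 a singular intersection is a single point, and every cone contains 0.\<close>

lemma Sing_subset:
  assumes "scattering_diagram I (W :: 'i \<Rightarrow> 2 wall)"
  shows "Sing I W \<subseteq> {0}"
proof -
  have wall: "is_wall (W l)" if "l \<in> I" for l using assms that by (simp add: scattering_diagram_def)
  have "wcone (W l) \<inter> wcone (W l') \<subseteq> {0}"
    if "l \<in> I" "l' \<in> I" "aff_dim (wcone (W l) \<inter> wcone (W l')) = int CARD(2) - 2" for l l'
  proof -
    have "aff_dim (wcone (W l) \<inter> wcone (W l')) = 0" using that(3) by simp
    then obtain a where a: "wcone (W l) \<inter> wcone (W l') = {a}" using aff_dim_eq_0 by metis
    moreover have "0 \<in> wcone (W l) \<inter> wcone (W l')"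
      using convex_cone_contains_0 wall_cone(1) wall that by blast
    ultimately show ?thesis by auto
  qed
  then show ?thesis unfolding Sing_def using cone_frontier[OF wall] by blast
qed

lemma Nplus_nth: "n \<in> Nplus \<Longrightarrow> 0 \<le> n $ i \<and> 0 \<le> n $ j \<and> 0 < n $ i + n $ j"
  by (simp add: Nplus_def all_ij sum_ij)

lemma circ_nonzero: "circ t \<noteq> 0"
proof
  assume "circ t = 0"
  then have "circ t $ i = 0" "circ t $ j = 0" by simp_all
  then have "sin (angle t) = 0" "cos (angle t) = 0"
    unfolding circ_def axis_nth_ij by simp_all
  then show False using sin_cos_squared_add[of "angle t"] by simp
qed

lemma admissible_circ:
  assumes sd: "scattering_diagram I W"
  shows "admissible I W circ"
proof -
  have wall: "is_wall (W l)" if "l \<in> I" for l using assms that by (simp add: scattering_diagram_def)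
  have "circ t \<notin> Supp I W" if "t = 0 \<or> t = 1" for t
  proof
    assume "circ t \<in> Supp I W"
    then obtain l where l: "l \<in> I" "circ t \<in> perp (wnormal (W l))"
      unfolding Supp_def using wall wall_cone(3) by blast
    have "2 * pi * 1 - pi / 4 = 2 * pi + - (pi / 4)" by simp
    then have "sin (angle t) = - (sqrt 2 / 2)" "cos (angle t) = sqrt 2 / 2"
      using that sin_periodic[of "- (pi / 4)"] cos_periodic[of "- (pi / 4)"]
      by (auto simp: sin_45 cos_45 algebra_simps)
    then have "(real_of_int (wnormal (W l) $ i) + real_of_int (wnormal (W l) $ j)) * (sqrt 2 / 2) = 0"
    proof -
      assume sc: "sin (angle t) = - (sqrt 2 / 2)" "cos (angle t) = sqrt 2 / 2"
      have "pairing (wnormal (W l)) (circ t) = 0" using l(2) by (simp add: perp_def)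
      then show ?thesis unfolding pairing_circ sc by (simp add: algebra_simps)
    qed
    moreover have "0 < wnormal (W l) $ i + wnormal (W l) $ j" using Nplus_nth wall_normal wall l(1) by blast
    ultimately show False by (simp flip: of_int_add)
  qed
  \<comment> \<open>\<open>circ t\<close> and its velocity are orthogonal and nonzero, so a normal
    that annihilates both is 0.\<close>
  moreover have "pairing (wnormal (W l)) (velocity circ t) \<noteq> 0"
    if "t \<in> {0..1}" "l \<in> I" "circ t \<in> wcone (W l)" for t l
  proof
    let ?a = "real_of_int (wnormal (W l) $ i)" and ?b = "real_of_int (wnormal (W l) $ j)"
    let ?s = "sin (angle t)" and ?c = "cos (angle t)"
    assume "pairing (wnormal (W l)) (velocity circ t) = 0"
    then have 1: "?a * ?c + ?b * ?s = 0" using that(1) by (simp add: pairing_velocity_circ)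
    have "circ t \<in> perp (wnormal (W l))" using wall_cone(3)[OF wall] that by blast
    then have 2: "- ?a * ?s + ?b * ?c = 0" by (simp add: perp_def pairing_circ)
    have "?a * (?c * ?c + ?s * ?s) = ?c * (?a * ?c + ?b * ?s) - ?s * (- ?a * ?s + ?b * ?c)"
      "?b * (?c * ?c + ?s * ?s) = ?s * (?a * ?c + ?b * ?s) + ?c * (- ?a * ?s + ?b * ?c)"
      by (simp_all add: algebra_simps del: sin_cos_squared_add3)
    then have "?a = 0" "?b = 0" unfolding 1 2 sin_cos_squared_add3 by simp_all
    then show False using Nplus_nth[OF wall_normal[OF wall[OF that(2)]]] by simp
  qed
  moreover have "circ t \<notin> Sing I W" for t using Sing_subset[OF sd] circ_nonzero by blast
  ultimately show ?thesis unfolding admissible_def using smooth_circ by blast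
qed

lemma circ_loop: "circ 0 = circ 1"
proof -
  have "2 * pi * 1 - pi / 4 = - (pi / 4) + 2 * pi" by simp
  then show ?thesis unfolding circ_def using sin_periodic[of "- (pi / 4)"] cos_periodic[of "- (pi / 4)"]
    by simp
qed

end

lemma (in fixed_data) Psi_not_multiple: "(\<And>k. 1 \<le> k \<Longrightarrow> m \<noteq> int k *s n) \<Longrightarrow> Psi a b n m = 0"
proof -
  assume "\<And>k. 1 \<le> k \<Longrightarrow> m \<noteq> int k *s n"
  then have "{k::nat. 1 \<le> k \<and> m = int k *s n} = {}" by blast
  then show ?thesis unfolding Psi_def by (simp only: sum.empty)
qed

context rank2_data
begin

lemma direction_sum_off_Nplus:
  assumes "scattering_diagram I W" "m \<notin> Nplus"
  shows "direction_sum d I W v m = 0"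
  unfolding direction_sum_def using assms welt_ghat
  by (intro sum.neutral) (auto simp: scattering_diagram_def ghat_def)

section \<open>The relation read off from the circle\<close>

text \<open>The component \<open>m\<close> is read on the outgoing ray of \<open>m\<close> itself,
  so this single function collects all outgoing walls; \<open>ray_part\<close> separates the
  directions again.\<close>

definition outgoing_sum :: "'i set \<Rightarrow> ('i \<Rightarrow> 2 wall) \<Rightarrow> 2 lie" where
  "outgoing_sum I W m = direction_sum 4 I W (- pstar m) m"

definition ray_part :: "int \<Rightarrow> int \<Rightarrow> 2 lie \<Rightarrow> 2 lie" where
  "ray_part a0 b0 x m = (if m \<in> Nplus \<and> m $ i * b0 = m $ j * a0 then x m else 0)"

definition tau :: "real \<Rightarrow> real" where
  "tau \<rho> = (\<rho> + pi / 4) / (2 * pi)"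

lemma tau_angle: "2 * pi * tau \<rho> - pi / 4 = \<rho>"
  by (simp add: tau_def)

lemma tau_01: "- (pi / 4) \<le> \<rho> \<Longrightarrow> \<rho> \<le> 7 * pi / 4 \<Longrightarrow> tau \<rho> \<in> {0..1}"
  by (auto simp: tau_def field_simps)

text \<open>\<open>e = 1\<close> on the outgoing ray of \<open>(a\<^sub>0, b\<^sub>0)\<close> and \<open>e = - 1\<close> on the opposite, incoming one.\<close>

lemma crossing_sum_circ:
  assumes D: "diagram I W" and \<rho>: "- (pi / 4) \<le> \<rho>" "\<rho> \<le> 7 * pi / 4"
    and ab: "0 \<le> a0" "0 \<le> b0" "0 < a0 + b0" and c: "0 < c" and e: "e = 1 \<or> e = - 1"
    and sc: "sin \<rho> = of_int e * c * of_int b0" "cos \<rho> = of_int e * c * of_int a0"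
  shows "th (crossing_sum 4 I W circ (tau \<rho>)) =
    th (\<lambda>m. of_int e * ray_part a0 b0 (\<lambda>m. direction_sum 4 I W (- of_int e *\<^sub>R pstar m) m) m)"
proof (rule th_cong)
  have sd: "scattering_diagram I W" using D by simp
  fix a b :: nat
  define m where "m = nvec a b"
  have mn: "m $ i = int a" "m $ j = int b" by (simp_all add: m_def)
  have "crossing_sum 4 I W circ (tau \<rho>) m =
    of_int e * ray_part a0 b0 (\<lambda>m. direction_sum 4 I W (- of_int e *\<^sub>R pstar m) m) m"
  proof (cases "m \<in> Nplus")
    case False
    then show ?thesis
      using direction_sum_off_Nplus[OF sd] by (simp add: crossing_sum_def ray_part_def)
  next
    case m: True
    then have abp: "0 < a + b" unfolding m_def mk_Nplus by linarith
    show ?thesis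
    proof (cases "int a * b0 = int b * a0")
      case par: True
      define s where "s = c * (of_int (a0 + b0)) / (real (a + b) * wr)"
      have "0 < real_of_int (a0 + b0)" "0 < real (a + b)" using ab(3) abp by (simp_all only: of_int_0_less_iff of_nat_0_less_iff)
      then have s: "0 < s" unfolding s_def using c wr_pos by (intro divide_pos_pos mult_pos_pos)
      have r: "real a * of_int b0 = real b * of_int a0" using par by (metis of_int_mult of_int_of_nat_eq)
      have v: "circ (tau \<rho>) = s *\<^sub>R (- of_int e *\<^sub>R pstar m)"
      proof -
        have e1: "real_of_int b0 = of_int (a0 + b0) * real b / real (a + b)"
          and e2: "real_of_int a0 = of_int (a0 + b0) * real a / real (a + b)"
          using r \<open>0 < real (a + b)\<close> by (simp_all add: eq_divide_eq algebra_simps del: of_nat_0_less_iff)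
        have "c * real_of_int b0 = s * (real b * wr)" "c * real_of_int a0 = s * (real a * wr)"
          using wr_pos by (subst e1, simp add: s_def, subst e2, simp add: s_def)
        then show ?thesis
          unfolding vec_eq_ij circ_def axis_nth_ij tau_angle sc by (simp add: pstar_nth mn)
      qed
      have pos: "0 < int a * a0 + int b * b0"
      proof (rule ccontr)
        assume "\<not> 0 < int a * a0 + int b * b0"
        moreover have "0 \<le> int a * a0" "0 \<le> int b * b0" using ab by auto
        ultimately have "int a * a0 = 0" "int b * b0 = 0" by linarith+
        then show False using par ab abp by auto
      qed
      have "crossing_sign circ (tau \<rho>) m = e"
      proof -
        have "pairing m (velocity circ (tau \<rho>)) = - (2 * pi) * of_int e * c * of_int (int a * a0 + int b * b0)"
          unfolding pairing_velocity_circ[OF tau_01[OF \<rho>]] tau_angle sc mn by (simp add: algebra_simps)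
        moreover have "0 < 2 * pi * c * of_int (int a * a0 + int b * b0)" using pos c by (simp only: zero_less_mult_iff of_int_0_less_iff) auto
        ultimately show ?thesis using e by (auto simp: crossing_sign_def)
      qed
      then show ?thesis
        unfolding crossing_sum_def v direction_sum_scale[OF sd s] ray_part_def using m par mn by simp
    next
      case False
      have "pairing m (circ (tau \<rho>)) = of_int e * c * of_int (int b * a0 - int a * b0)"
        unfolding pairing_circ tau_angle sc mn by (simp add: algebra_simps)
      moreover have "of_int e * c * of_int (int b * a0 - int a * b0) \<noteq> 0"
        using e c False by (simp only: mult_eq_0_iff of_int_eq_0_iff) auto
      ultimately have "circ (tau \<rho>) \<notin> perp m" by (simp add: perp_def)
      then show ?thesis using direction_sum_off_perp[OF sd] False mn by (simp add: crossing_sum_def ray_part_def)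
    qed
  qed
  then show "crossing_sum 4 I W circ (tau \<rho>) (nvec a b) =
    of_int e * ray_part a0 b0 (\<lambda>m. direction_sum 4 I W (- of_int e *\<^sub>R pstar m) m) (nvec a b)"
    by (simp add: m_def)
qed

lemma Psi_ray_part:
  "th (ray_part 1 0 (\<lambda>m. Psi a 0 (seed i) m + Psi a' 0 (seed j) m)) = th (Psi a 0 (seed i))"
  "th (ray_part 0 1 (\<lambda>m. Psi a 0 (seed i) m + Psi a' 0 (seed j) m)) = th (Psi a' 0 (seed j))"
  by (rule th_cong, auto simp: ray_part_def seed_mk intro!: Psi_not_multiple)+

text \<open>The outgoing ray of (a, b) is met at the angle arctan (b / a), and a + b \<le> 4 leaves
  only the listed slopes. The angles pi and 3 pi / 2 belong to the incoming halves of the initial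
  lines.\<close>

lemma crossing_times_circ:
  assumes D: "diagram I W"
  shows "fst ` crossings 4 I W circ \<subseteq>
    set (map tau [0, arctan (1/3), arctan (1/2), pi / 4, arctan 2, arctan 3, pi / 2, pi, 3 * pi / 2])"
proof
  let ?R = "{0, arctan (1/3), arctan (1/2), pi / 4, arctan 2, arctan 3, pi / 2, pi, 3 * pi / 2}"
  fix t assume "t \<in> fst ` crossings 4 I W circ"
  then obtain l where l: "t \<in> {0..1}" "l \<in> I" "welt (W l) \<notin> G_gt 4" "circ t \<in> wcone (W l)"
    by (auto simp: crossings_def)
  have wall: "is_wall (W l)" using D l by (simp add: scattering_diagram_def)
  define \<rho> where "\<rho> = 2 * pi * t - pi / 4"
  have t: "t = tau \<rho>" by (simp add: tau_def \<rho>_def)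
  have "2 * pi * t \<le> 2 * pi * 1" using l(1) by (intro mult_left_mono) auto
  moreover have "0 \<le> 2 * pi * t" using l(1) by simp
  ultimately have \<rho>: "- (pi / 4) \<le> \<rho>" "\<rho> \<le> 7 * pi / 4" unfolding \<rho>_def by linarith+
  obtain m where m: "deg m \<le> 4" "welt (W l) m \<noteq> 0"
    using l(3) welt_ghat[OF wall] by (auto simp: G_gt_def)
  then have "m \<in> Nplus" using welt_ghat[OF wall] by (auto simp: ghat_def)
  then obtain a b where ab: "m = nvec a b" "0 < a + b" using Nplus_mk by blast
  have ab4: "a + b \<le> 4" using m ab by simp
  have "circ t \<in> perp m" using welt_zero_off_perp[OF wall l(4)] m by auto
  then have e: "real a * sin \<rho> = real b * cos \<rho>" by (simp add: perp_def pairing_circ ab \<rho>_def)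
  have sin0: "\<rho> \<in> {0, pi}" if s0: "sin \<rho> = 0"
  proof -
    obtain k :: int where k: "\<rho> = of_int k * pi" using iffD1[OF sin_zero_iff_int2 s0] by (elim exE)
    have "- (1/4) * pi \<le> of_int k * pi" "of_int k * pi \<le> (7/4) * pi" using \<rho> k by simp_all
    then have "- (1/4) \<le> real_of_int k" "real_of_int k \<le> 7/4"
      using pi_gt_zero by (simp_all only: mult_le_cancel_right_pos)
    then have "k = 0 \<or> k = 1" by linarith
    then show ?thesis using k by auto
  qed
  have cos0: "\<rho> \<in> {pi / 2, 3 * pi / 2}" if c0: "cos \<rho> = 0"
  proof -
    obtain k :: int where k: "\<rho> = of_int k * pi + pi / 2" using iffD1[OF cos_zero_iff_int2 c0] by (elim exE)
    have "- (3/4) * pi \<le> of_int k * pi" "of_int k * pi \<le> (5/4) * pi" using \<rho> k by simp_all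
    then have "- (3/4) \<le> real_of_int k" "real_of_int k \<le> 5/4"
      using pi_gt_zero by (simp_all only: mult_le_cancel_right_pos)
    then have "k = 0 \<or> k = 1" by linarith
    then show ?thesis using k by auto
  qed
  have "\<rho> \<in> ?R"
  proof (cases "a = 0 \<or> b = 0")
    case True
    then have "sin \<rho> = 0 \<or> cos \<rho> = 0" using e ab(2) by auto
    then show ?thesis using sin0 cos0 by auto
  next
    case False
    \<comment> \<open>Incoming walls are initial and have components on the axes only. So this wall
      is met on its outgoing side, where sine and cosine are positive.\<close>
    have ninc: "\<not> incoming (W l)"
    proof
      assume "incoming (W l)"
      then have "W l \<in> range initial_wall" using D l(2) by (auto simp: initial_incoming_def bij_betw_def)
      then obtain k where "W l = initial_wall k" by auto
      then have "wnormal (W l) = seed k" by (simp add: initial_wall_def)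
      then obtain q where "m = int q *s seed k" using welt_multiple[OF wall m(2)] by auto
      then show False using False ab index_cases[of k] by (auto simp: seed_mk)
    qed
    then have np: "pstar m \<notin> wcone (W l)" using pstar_in_cone_iff_incoming[OF wall m(2)] by simp
    have m0: "m \<noteq> 0" using False ab by (auto simp: vec_eq_ij)
    obtain s where s: "circ t = s *\<^sub>R pstar m" using perp_multiple_pstar \<open>circ t \<in> perp m\<close> m0 by blast
    have "s \<le> 0"
    proof (rule ccontr)
      assume "\<not> s \<le> 0"
      then have "pstar m = (1 / s) *\<^sub>R circ t" "0 \<le> 1 / s" using s by simp_all
      then show False using np convex_cone_scaleR[OF wall_cone(1)[OF wall] _ l(4), of "1 / s"] by simp
    qed
    moreover have sn: "sin \<rho> = - s * (real b * wr)" "cos \<rho> = - s * (real a * wr)"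
      using arg_cong[OF s, of "\<lambda>v. v $ i"] arg_cong[OF s, of "\<lambda>v. v $ j"]
      unfolding circ_def axis_nth_ij \<rho>_def by (simp_all add: pstar_nth ab)
    moreover have "s \<noteq> 0" using s circ_nonzero by auto
    ultimately have pos: "0 < sin \<rho>" "0 < cos \<rho>"
      using False wr_pos unfolding sn by (simp_all add: zero_less_mult_iff mult_less_0_iff)
    have tan: "tan \<rho> = real b / real a"
      using e pos False by (simp add: tan_def field_simps)
    have "\<rho> < pi / 2"
    proof (rule ccontr)
      assume "\<not> \<rho> < pi / 2"
      then have "pi / 2 \<le> \<rho>" by simp
      then have "cos \<rho> \<le> 0 \<or> sin \<rho> \<le> 0"
      proof (cases "\<rho> \<le> 3 * pi / 2")
        case True
        then have "cos \<rho> \<le> 0" using \<open>pi / 2 \<le> \<rho>\<close>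
          using cos_ge_zero[of "\<rho> - pi"] by (simp add: cos_diff)
        then show ?thesis by simp
      next
        case False
        then have "sin \<rho> \<le> 0" using sin_le_zero[of \<rho>] \<rho>(2) by simp
        then show ?thesis by simp
      qed
      then show False using pos by auto
    qed
    then have "arctan (tan \<rho>) = \<rho>" using \<rho>(1) pi_gt_zero by (intro arctan_tan) linarith+
    then have r: "\<rho> = arctan (real b / real a)" using tan by simp
    have "a = 1 \<or> a = 2 \<or> a = 3" "b = 1 \<or> b = 2 \<or> b = 3" using False ab4 by auto
    then have "(a = 1 \<and> b = 1) \<or> (a = 2 \<and> b = 2) \<or> (a = 2 \<and> b = 1) \<or> (a = 3 \<and> b = 1) \<or> (a = 1 \<and> b = 2) \<or> (a = 1 \<and> b = 3)"
      using ab4 by (elim disjE) simp_all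
    then show ?thesis unfolding r by (elim disjE conjE) simp_all
  qed
  then show "t \<in> set (map tau [0, arctan (1/3), arctan (1/2), pi / 4, arctan 2, arctan 3, pi / 2, pi, 3 * pi / 2])"
    unfolding t by (simp only: set_map list.set imageI)
qed

abbreviation "Psi_i \<equiv> Psi (1 / of_nat (\<delta> i)) 0 (seed i)"
abbreviation "Psi_j \<equiv> Psi (1 / of_nat (\<delta> j)) 0 (seed j)"

lemma Psi_ghat: "n \<in> Nplus \<Longrightarrow> Psi a b n \<in> ghat"
  unfolding ghat_def by (intro CollectI allI impI Psi_not_multiple) (metis Nplus_zsmult)

lemma texp_minus: "u \<in> hi 1 \<Longrightarrow> texp u * texp (- u) = 1"
  using texp_add[of u "- u"] by simp

text \<open>Later factors stand on the left, and the incoming halves of the initial lines are met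
  last, with sign - 1. The loop therefore gives Psi_j^-1 Psi_i^-1 U 0 1 ... U 1 0 = 1, and the
  inverses are moved to the other side.\<close>

lemma loop_relation:
  assumes q: "qcsd I W"
  defines "U \<equiv> \<lambda>a b. texp (th (ray_part a b (outgoing_sum I W)))"
  shows "texp (th Psi_i) * texp (th Psi_j) =
    U 0 1 * (U 1 3 * (U 1 2 * (U 1 1 * (U 2 1 * (U 3 1 * U 1 0)))))"
proof -
  have D: "diagram I W" using q by (simp add: qcsd_def)
  let ?rs = "[0, arctan (1/3), arctan (1/2), pi / 4, arctan 2, arctan 3, pi / 2, pi, 3 * pi / 2]"
  let ?ts = "map tau ?rs"
  let ?C = "\<lambda>\<rho>. th (crossing_sum 4 I W circ (tau \<rho>))" and ?R = "\<lambda>a b. th (ray_part a b (outgoing_sum I W))"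
  have lt: "0 < arctan (1/3)" "arctan (1/3) < arctan (1/2)" "arctan (1/2) < pi / 4" "pi / 4 < arctan 2"
    "arctan 2 < arctan 3" "arctan 3 < pi / 2" "pi / 2 < pi" "pi < 3 * pi / 2"
    using arctan_ubound[of 3] pi_gt_zero by (simp_all add: arctan_less_iff flip: arctan_one)
  have tau_mono: "tau x < tau y \<longleftrightarrow> x < y" for x y by (simp add: tau_def divide_less_cancel)
  have "sorted_wrt (<) ?ts"
    unfolding sorted_wrt_map tau_mono by (simp del: arctan_less_iff) (use lt in linarith)
  then have ts: "sorted ?ts" "distinct ?ts" using strict_sorted_iff by blast+
  have rb: "- (pi / 4) \<le> r \<and> r \<le> 7 * pi / 4" if "r \<in> set ?rs" for r
  proof -
    have "r = 0 \<or> r = arctan (1/3) \<or> r = arctan (1/2) \<or> r = pi / 4 \<or> r = arctan 2 \<or> r = arctan 3 \<or>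
      r = pi / 2 \<or> r = pi \<or> r = 3 * pi / 2" using that by simp
    then show ?thesis using lt pi_gt_zero by (elim disjE) linarith+
  qed
  have ts01: "set ?ts \<subseteq> {0..1}" unfolding set_map using rb tau_01 by (intro image_subsetI) blast
  have "path_prod I W circ = gone"
    using q admissible_circ[of I W] circ_loop unfolding qcsd_def consistent_def by blast
  then have "texp (th (path_prod I W circ)) = 1" by (simp add: gone_def th_linear)
  then have one: "fold (\<lambda>t acc. texp (th (crossing_sum 4 I W circ t)) * acc) ?ts 1 = 1"
    using path_prod_product(2)[OF D admissible_circ ts crossing_times_circ[OF D] ts01] D by simp
  have out: "?C \<rho> = ?R a b"
    if "\<rho> \<in> set ?rs" "0 \<le> a" "0 \<le> b" "0 < a + b" "0 < c" "sin \<rho> = c * of_int b" "cos \<rho> = c * of_int a" for \<rho> a b c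
    using crossing_sum_circ[OF D, of \<rho> a b c 1] rb[OF that(1)] that by (simp add: outgoing_sum_def[abs_def])
  have inc: "?C \<rho> = - th (ray_part a b (\<lambda>m. Psi_i m + Psi_j m))"
    if "\<rho> \<in> set ?rs" "0 \<le> a" "0 \<le> b" "0 < a + b" "0 < c" "sin \<rho> = - c * of_int b" "cos \<rho> = - c * of_int a" for \<rho> a b c
  proof -
    have "th (\<lambda>m. of_int (-1) * ray_part a b (\<lambda>m. direction_sum 4 I W (- of_int (-1) *\<^sub>R pstar m) m) m) =
      th (\<lambda>m. - 1 * ray_part a b (\<lambda>m. Psi_i m + Psi_j m) m)"
      using direction_sum_incoming[OF D] by (intro th_cong) (simp add: ray_part_def)
    also have "\<dots> = - th (ray_part a b (\<lambda>m. Psi_i m + Psi_j m))" unfolding th_linear(3) by simp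
    finally show ?thesis using crossing_sum_circ[OF D, of \<rho> a b c "-1"] rb[OF that(1)] that by simp
  qed
  have at: "?C (arctan (of_int b / of_int a)) = ?R a b"
    if "arctan (of_int b / of_int a) \<in> set ?rs" "0 < a" "0 \<le> b" for a b :: int
  proof (rule out[of _ a b "1 / (of_int a * sqrt (1 + (of_int b / of_int a)\<^sup>2))", OF that(1)])
    have "0 < sqrt (1 + (of_int b / of_int a)\<^sup>2)" by (simp add: add_pos_nonneg)
    then show "0 < 1 / (real_of_int a * sqrt (1 + (real_of_int b / real_of_int a)\<^sup>2))" using that by simp
  qed (use that in \<open>simp_all add: sin_arctan cos_arctan\<close>)
  have t10: "?C 0 = ?R 1 0"
    using at[of 0 1] by simp
  have t31: "?C (arctan (1/3)) = ?R 3 1"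
    using at[of 1 3] by simp
  have t21: "?C (arctan (1/2)) = ?R 2 1"
    using at[of 1 2] by simp
  have t11: "?C (pi / 4) = ?R 1 1"
    using at[of 1 1] by simp
  have t12: "?C (arctan 2) = ?R 1 2"
    using at[of 2 1] by simp
  have t13: "?C (arctan 3) = ?R 1 3"
    using at[of 3 1] by simp
  have t01: "?C (pi / 2) = ?R 0 1"
    by (rule out[of _ 0 1 1]) simp_all
  have ti: "?C pi = - th Psi_i"
    using inc[of pi 1 0 1] by (simp add: Psi_ray_part)
  have s32: "sin (3 * pi / 2) = -1" "cos (3 * pi / 2) = 0"
    using sin_3over2_pi cos_3over2_pi by simp_all
  have tj: "?C (3 * pi / 2) = - th Psi_j"
    using inc[of "3 * pi / 2" 0 1 1] s32 by (simp add: Psi_ray_part)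
  have hi: "th Psi_i \<in> hi 1" "th Psi_j \<in> hi 1"
    by (intro th_hi_1 Psi_ghat, simp add: seed_mk)+
  let ?P = "U 0 1 * (U 1 3 * (U 1 2 * (U 1 1 * (U 2 1 * (U 3 1 * U 1 0)))))"
  have "texp (- th Psi_j) * (texp (- th Psi_i) * ?P) = 1"
    using one unfolding U_def by (simp add: t10 t31 t21 t11 t12 t13 t01 ti tj)
  then have "texp (th Psi_i) * texp (th Psi_j) * (texp (- th Psi_j) * (texp (- th Psi_i) * ?P)) =
     texp (th Psi_i) * texp (th Psi_j)" by simp
  moreover have "texp (th Psi_i) * texp (th Psi_j) * (texp (- th Psi_j) * (texp (- th Psi_i) * ?P)) =
     texp (th Psi_i) * (texp (th Psi_j) * texp (- th Psi_j)) * texp (- th Psi_i) * ?P"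
    by (simp only: mult.assoc)
  ultimately show ?thesis using texp_minus[OF hi(1)] texp_minus[OF hi(2)] by simp
qed

end

section \<open>Solving the loop relation\<close>

definition on_x_axis :: "'a::field_char_0 skew \<Rightarrow> bool" where
  "on_x_axis f \<longleftrightarrow> (\<forall>a b c. 0 < b \<longrightarrow> cmp f a b c = 0)"

definition on_y_axis :: "'a::field_char_0 skew \<Rightarrow> bool" where
  "on_y_axis f \<longleftrightarrow> (\<forall>a b c. 0 < a \<longrightarrow> cmp f a b c = 0)"

lemma on_axis_texp: "on_x_axis u \<Longrightarrow> on_x_axis (texp u)" "on_y_axis u \<Longrightarrow> on_y_axis (texp u)"
proof -
  have x: "on_x_axis (f * g)" if "on_x_axis f" "on_x_axis g" for f g :: "'a skew"
  proof -
    have "cmp f a' b' c * cmp g (a - a') (b - b') c = 0" if "0 < b" for a b a' b' c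
      using that \<open>on_x_axis f\<close> \<open>on_x_axis g\<close> by (cases "b' = 0") (auto simp: on_x_axis_def)
    then show ?thesis by (auto simp: on_x_axis_def times_skew.rep_eq intro!: sum.neutral)
  qed
  have y: "on_y_axis (f * g)" if "on_y_axis f" "on_y_axis g" for f g :: "'a skew"
  proof -
    have "cmp f a' b' c * cmp g (a - a') (b - b') c = 0" if "0 < a" for a b a' b' c
      using that \<open>on_y_axis f\<close> \<open>on_y_axis g\<close> by (cases "a' = 0") (auto simp: on_y_axis_def)
    then show ?thesis by (auto simp: on_y_axis_def times_skew.rep_eq intro!: sum.neutral)
  qed
  show "on_x_axis u \<Longrightarrow> on_x_axis (texp u)" 
    using x[of u u] x[of u "u * u"] x[of u "u * (u * u)"] by (auto simp: on_x_axis_def texp_def)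
  show "on_y_axis u \<Longrightarrow> on_y_axis (texp u)"
    using y[of u u] y[of u "u * u"] y[of u "u * (u * u)"] by (auto simp: on_y_axis_def texp_def)
qed

text \<open>Powers of y on the left, like powers of x on the right, are already normally ordered, so
  no power of \<open>c\<close> appears.\<close>

lemma cmp_times_y_axis:
  assumes "on_y_axis u" "i + j \<le> 4"
  shows "cmp (u * f) i j c = (\<Sum>b=0..j. cmp u 0 b c * cmp f i (j - b) c)"
proof -
  have "cmp (u * f) i j c = (\<Sum>a\<in>{0}. \<Sum>b=0..j. cmp u a b c * cmp f (i - a) (j - b) c * c ^ (a * (j - b)))"
    unfolding cmp_times[OF assms(2)] using assms(1)
    by (intro sum.mono_neutral_right) (auto simp: on_y_axis_def intro!: sum.neutral)
  then show ?thesis by simp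
qed

lemma cmp_times_x_axis:
  assumes "on_x_axis v" "i + j \<le> 4"
  shows "cmp (f * v) i j c = (\<Sum>a=0..i. cmp f a j c * cmp v (i - a) 0 c)"
proof -
  have "(\<Sum>b=0..j. cmp f a b c * cmp v (i - a) (j - b) c * c ^ (a * (j - b))) = cmp f a j c * cmp v (i - a) 0 c" for a
  proof -
    have "(\<Sum>b=0..j. cmp f a b c * cmp v (i - a) (j - b) c * c ^ (a * (j - b))) =
      (\<Sum>b\<in>{j}. cmp f a b c * cmp v (i - a) (j - b) c * c ^ (a * (j - b)))"
      using assms(1) by (intro sum.mono_neutral_right) (auto simp: on_x_axis_def)
    then show ?thesis by simp
  qed
  then show ?thesis unfolding cmp_times[OF assms(2)] by simp
qed

text \<open>In this order every x has to pass every y.\<close>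

lemma cmp_times_x_y_axis:
  assumes u: "on_x_axis u" and v: "on_y_axis v" and ij: "i + j \<le> 4"
  shows "cmp (u * v) i j c = cmp u i 0 c * cmp v 0 j c * c ^ (i * j)"
proof -
  have "cmp (u * v) i j c = (\<Sum>a\<in>{i}. \<Sum>b=0..j. cmp u a b c * cmp v (i - a) (j - b) c * c ^ (a * (j - b)))"
    unfolding cmp_times[OF ij] using v
    by (intro sum.mono_neutral_right) (auto simp: on_y_axis_def intro!: sum.neutral)
  also have "\<dots> = (\<Sum>b=0..j. cmp u i b c * cmp v 0 (j - b) c * c ^ (i * (j - b)))" by simp
  also have "\<dots> = (\<Sum>b\<in>{0}. cmp u i b c * cmp v 0 (j - b) c * c ^ (i * (j - b)))"
    using u by (intro sum.mono_neutral_right) (auto simp: on_x_axis_def)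
  finally show ?thesis by simp
qed

lemma cmp_texp_00: "u \<in> hi 1 \<Longrightarrow> cmp (texp u) 0 0 c = 1"
  by (simp add: texp_def times_skew.rep_eq hi_def)

lemma cmp_texp_x_axis:
  assumes "u \<in> hi 1"
  shows "cmp (texp u) 1 0 c = cmp u 1 0 c"
    "cmp (texp u) 2 0 c = cmp u 2 0 c + cmp u 1 0 c ^ 2 / 2"
    "cmp (texp u) 3 0 c = cmp u 3 0 c + cmp u 1 0 c * cmp u 2 0 c + cmp u 1 0 c ^ 3 / 6"
  using assms by (simp_all add: texp_def times_skew.rep_eq hi_def numeral_eq_Suc sum.atLeast0_atMost_Suc field_simps)

lemma cmp_texp_y_axis:
  assumes "u \<in> hi 1"
  shows "cmp (texp u) 0 1 c = cmp u 0 1 c"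
    "cmp (texp u) 0 2 c = cmp u 0 2 c + cmp u 0 1 c ^ 2 / 2"
    "cmp (texp u) 0 3 c = cmp u 0 3 c + cmp u 0 1 c * cmp u 0 2 c + cmp u 0 1 c ^ 3 / 6"
  using assms by (simp_all add: texp_def times_skew.rep_eq hi_def numeral_eq_Suc sum.atLeast0_atMost_Suc field_simps)

lemma texp_high:
  "u \<in> hi 3 \<Longrightarrow> texp u = 1 + u" "u \<in> hi 2 \<Longrightarrow> texp u = 1 + u + skscale (1/2) (u * u)"
proof -
  assume u: "u \<in> hi 3"
  then have "u * u = 0" by (intro hi_times_0[OF u u]) simp
  then show "texp u = 1 + u" by (simp add: texp_def)
next
  assume u: "u \<in> hi 2"
  have "u * (u * u) = 0" using hi_times_0[OF u hi_times[OF u u]] by simp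
  then show "texp u = 1 + u + skscale (1/2) (u * u)" by (simp add: texp_def)
qed

text \<open>Among the products of two logarithms only \<open>u11 * u11\<close> has order below
  5.\<close>

lemma middle_product:
  assumes u13: "u13 \<in> hi 4" and u12: "u12 \<in> hi 3" and u11: "u11 \<in> hi 2" and u21: "u21 \<in> hi 3" and u31: "u31 \<in> hi 4"
  shows "texp u13 * (texp u12 * (texp u11 * (texp u21 * texp u31))) =
    1 + (u13 + u12 + u11 + skscale (1/2) (u11 * u11) + u21 + u31)"
proof -
  have z: "f * g = 0" if "f \<in> hi 3" "g \<in> hi 2" for f g :: "'a skew" using hi_times_0[OF that] by simp
  have z': "g * f = 0" if "f \<in> hi 3" "g \<in> hi 2" for f g :: "'a skew" using hi_times_0[OF that(2,1)] by simp
  have m: "u13 \<in> hi 3" "u31 \<in> hi 3" "u13 \<in> hi 2" "u31 \<in> hi 2" "u12 \<in> hi 2" "u21 \<in> hi 2" "u11 * u11 \<in> hi 3"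
    using assms hi_mono[of u13 4] hi_mono[of u31 4] hi_mono[of u12 3 2] hi_mono[of u21 3 2] hi_times_ge[OF u11 u11, of 3] by auto
  show ?thesis
    by (simp add: texp_high m assms distrib_left distrib_right z z' mult.assoc[symmetric] skscale_distribs add_ac)
qed

lemma (in rank2_data) ray_part_th:
  "cmp (th (ray_part a0 b0 x)) a b c =
    (if 0 < a + b \<and> a + b \<le> 4 \<and> int a * b0 = int b * a0 \<and> c = Q ^ 2 then x (nvec a b) / kap * Q ^ (a * b) else 0)"
  by (auto simp: cmp_th ray_part_def)

context rank2_data
begin

text \<open>The coefficients of \<open>y\<^sup>b x\<^sup>a\<close> in the loop relation; \<open>f a b\<close> is that of the logarithm of the outgoing walls.\<close>

lemma loop_components:
  assumes q: "qcsd I W"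
  defines "f \<equiv> \<lambda>a b. outgoing_sum I W (nvec a b) / kap * Q ^ (a * b)"
  defines "e \<equiv> \<lambda>a. cmp (texp (th Psi_i)) a 0 (Q ^ 2)"
  defines "g \<equiv> \<lambda>b. cmp (texp (th Psi_j)) 0 b (Q ^ 2)"
  shows "\<And>k. 1 \<le> k \<Longrightarrow> k \<le> 4 \<Longrightarrow> outgoing_sum I W (mk (int k) 0) = Psi_i (mk (int k) 0)"
    "\<And>k. 1 \<le> k \<Longrightarrow> k \<le> 4 \<Longrightarrow> outgoing_sum I W (mk 0 (int k)) = Psi_j (mk 0 (int k))"
    "e 1 * g 1 * Q ^ 2 = e 1 * g 1 + f 1 1"
    "e 2 * g 1 * (Q ^ 2) ^ 2 = e 2 * g 1 + f 1 1 * e 1 + f 2 1" (is ?g1)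
    "e 3 * g 1 * (Q ^ 2) ^ 3 = e 3 * g 1 + f 1 1 * e 2 + f 2 1 * e 1 + f 3 1" (is ?g2)
    "e 1 * g 2 * (Q ^ 2) ^ 2 = e 1 * g 2 + g 1 * f 1 1 + f 1 2" (is ?g3)
    "e 1 * g 3 * (Q ^ 2) ^ 3 = e 1 * g 3 + g 2 * f 1 1 + g 1 * f 1 2 + f 1 3" (is ?g4)
    "e 2 * g 2 * (Q ^ 2) ^ 4 = e 2 * g 2 + g 1 * f 1 1 * e 1 + g 1 * f 2 1 + f 1 2 * e 1 + (f 2 2 + (f 1 1) ^ 2 * Q ^ 2 / 2)" (is ?g5)
proof -
  define F where "F = outgoing_sum I W"
  define R where "R a b = th (ray_part a b F)" for a b
  note cR = ray_part_th[of _ _ F, folded R_def]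
  have hi: "R 1 3 \<in> hi 4" "R 1 2 \<in> hi 3" "R 1 1 \<in> hi 2" "R 2 1 \<in> hi 3" "R 3 1 \<in> hi 4"
    by (auto simp: hi_def cR; presburger)+
  have hi1: "R a b \<in> hi 1" for a b by (auto simp: hi_def cR)
  have hiP: "th Psi_i \<in> hi 1" "th Psi_j \<in> hi 1"
    by (intro th_hi_1 Psi_ghat, simp add: seed_mk)+
  define S where "S = R 1 3 + R 1 2 + R 1 1 + skscale (1/2) (R 1 1 * R 1 1) + R 2 1 + R 3 1"
  have mid: "texp (R 1 3) * (texp (R 1 2) * (texp (R 1 1) * (texp (R 2 1) * texp (R 3 1)))) = 1 + S"
    unfolding S_def by (rule middle_product[OF hi])
  have rel: "texp (th Psi_i) * texp (th Psi_j) = texp (R 0 1) * ((1 + S) * texp (R 1 0))"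
    using loop_relation[OF q] unfolding F_def[symmetric] R_def[symmetric] mid[symmetric] by (simp only: mult.assoc)
  have axx: "on_x_axis (texp (th Psi_i))" "on_x_axis (texp (R 1 0))"
    by (rule on_axis_texp(1); auto simp: on_x_axis_def cmp_th cR seed_mk intro!: Psi_not_multiple)+
  have axy: "on_y_axis (texp (th Psi_j))" "on_y_axis (texp (R 0 1))"
    by (rule on_axis_texp(2); auto simp: on_y_axis_def cmp_th cR seed_mk intro!: Psi_not_multiple)+
  \<comment> \<open>Without pure powers of x or y in \<open>S\<close>, the components on the axes
    determine the two outermost factors, which turn out to be the initial wall elements.\<close>
  have S0: "cmp S a 0 c = 0" "cmp S 0 b c = 0" for a b c
    by (auto simp: S_def cR times_skew.rep_eq intro!: sum.neutral)
  have Eq: "cmp (texp (th Psi_i)) a 0 c * cmp (texp (th Psi_j)) 0 b c * c ^ (a * b) =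
    (\<Sum>b'=0..b. cmp (texp (R 0 1)) 0 b' c * (\<Sum>a'=0..a. cmp (1 + S) a' (b - b') c * cmp (texp (R 1 0)) (a - a') 0 c))"
    if "a + b \<le> 4" for a b c
  proof -
    have *: "a + (b - b') \<le> 4" for b' using that by simp
    show ?thesis
      using arg_cong[OF rel, of "\<lambda>x. cmp x a b c"]
      unfolding cmp_times_x_y_axis[OF axx(1) axy(1) that] cmp_times_y_axis[OF axy(2) that] cmp_times_x_axis[OF axx(2) *] .
  qed
  have one00: "cmp (texp (th Psi_i)) 0 0 c = 1" "cmp (texp (th Psi_j)) 0 0 c = 1"
    "cmp (texp (R a b)) 0 0 c = 1" for a b c using cmp_texp_00 hiP hi1 by blast+
  have "cmp (texp (th Psi_i)) a 0 c = cmp (texp (R 1 0)) a 0 c" if "a \<le> 4" for a c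
  proof -
    have "(\<Sum>a'=0..a. cmp (1 + S) a' 0 c * cmp (texp (R 1 0)) (a - a') 0 c) =
      (\<Sum>a'\<in>{0}. cmp (1 + S) a' 0 c * cmp (texp (R 1 0)) (a - a') 0 c)"
      by (intro sum.mono_neutral_right) (auto simp: S0)
    then show ?thesis using Eq[of a 0 c] that by (simp add: one00 S0)
  qed
  then have "texp (th Psi_i) = texp (R 1 0)"
    using axx by (intro skew_eqI) (metis add_leD1 gr0I on_x_axis_def)
  then have Ri: "th Psi_i = R 1 0" using texp_inj hiP hi1 by blast
  have "cmp (texp (th Psi_j)) 0 b c = cmp (texp (R 0 1)) 0 b c" if "b \<le> 4" for b c
  proof -
    have "(\<Sum>b'=0..b. cmp (texp (R 0 1)) 0 b' c * cmp (1 + S) 0 (b - b') c) =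
      (\<Sum>b'\<in>{b}. cmp (texp (R 0 1)) 0 b' c * cmp (1 + S) 0 (b - b') c)"
      by (intro sum.mono_neutral_right) (auto simp: S0)
    then show ?thesis using Eq[of 0 b c] that by (simp add: one00 S0)
  qed
  then have "texp (th Psi_j) = texp (R 0 1)"
    using axy by (intro skew_eqI) (metis add_leD2 gr0I on_y_axis_def)
  then have Rj: "th Psi_j = R 0 1" using texp_inj hiP hi1 by blast
  show "outgoing_sum I W (mk (int k) 0) = Psi_i (mk (int k) 0)" if "1 \<le> k" "k \<le> 4" for k
    using arg_cong[OF Ri, of "\<lambda>x. cmp x k 0 (Q ^ 2)"] that by (simp add: cR cmp_th F_def)
  show "outgoing_sum I W (mk 0 (int k)) = Psi_j (mk 0 (int k))" if "1 \<le> k" "k \<le> 4" for k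
    using arg_cong[OF Rj, of "\<lambda>x. cmp x 0 k (Q ^ 2)"] that by (simp add: cR cmp_th F_def)
  \<comment> \<open>(y x) (y x) = c y^2 x^2 with c = Q^2 produces the square of \<open>f 1 1\<close>
    in the last component.\<close>
  have S: "cmp S 1 1 (Q ^ 2) = f 1 1" "cmp S 2 1 (Q ^ 2) = f 2 1" "cmp S 3 1 (Q ^ 2) = f 3 1"
    "cmp S 1 2 (Q ^ 2) = f 1 2" "cmp S 1 3 (Q ^ 2) = f 1 3" "cmp S 2 2 (Q ^ 2) = f 2 2 + (f 1 1) ^ 2 * Q ^ 2 / 2"
    by (simp_all add: S_def cR f_def F_def times_skew.rep_eq numeral_eq_Suc sum.atLeast0_atMost_Suc)
  have e: "cmp (texp (R 1 0)) a 0 (Q ^ 2) = e a" "cmp (texp (R 0 1)) 0 a (Q ^ 2) = g a" for a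
    by (simp_all add: e_def g_def Ri Rj)
  have e0: "e 0 = 1" "g 0 = 1" using one00 by (simp_all add: e_def g_def)
  have eqs: "e a * g b * (Q ^ 2) ^ (a * b) =
    (\<Sum>b'=0..b. g b' * (\<Sum>a'=0..a. cmp (1 + S) a' (b - b') (Q ^ 2) * e (a - a')))" if "a + b \<le> 4" for a b
    using Eq[OF that, of "Q ^ 2"] unfolding e by (simp only: e_def g_def)
  note sums = sum.atLeast0_atMost_Suc S0 S e0
  show "e 1 * g 1 * Q ^ 2 = e 1 * g 1 + f 1 1"
    using eqs[of 1 1] S by (simp add: sums algebra_simps)
  show ?g1
    using eqs[of 2 1] S by (simp add: sums numeral_2_eq_2 algebra_simps)
  show ?g2
    using eqs[of 3 1] S by (simp add: sums numeral_2_eq_2 numeral_3_eq_3 algebra_simps)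
  show ?g3
    using eqs[of 1 2] S by (simp add: sums numeral_2_eq_2 algebra_simps)
  show ?g4
    using eqs[of 1 3] S by (simp add: sums numeral_2_eq_2 numeral_3_eq_3 algebra_simps)
  show ?g5
    using eqs[of 2 2] S by (simp add: sums numeral_eq_Suc algebra_simps)
qed

end

text \<open>
  The exponential of \<open>\<Sum>\<^sub>k (-1)\<^bsup>k+1\<^esup> x\<^sup>k / (k (r\<^sup>k - r\<^sup>-\<^sup>k))\<close> has these coefficients through degree 3.
\<close>

lemma dilogarithm_coefficients:
  fixes r :: "'a::field_char_0"
  assumes "r \<noteq> 0" "r ^ 2 \<noteq> 1" "r ^ 2 + 1 \<noteq> 0" "(r ^ 2) ^ 2 + r ^ 2 + 1 \<noteq> 0"
  shows "1 / (r - 1 / r) = r / (r ^ 2 - 1)"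
    "- 1 / (2 * (r * r - 1 / (r * r))) + (1 / (r - 1 / r)) ^ 2 / 2 = (r / (r ^ 2 - 1)) ^ 2 / (r ^ 2 + 1)" (is ?g1)
    "1 / (3 * (r * r * r - 1 / (r * r * r))) + 1 / (r - 1 / r) * (- 1 / (2 * (r * r - 1 / (r * r)))) + (1 / (r - 1 / r)) ^ 3 / 6 =
      (r / (r ^ 2 - 1)) ^ 3 / ((r ^ 2 + 1) * ((r ^ 2) ^ 2 + r ^ 2 + 1))" (is ?g2)
proof -
  define p where "p = r ^ 2"
  have p: "p - 1 \<noteq> 0" "p + 1 \<noteq> 0" "p ^ 2 + p + 1 \<noteq> 0" using assms by (auto simp: p_def)
  \<comment> \<open>\<open>z\<close> is the first coefficient; the relation
    \<open>z ^ 2 * (p - 1) ^ 2 = p\<close> turns the higher ones into powers of \<open>z\<close>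
    times functions of \<open>p\<close>.\<close>
  define z where "z = r / (p - 1)"
  have z0: "z \<noteq> 0" using assms(1) p by (simp add: z_def)
  have "2 + p * 2 = 2 * (p + 1)" "3 + (p * 3 + p * (p * 3)) = 3 * (p ^ 2 + p + 1)"
    by (simp_all add: algebra_simps power2_eq_square)
  then have n23: "2 + p * 2 \<noteq> 0" "3 + (p * 3 + p * (p * 3)) \<noteq> 0" using p by (metis mult_eq_0_iff zero_neq_numeral)+
  have 1: "1 / (r - 1 / r) = z" using assms(1) p(1) by (simp add: z_def p_def field_simps power2_eq_square)
  have zz: "z ^ 2 * (p - 1) ^ 2 = p" using p(1) by (simp add: z_def power_divide p_def)
  have 2: "1 / (r * r - 1 / (r * r)) = p / ((p - 1) * (p + 1))"
    using assms(1) p by (simp add: p_def field_simps power2_eq_square)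
  have 3: "1 / (r * r * r - 1 / (r * r * r)) = z * p / (p ^ 2 + p + 1)"
  proof -
    have "r * r * r - 1 / (r * r * r) = (p - 1) * (p ^ 2 + p + 1) / (r * p)"
      using assms(1) by (simp add: p_def field_simps power2_eq_square)
    then show ?thesis using p assms(1) by (simp add: z_def)
  qed
  have p2: "p / ((p - 1) * (p + 1)) = z ^ 2 * (p - 1) / (p + 1)"
  proof -
    have "p / ((p - 1) * (p + 1)) = z ^ 2 * (p - 1) ^ 2 / ((p - 1) * (p + 1))" unfolding zz ..
    then show ?thesis using p by (simp add: power2_eq_square)
  qed
  have p3: "z * p / (p ^ 2 + p + 1) = z ^ 3 * (p - 1) ^ 2 / (p ^ 2 + p + 1)"
    using zz by (metis (no_types, lifting) mult.assoc power2_eq_square power3_eq_cube)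
  show "1 / (r - 1 / r) = r / (r ^ 2 - 1)" using 1 by (simp add: z_def p_def)
  have "- 1 / (2 * (r * r - 1 / (r * r))) + (1 / (r - 1 / r)) ^ 2 / 2 = - (1 / (r * r - 1 / (r * r))) / 2 + z ^ 2 / 2"
    unfolding 1 by simp
  also have "\<dots> = z ^ 2 * ((1 - (p - 1) / (p + 1)) / 2)" 
  proof -
    have *: "- (A * k) / 2 + A / 2 = A * ((1 - k) / 2)" for A k :: 'a by (simp add: algebra_simps diff_divide_distrib)
    show ?thesis unfolding 2 p2 times_divide_eq_right[symmetric] by (rule *)
  qed
  also have "1 - (p - 1) / (p + 1) = 2 * inverse (p + 1)" using p by (simp add: field_simps)
  also have "z ^ 2 * (2 * inverse (p + 1) / 2) = z ^ 2 * inverse (p + 1)" by simp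
  also have "\<dots> = z ^ 2 / (p + 1)" by (simp only: divide_inverse)
  finally show ?g1
    by (simp add: z_def p_def)
  have "1 / (3 * (r * r * r - 1 / (r * r * r))) + 1 / (r - 1 / r) * (- 1 / (2 * (r * r - 1 / (r * r)))) + (1 / (r - 1 / r)) ^ 3 / 6 =
    1 / (r * r * r - 1 / (r * r * r)) / 3 - z * (1 / (r * r - 1 / (r * r))) / 2 + z ^ 3 / 6"
    unfolding 1 by (simp add: mult.commute)
  also have "\<dots> = z ^ 3 * ((p - 1) ^ 2 / (3 * (p ^ 2 + p + 1)) - (p - 1) / (2 * (p + 1)) + 1 / 6)"
    unfolding 2 3 p2 p3 by (simp add: algebra_simps power2_eq_square power3_eq_cube)
  also have "(p - 1) ^ 2 / (3 * (p ^ 2 + p + 1)) - (p - 1) / (2 * (p + 1)) + 1 / 6 = 1 / ((p + 1) * (p ^ 2 + p + 1))"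
    using p n23 by (simp add: divide_simps) (simp add: algebra_simps power2_eq_square)
  finally show ?g2
    by (simp add: z_def p_def)
qed

text \<open>Forward substitution, each equation being linear in the next unknown. It is applied to
  the column (k, 1) and, with the axes exchanged, to the row (1, k); the factors c - p^k will become
  quantum integers.\<close>

lemma solve_loop_column:
  fixes c p z g :: "'a::field_char_0"
  assumes p: "p + 1 \<noteq> 0" "p ^ 2 + p + 1 \<noteq> 0"
    and f11: "z * g * c = z * g + f11"
    and f21: "z ^ 2 / (p + 1) * g * c ^ 2 = z ^ 2 / (p + 1) * g + f11 * z + f21"
    and f31: "z ^ 3 / ((p + 1) * (p ^ 2 + p + 1)) * g * c ^ 3 =
       z ^ 3 / ((p + 1) * (p ^ 2 + p + 1)) * g + f11 * (z ^ 2 / (p + 1)) + f21 * z + f31"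
  shows "f11 = g * z * (c - 1)" "f21 = g * z ^ 2 * ((c - 1) * (c - p) / (p + 1))"
    "f31 = g * z ^ 3 * ((c - 1) * (c - p) * (c - p ^ 2) / ((p + 1) * (p ^ 2 + p + 1)))" (is ?g1)
proof -
  show 1: "f11 = g * z * (c - 1)" using f11 by (simp add: algebra_simps)
  have "f21 = g * z ^ 2 * ((c ^ 2 - 1) / (p + 1) - (c - 1))"
    using f21 unfolding 1 by (simp add: algebra_simps power2_eq_square diff_divide_distrib)
  also have "(c ^ 2 - 1) / (p + 1) - (c - 1) = (c - 1) * (c - p) / (p + 1)"
    using p by (simp add: field_simps power2_eq_square)
  finally show 2: "f21 = g * z ^ 2 * ((c - 1) * (c - p) / (p + 1))" .
  have "f31 = g * z ^ 3 * ((c ^ 3 - 1) / ((p + 1) * (p ^ 2 + p + 1)) - (c - 1) / (p + 1) - (c - 1) * (c - p) / (p + 1))"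
    using f31 unfolding 1 2 by (simp add: algebra_simps power2_eq_square power3_eq_cube diff_divide_distrib)
  also have "(c ^ 3 - 1) / ((p + 1) * (p ^ 2 + p + 1)) - (c - 1) / (p + 1) - (c - 1) * (c - p) / (p + 1) =
    (c - 1) * (c - p) * (c - p ^ 2) / ((p + 1) * (p ^ 2 + p + 1))"
    using p by (simp add: divide_simps) (simp add: algebra_simps power2_eq_square power3_eq_cube)
  finally show ?g1 .
qed

text \<open>Two forms of one value: the quadratic correction has denominator \<open>u + 1\<close> in
  the first, as suits \<delta>_i dividing \<delta>_j, and \<open>p + 1\<close> in the second, for
  the opposite divisibility.\<close>

lemma solve_loop_22:
  fixes c p u z y :: "'a::field_char_0"
  assumes p: "p + 1 \<noteq> 0" "u + 1 \<noteq> 0"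
    and f: "f11 = y * z * (c - 1)" "f21 = y * z ^ 2 * ((c - 1) * (c - p) / (p + 1))"
      "f12 = z * y ^ 2 * ((c - 1) * (c - u) / (u + 1))"
    and f22: "z ^ 2 / (p + 1) * (y ^ 2 / (u + 1)) * c ^ 4 = z ^ 2 / (p + 1) * (y ^ 2 / (u + 1)) + y * f11 * z + y * f21 + f12 * z +
        (f22 + f11 ^ 2 * c / 2)"
  shows "f22 = z ^ 2 * y ^ 2 * (c - 1) * ((c - p) * (c ^ 2 - u) / ((p + 1) * (u + 1)) - c * (c - 1) * (u - 1) / (2 * (u + 1)))" (is ?g1)
    "f22 = z ^ 2 * y ^ 2 * (c - 1) * ((c - u) * (c ^ 2 - p) / ((p + 1) * (u + 1)) - c * (c - 1) * (p - 1) / (2 * (p + 1)))" (is ?g2)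
proof -
  have "2 + p * 2 = 2 * (p + 1)" "2 + u * 2 = 2 * (u + 1)" by (simp_all add: algebra_simps)
  then have p': "2 + p * 2 \<noteq> 0" "2 + u * 2 \<noteq> 0" using p by (metis mult_eq_0_iff zero_neq_numeral)+
  have "f22 = z ^ 2 / (p + 1) * (y ^ 2 / (u + 1)) * (c ^ 4 - 1) - y * f11 * z - y * f21 - f12 * z - f11 ^ 2 * c / 2"
    using f22 by (simp add: algebra_simps diff_divide_distrib)
  also have "\<dots> = z ^ 2 * y ^ 2 * ((c ^ 4 - 1) / ((p + 1) * (u + 1)) - (c - 1) - (c - 1) * (c - p) / (p + 1)
      - (c - 1) * (c - u) / (u + 1) - (c - 1) ^ 2 * c / 2)"
    unfolding f by (simp add: algebra_simps power2_eq_square diff_divide_distrib)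
  finally have 1: "f22 = z ^ 2 * y ^ 2 * ((c ^ 4 - 1) / ((p + 1) * (u + 1)) - (c - 1) - (c - 1) * (c - p) / (p + 1)
      - (c - 1) * (c - u) / (u + 1) - (c - 1) ^ 2 * c / 2)" .
  have 2: "(c ^ 4 - 1) / ((p + 1) * (u + 1)) - (c - 1) - (c - 1) * (c - p) / (p + 1)
      - (c - 1) * (c - u) / (u + 1) - (c - 1) ^ 2 * c / 2 =
    (c - 1) * ((c - p) * (c ^ 2 - u) / ((p + 1) * (u + 1)) - c * (c - 1) * (u - 1) / (2 * (u + 1)))"
    using p p' by (simp add: divide_simps) (simp add: algebra_simps power2_eq_square power4_eq_xxxx)
  show ?g1
    unfolding 1 2 by simp
  have 3: "(c ^ 4 - 1) / ((p + 1) * (u + 1)) - (c - 1) - (c - 1) * (c - p) / (p + 1)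
      - (c - 1) * (c - u) / (u + 1) - (c - 1) ^ 2 * c / 2 =
    (c - 1) * ((c - u) * (c ^ 2 - p) / ((p + 1) * (u + 1)) - c * (c - 1) * (p - 1) / (2 * (p + 1)))"
    using p p' by (simp add: divide_simps) (simp add: algebra_simps power2_eq_square power4_eq_xxxx)
  show ?g2
    unfolding 1 3 by simp
qed

text \<open>Rewrites the solved value in balanced quotients such as \<open>(Q ^ 2 - 1) / Q\<close>,
  which are values of \<open>br\<close>. Division by \<open>Q ^ 4\<close> undoes the weight of
  X_(2,2) in \<open>th\<close>, and \<open>y * (u - 1) = s\<close> simplifies the correction
  term.\<close>

lemma value_22_conversion:
  fixes r s Q z y p u :: "'a::field_char_0"
  assumes "r \<noteq> 0" "s \<noteq> 0" "Q \<noteq> 0" "y * (u - 1) = s" "u + 1 \<noteq> 0" "p + 1 \<noteq> 0"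
  shows "z ^ 2 * y ^ 2 * (Q ^ 2 - 1) * ((Q ^ 2 - p) * ((Q ^ 2) ^ 2 - u) / ((p + 1) * (u + 1)) -
      Q ^ 2 * (Q ^ 2 - 1) * (u - 1) / (2 * (u + 1))) / Q ^ 4 =
    s * y / (u + 1) * ((Q ^ 2 - 1) / Q * ((Q ^ 2 - p) / (Q * r)) * z * (r * z / (p + 1)) *
       (((Q ^ 2) ^ 2 - u) / (Q ^ 2 * s)) * y - ((Q ^ 2 - 1) / Q * z) ^ 2 / 2)"
proof -
  define c where "c = Q ^ 2"
  have c0: "c \<noteq> 0" using assms by (simp add: c_def)
  have c4: "Q ^ 4 = c * c" by (simp add: c_def power4_eq_xxxx power2_eq_square)
  have q: "(c - 1) / Q * ((c - p) / (Q * r)) * z * (r * z / (p + 1)) = z ^ 2 * ((c - 1) * (c - p)) / (c * (p + 1))"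
    using assms by (simp add: c_def power2_eq_square)
  have q2: "((c - 1) / Q * z) ^ 2 = z ^ 2 * (c - 1) ^ 2 / c" by (simp add: c_def power_divide power_mult_distrib)
  have l: "z ^ 2 * y ^ 2 * k * (A / m - c * k * U / d) / (c * c) =
    z ^ 2 * y ^ 2 * k * A / (c * c * m) - z ^ 2 * y * k ^ 2 * (y * U) / (c * d)" for A k m U d
    using c0 by (simp add: right_diff_distrib diff_divide_distrib power2_eq_square mult_ac)
  have r: "s * y / v * (z ^ 2 * (k * B) / (c * m) * (E / (c * s)) * y - z ^ 2 * k ^ 2 / c / 2) =
    z ^ 2 * y ^ 2 * k * (B * E) / (c * c * (m * v)) - z ^ 2 * y * k ^ 2 * s / (c * (2 * v))" for k v B E m
    using assms(2) by (simp add: right_diff_distrib diff_divide_distrib power2_eq_square mult_ac)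
  show ?thesis unfolding c_def[symmetric] c4 q q2 l r assms(4) ..
qed

context rank2_data
begin

lemma Psi_mk:
  assumes "x \<noteq> 0 \<or> y \<noteq> 0" "1 \<le> k" "m = mk (int k * x) (int k * y)"
  shows "Psi a b (mk x y) m = (- 1) ^ (k + 1) / (of_nat k * qnum (of_nat k * a)) * qpow (of_nat k * b)"
proof -
  have "{j::nat. 1 \<le> j \<and> m = int j *s mk x y} = {k}" using assms by auto
  then show ?thesis unfolding Psi_def by simp
qed

lemma qpow_0 [simp]: "qpow 0 = 1"
  by (simp add: qpow_def)

definition ri :: coeff where "ri = tvar ^ Ai"
definition rj :: coeff where "rj = tvar ^ Aj"

lemma Q_powers: "Q = ri ^ bi" "Q = rj ^ bj"
  by (simp_all add: Q_def ri_def rj_def power_mult[symmetric] wn_def, simp add: wn_def[symmetric] wn_alt)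

lemma br_A: "qbr Ai = ri - 1 / ri" "qbr (2 * Ai) = ri * ri - 1 / (ri * ri)"
  "qbr (3 * Ai) = ri * ri * ri - 1 / (ri * ri * ri)"
  "qbr Aj = rj - 1 / rj" "qbr (2 * Aj) = rj * rj - 1 / (rj * rj)"
  "qbr (3 * Aj) = rj * rj * rj - 1 / (rj * rj * rj)"
  by (simp_all add: tq.br_double tq.br_triple ri_def rj_def, simp_all add: tq.br_def inverse_eq_divide)

text \<open>The last two expressions are factors of \<open>x ^ 4 - 1\<close> and
  \<open>x ^ 6 - 1\<close>, which are nonzero.\<close>

lemma generic_power:
  assumes "0 < A"
  defines "x \<equiv> tvar ^ A"
  shows "x \<noteq> 0" "x ^ 2 \<noteq> 1" "x ^ 2 + 1 \<noteq> 0" "(x ^ 2) ^ 2 + x ^ 2 + 1 \<noteq> 0"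
proof -
  show "x \<noteq> 0" using tq.nonzero by (simp add: x_def)
  have n: "x ^ k \<noteq> 1" if "0 < k" for k
    using tq.not_root_of_unity[of "A * k"] assms(1) that by (simp add: x_def power_mult)
  show "x ^ 2 \<noteq> 1" using n by simp
  have "x ^ 4 - 1 = (x ^ 2 - 1) * (x ^ 2 + 1)" by (simp add: algebra_simps power2_eq_square power4_eq_xxxx)
  then show "x ^ 2 + 1 \<noteq> 0" using n[of 4] by auto
  have "x ^ 6 - 1 = (x ^ 2 - 1) * ((x ^ 2) ^ 2 + x ^ 2 + 1)" by (simp add: algebra_simps power2_eq_square power_numeral_reduce)
  then show "(x ^ 2) ^ 2 + x ^ 2 + 1 \<noteq> 0" using n[of 6] by auto
qed

lemmas ri_generic = generic_power[OF Ai(2), folded ri_def]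
lemmas rj_generic = generic_power[OF Aj(2), folded rj_def]

lemma Psi_seed_components:
  assumes "1 \<le> k" "k \<le> 4"
  shows "cmp (th Psi_i) k 0 (Q ^ 2) = (- 1) ^ (k + 1) / (of_nat k * qbr (k * Ai))" (is ?g1)
    "cmp (th Psi_j) 0 k (Q ^ 2) = (- 1) ^ (k + 1) / (of_nat k * qbr (k * Aj))" (is ?g2)
proof -
  have qi: "qnum (of_nat k / of_nat (\<delta> i)) = qbr (k * Ai) / kap"
    using Ai(1) \<delta>_pos[of i] by (subst qnum_eq[of _ "k * Ai"]) (simp_all add: kap_def)
  have qj: "qnum (of_nat k / of_nat (\<delta> j)) = qbr (k * Aj) / kap"
    using \<delta>_pos[of j] by (subst qnum_eq[of _ "k * Aj"]) (simp_all add: kap_def, subst Aj(1), simp)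
  show ?g1
    using assms unfolding cmp_th seed_mk by (simp add: Psi_mk[OF _ assms(1)] qi del: of_nat_mult)
  show ?g2
    using assms unfolding cmp_th seed_mk by (simp add: Psi_mk[OF _ assms(1)] qj del: of_nat_mult)
qed

lemma texp_Psi_components:
  defines "z \<equiv> ri / (ri ^ 2 - 1)" and "y \<equiv> rj / (rj ^ 2 - 1)"
  shows "cmp (texp (th Psi_i)) 1 0 (Q ^ 2) = z" "cmp (texp (th Psi_i)) 2 0 (Q ^ 2) = z ^ 2 / (ri ^ 2 + 1)" (is ?g1)
    "cmp (texp (th Psi_i)) 3 0 (Q ^ 2) = z ^ 3 / ((ri ^ 2 + 1) * ((ri ^ 2) ^ 2 + ri ^ 2 + 1))" (is ?g2)
    "cmp (texp (th Psi_j)) 0 1 (Q ^ 2) = y" "cmp (texp (th Psi_j)) 0 2 (Q ^ 2) = y ^ 2 / (rj ^ 2 + 1)" (is ?g3)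
    "cmp (texp (th Psi_j)) 0 3 (Q ^ 2) = y ^ 3 / ((rj ^ 2 + 1) * ((rj ^ 2) ^ 2 + rj ^ 2 + 1))" (is ?g4)
proof -
  have hiP: "th Psi_i \<in> hi 1" "th Psi_j \<in> hi 1"
    by (intro th_hi_1 Psi_ghat, simp add: seed_mk)+
  have ci: "cmp (th Psi_i) 1 0 (Q ^ 2) = 1 / (ri - 1 / ri)" "cmp (th Psi_i) 2 0 (Q ^ 2) = - 1 / (2 * (ri * ri - 1 / (ri * ri)))"
    "cmp (th Psi_i) 3 0 (Q ^ 2) = 1 / (3 * (ri * ri * ri - 1 / (ri * ri * ri)))"
    "cmp (th Psi_j) 0 1 (Q ^ 2) = 1 / (rj - 1 / rj)" "cmp (th Psi_j) 0 2 (Q ^ 2) = - 1 / (2 * (rj * rj - 1 / (rj * rj)))"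
    "cmp (th Psi_j) 0 3 (Q ^ 2) = 1 / (3 * (rj * rj * rj - 1 / (rj * rj * rj)))"
    unfolding br_A[symmetric] by (subst Psi_seed_components, simp, simp, simp)+
  note d = dilogarithm_coefficients[OF ri_generic] dilogarithm_coefficients[OF rj_generic]
  show "cmp (texp (th Psi_i)) 1 0 (Q ^ 2) = z" ?g1 ?g2
    "cmp (texp (th Psi_j)) 0 1 (Q ^ 2) = y" ?g3 ?g4
    unfolding cmp_texp_x_axis[OF hiP(1)] cmp_texp_y_axis[OF hiP(2)] ci z_def y_def by (rule d)+
qed

lemma inverse_br:
  "1 / qbr Ai = ri / (ri ^ 2 - 1)" "1 / qbr Aj = rj / (rj ^ 2 - 1)"
  "1 / qbr (2 * Ai) = ri * (ri / (ri ^ 2 - 1)) / (ri ^ 2 + 1)" (is ?g1)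
  "1 / qbr (2 * Aj) = rj * (rj / (rj ^ 2 - 1)) / (rj ^ 2 + 1)" (is ?g2)
  "1 / qbr (3 * Ai) = ri ^ 2 * (ri / (ri ^ 2 - 1)) / ((ri ^ 2) ^ 2 + ri ^ 2 + 1)" (is ?g3)
  "1 / qbr (3 * Aj) = rj ^ 2 * (rj / (rj ^ 2 - 1)) / ((rj ^ 2) ^ 2 + rj ^ 2 + 1)" (is ?g4)
proof -
  have *: "1 / (x * x - 1 / (x * x)) = x * (x / (x ^ 2 - 1)) / (x ^ 2 + 1)"
    "1 / (x * x * x - 1 / (x * x * x)) = x ^ 2 * (x / (x ^ 2 - 1)) / ((x ^ 2) ^ 2 + x ^ 2 + 1)"
    if x: "x \<noteq> 0" "x ^ 2 \<noteq> 1" "x ^ 2 + 1 \<noteq> 0" "(x ^ 2) ^ 2 + x ^ 2 + 1 \<noteq> 0" for x :: coeff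
  proof -
    have "x * x - 1 / (x * x) = (x ^ 2 - 1) * (x ^ 2 + 1) / (x * x)"
      "x * x * x - 1 / (x * x * x) = (x ^ 2 - 1) * ((x ^ 2) ^ 2 + x ^ 2 + 1) / (x * x * x)"
      using x(1) by (simp_all add: field_simps power2_eq_square)
    then show "1 / (x * x - 1 / (x * x)) = x * (x / (x ^ 2 - 1)) / (x ^ 2 + 1)"
      "1 / (x * x * x - 1 / (x * x * x)) = x ^ 2 * (x / (x ^ 2 - 1)) / ((x ^ 2) ^ 2 + x ^ 2 + 1)"
      using x by (simp_all add: power2_eq_square)
  qed
  show "1 / qbr Ai = ri / (ri ^ 2 - 1)" "1 / qbr Aj = rj / (rj ^ 2 - 1)"
    unfolding br_A using dilogarithm_coefficients(1)[OF ri_generic] dilogarithm_coefficients(1)[OF rj_generic] by auto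
  show ?g1 ?g2 ?g3 ?g4
    unfolding br_A by (rule *[OF ri_generic] *[OF rj_generic])+
qed

lemma br_multiples:
  "qbr wn = (Q ^ 2 - 1) / Q"
  "qbr (Ai * (bi - 1)) = (Q ^ 2 - ri ^ 2) / (Q * ri)" (is ?g1) "qbr (Aj * (bj - 1)) = (Q ^ 2 - rj ^ 2) / (Q * rj)" (is ?g2)
  "2 \<le> bi \<Longrightarrow> qbr (Ai * (bi - 2)) = (Q ^ 2 - (ri ^ 2) ^ 2) / (Q * ri ^ 2)"
  "2 \<le> bj \<Longrightarrow> qbr (Aj * (bj - 2)) = (Q ^ 2 - (rj ^ 2) ^ 2) / (Q * rj ^ 2)"
  "qbr (Ai * (2 * bi - 1)) = ((Q ^ 2) ^ 2 - ri ^ 2) / (Q ^ 2 * ri)" (is ?g3)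
  "qbr (Aj * (2 * bj - 1)) = ((Q ^ 2) ^ 2 - rj ^ 2) / (Q ^ 2 * rj)" (is ?g4)
proof -
  show "qbr wn = (Q ^ 2 - 1) / Q" unfolding tq.br_def Q_def[symmetric] by (simp add: field_simps power2_eq_square)
  have *: "qbr (A * (n - k)) = ((x ^ n) ^ 2 - (x ^ k) ^ 2) / (x ^ n * x ^ k)"
    if "k \<le> n" "x = tvar ^ A" "x \<noteq> 0" for A n k x
    using that tq.br_diff[of "A * k" "A * n"]
    by (simp add: diff_mult_distrib2 power_mult field_simps power2_eq_square)
  show ?g1
    using *[of 1 bi ri Ai] bi(1) ri_generic(1) by (simp add: ri_def[symmetric] Q_powers(1)[symmetric])
  show ?g2
    using *[of 1 bj rj Aj] bj(1) rj_generic(1) by (simp add: rj_def[symmetric] Q_powers(2)[symmetric])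
  show "2 \<le> bi \<Longrightarrow> qbr (Ai * (bi - 2)) = (Q ^ 2 - (ri ^ 2) ^ 2) / (Q * ri ^ 2)"
    using *[of 2 bi ri Ai] ri_generic(1) by (simp add: ri_def[symmetric] Q_powers(1)[symmetric])
  show "2 \<le> bj \<Longrightarrow> qbr (Aj * (bj - 2)) = (Q ^ 2 - (rj ^ 2) ^ 2) / (Q * rj ^ 2)"
    using *[of 2 bj rj Aj] rj_generic(1) by (simp add: rj_def[symmetric] Q_powers(2)[symmetric])
  show ?g3
    using *[of 1 "2 * bi" ri Ai] bi(1) ri_generic(1)
    by (simp add: ri_def[symmetric] mult.commute[of 2] power_mult Q_powers(1)[symmetric])
  show ?g4
    using *[of 1 "2 * bj" rj Aj] bj(1) rj_generic(1)
    by (simp add: rj_def[symmetric] mult.commute[of 2] power_mult Q_powers(2)[symmetric])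
qed

lemma outgoing_values:
  assumes q: "qcsd I W"
  defines "F \<equiv> \<lambda>a b. outgoing_sum I W (mk a b)"
  shows "F 1 1 = kap * (qbr wn * (1 / qbr Ai) * (1 / qbr Aj))" (is ?g1)
    "F 2 1 = kap * (qbr wn * qbr (Ai * (bi - 1)) * (1 / qbr Ai) * (1 / qbr (2 * Ai)) * (1 / qbr Aj))" (is ?g2)
    "F 3 1 = kap * (qbr wn * qbr (Ai * (bi - 1)) * qbr (Ai * (bi - 2)) * (1 / qbr Ai) * (1 / qbr (2 * Ai)) *
       (1 / qbr (3 * Ai)) * (1 / qbr Aj))" (is ?g3)
    "F 1 2 = kap * (qbr wn * qbr (Aj * (bj - 1)) * (1 / qbr Aj) * (1 / qbr (2 * Aj)) * (1 / qbr Ai))" (is ?g4)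
    "F 1 3 = kap * (qbr wn * qbr (Aj * (bj - 1)) * qbr (Aj * (bj - 2)) * (1 / qbr Aj) * (1 / qbr (2 * Aj)) *
       (1 / qbr (3 * Aj)) * (1 / qbr Ai))" (is ?g5)
    "F 2 2 = kap * (1 / qbr (2 * Aj) * (qbr wn * qbr (Ai * (bi - 1)) * (1 / qbr Ai) * (1 / qbr (2 * Ai)) *
       qbr (Aj * (2 * bj - 1)) * (1 / qbr Aj) - (qbr wn * (1 / qbr Ai)) ^ 2 / 2))" (is ?g6)
    "F 2 2 = kap * (1 / qbr (2 * Ai) * (qbr wn * qbr (Aj * (bj - 1)) * (1 / qbr Aj) * (1 / qbr (2 * Aj)) *
       qbr (Ai * (2 * bi - 1)) * (1 / qbr Ai) - (qbr wn * (1 / qbr Aj)) ^ 2 / 2))" (is ?g7)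
proof -
  note lc = loop_components[OF q, unfolded texp_Psi_components]
  define z where "z = ri / (ri ^ 2 - 1)"
  define y where "y = rj / (rj ^ 2 - 1)"
  define f where "f a b = outgoing_sum I W (nvec a b) / kap * Q ^ (a * b)" for a b
  have F: "F (int a) (int b) = kap * f a b / Q ^ (a * b)" for a b by (simp add: F_def f_def)
  note lc' = lc[folded z_def y_def f_def]
  note g = ri_generic rj_generic Q_nonzero
  have col: "f 1 1 = y * z * (Q\<^sup>2 - 1)" "f 2 1 = y * z ^ 2 * ((Q\<^sup>2 - 1) * (Q\<^sup>2 - ri\<^sup>2) / (ri\<^sup>2 + 1))"
    "f 3 1 = y * z ^ 3 * ((Q\<^sup>2 - 1) * (Q\<^sup>2 - ri\<^sup>2) * (Q\<^sup>2 - (ri\<^sup>2)\<^sup>2) / ((ri\<^sup>2 + 1) * ((ri\<^sup>2)\<^sup>2 + ri\<^sup>2 + 1)))"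
    by (rule solve_loop_column[OF ri_generic(3,4), of z y "Q\<^sup>2" "f 1 1" "f 2 1" "f 3 1"];
        use lc'(3-5) in simp)+
  have row: "f 1 2 = z * y ^ 2 * ((Q\<^sup>2 - 1) * (Q\<^sup>2 - rj\<^sup>2) / (rj\<^sup>2 + 1))"
    "f 1 3 = z * y ^ 3 * ((Q\<^sup>2 - 1) * (Q\<^sup>2 - rj\<^sup>2) * (Q\<^sup>2 - (rj\<^sup>2)\<^sup>2) / ((rj\<^sup>2 + 1) * ((rj\<^sup>2)\<^sup>2 + rj\<^sup>2 + 1)))"
    by (rule solve_loop_column[OF rj_generic(3,4), of y z "Q\<^sup>2" "f 1 1" "f 1 2" "f 1 3"];
        use lc'(3,6,7) in \<open>simp add: mult_ac\<close>)+
  note f22 = solve_loop_22[OF ri_generic(3) rj_generic(3) col(1,2) row(1), of "f 2 2", OF lc'(8)]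
  have zz: "z * (ri ^ 2 - 1) = ri" "y * (rj ^ 2 - 1) = rj" using ri_generic(2) rj_generic(2) by (auto simp: z_def y_def)
  note ib = inverse_br[folded z_def y_def]
  show ?g1
    using F[of 1 1] unfolding col ib br_multiples(1) by (simp add: field_simps)
  show ?g2
    using F[of 2 1] g unfolding col ib br_multiples(1,2) by (simp add: power2_eq_square mult_ac)
  show ?g4
    using F[of 1 2] g unfolding row ib br_multiples(1,3) by (simp add: power2_eq_square mult_ac)
  show ?g3
  proof (cases "2 \<le> bi")
    case True
    show ?thesis
      using F[of 3 1] g unfolding col ib br_multiples(1,2) br_multiples(4)[OF True]
      by (simp add: power2_eq_square power3_eq_cube mult_ac)
  next
    \<comment> \<open>For \<open>bi = 1\<close> the truncated \<open>bi - 2\<close> is 0 and the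
      closed form of that factor fails, but both sides vanish through the factor belonging to
      \<open>bi - 1\<close>.\<close>
    case False
    then have "bi = 1" using bi(1) by simp
    then have "Q = ri" "qbr (Ai * (bi - 1)) = 0" using Q_powers(1) by simp_all
    then show ?thesis using F[of 3 1] unfolding col by simp
  qed
  show ?g5
  proof (cases "2 \<le> bj")
    case True
    show ?thesis
      using F[of 1 3] g unfolding row ib br_multiples(1,3) br_multiples(5)[OF True]
      by (simp add: power2_eq_square power3_eq_cube mult_ac)
  next
    case False
    then have "bj = 1" using bj(1) by simp
    then have "Q = rj" "qbr (Aj * (bj - 1)) = 0" using Q_powers(2) by simp_all
    then show ?thesis using F[of 1 3] unfolding row by simp
  qed
  have "F 2 2 = kap * (f 2 2 / Q ^ 4)" using F[of 2 2] by simp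
  also have "f 2 2 / Q ^ 4 = 1 / qbr (2 * Aj) * (qbr wn * qbr (Ai * (bi - 1)) * (1 / qbr Ai) * (1 / qbr (2 * Ai)) *
       qbr (Aj * (2 * bj - 1)) * (1 / qbr Aj) - (qbr wn * (1 / qbr Ai)) ^ 2 / 2)"
    unfolding f22(1) ib br_multiples by (rule value_22_conversion[OF ri_generic(1) rj_generic(1) Q_nonzero zz(2) rj_generic(3) ri_generic(3)])
  finally show ?g6 .
  have "F 2 2 = kap * (f 2 2 / Q ^ 4)" using F[of 2 2] by simp
  also have "f 2 2 / Q ^ 4 = 1 / qbr (2 * Ai) * (qbr wn * qbr (Aj * (bj - 1)) * (1 / qbr Aj) * (1 / qbr (2 * Aj)) *
       qbr (Ai * (2 * bi - 1)) * (1 / qbr Ai) - (qbr wn * (1 / qbr Aj)) ^ 2 / 2)"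
    unfolding f22(2) ib br_multiples
    using value_22_conversion[OF rj_generic(1) ri_generic(1) Q_nonzero zz(1) ri_generic(3) rj_generic(3), of y]
    by (simp only: mult.commute[of "ri\<^sup>2 + 1"] mult.commute[of "z\<^sup>2"])
  finally show ?g7 .
qed

end

section \<open>Positivity of the outgoing walls\<close>

context generic_parameter
begin

text \<open>Newton's identity p_1^2 - p_2 = 2 e_2 in the variables x^(n-1), x^(n-3), ..., x^(1-n)
  with x = t^m: the power sums are [n] in x and in x^2, and e_2 is the balanced quantum
  binomial.\<close>

lemma quantum_square_identity:
  assumes "0 < m" "0 < n"
  shows "(br (m * n) / br m) ^ 2 - br (2 * m * n) / br (2 * m) = 2 * (br (m * n) * br (m * (n - 1)) / (br m * br (2 * m)))"
proof -
  define x where "x = t ^ m"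
  define q where "q = t ^ (m * n)"
  have n0: "x \<noteq> 0" "q \<noteq> 0" using nonzero by (simp_all add: x_def q_def)
  have b: "br (m * n) = q - 1 / q" "br m = x - 1 / x" "br (2 * m * n) = (q - 1 / q) * (q + 1 / q)" "br (2 * m) = (x - 1 / x) * (x + 1 / x)"
    using n0 br_double[of m] br_double[of "m * n"]
    by (simp_all add: x_def[symmetric] q_def[symmetric] br_def inverse_eq_divide field_simps mult.assoc)
  have "m \<le> m * n" "m * (n - 1) = m * n - m" using assms by (simp_all add: diff_mult_distrib2)
  then have b': "br (m * (n - 1)) = q / x - x / q" using br_diff[of m "m * n"] by (simp add: x_def q_def)
  have nz: "x - 1 / x \<noteq> 0" "x + 1 / x \<noteq> 0"
    using br_nonzero[of m] br_nonzero[of "2 * m"] assms b(2,4) by auto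
  have e: "(q - 1 / q) * (x + 1 / x) - (q + 1 / q) * (x - 1 / x) = 2 * (q / x - x / q)"
    using n0 by (simp add: field_simps)
  have "(U / X) ^ 2 - U * V / (X * Y) = U / (X * (X * Y)) * (U * Y - V * X)"
    if "X \<noteq> 0" "Y \<noteq> 0" for U V X Y :: 'a using that by (simp add: power2_eq_square right_diff_distrib diff_divide_distrib mult_ac)
  from this[OF nz, of "q - 1 / q" "q + 1 / q", unfolded e]
  show ?thesis unfolding b b' by (simp only: times_divide_eq_right times_divide_eq_left mult_ac)
qed

text \<open>Written for \<open>Ai = m\<close> and \<open>Aj = 1\<close>; the opposite divisibility
  uses it with the axes exchanged. The conditional factors at (1,2) and (1,3) come from
  1/\<delta>(n); where they are 1, \<open>m\<close> is odd or prime to 3 and the rational binomials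
  apply.\<close>

lemma positive_expansions:
  assumes m: "0 < m" and b: "0 < b"
  obtains E :: "nat \<Rightarrow> nat \<Rightarrow> int list" where
    "laurent_sum (E 1 1) = br (m * b) / br m"
    "(\<Sum>e\<leftarrow>E 1 1. t powi (2 * e)) = br (2 * m * b) / br (2 * m)"
    "laurent_sum (E 2 1) = br (m * b) * br (m * (b - 1)) / (br m * br (2 * m))"
    "laurent_sum (E 3 1) = br (m * b) * br (m * (b - 1)) * br (m * (b - 2)) / (br m * br (2 * m) * br (3 * m))"
    "laurent_sum (E 1 2) = br (m * b) * br (m * b - 1) / (br 1 * br 2 * br m) * br (if 2 dvd m then 2 else 1)"
    "laurent_sum (E 1 3) = br (m * b) * br (m * b - 1) * br (m * b - 2) / (br 1 * br 2 * br 3 * br m) * br (if 3 dvd m then 3 else 1)"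
    "laurent_sum (E 2 2) = br (m * b) * br (m * (b - 1)) / (br m * br (2 * m)) * br (2 * (m * b) - 1) / br 1 - ((br (m * b) / br m) ^ 2 - br (2 * m * b) / br (2 * m)) / 2"
proof -
  have ex: "\<exists>es. laurent_sum es = x" if "x \<in> laurent_pos" for x using that by (auto simp: laurent_pos_def)
  obtain e11 where e11: "laurent_sum e11 = br (m * b) / br m" "(\<Sum>e\<leftarrow>e11. t powi (2 * e)) = br (2 * m * b) / br (2 * m)"
    using quantum_integer_expansion[OF m] by blast
  obtain e21 where e21: "laurent_sum e21 = br (m * b) * br (m * (b - 1)) / (br m * br (2 * m))"
    using ex[OF quantum_binomial2_pos[OF m]] by blast
  obtain e31 where e31: "laurent_sum e31 = br (m * b) * br (m * (b - 1)) * br (m * (b - 2)) / (br m * br (2 * m) * br (3 * m))"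
    using ex[OF quantum_binomial3_pos[OF m]] by blast
  have "br (m * b) * br (m * b - 1) / (br 1 * br 2 * br m) * br (if 2 dvd m then 2 else 1) \<in> laurent_pos" (is "?x12 \<in> _")
  proof (cases "even m")
    case True
    have "br (m * b) / br m * (br (m * b - 1) / br 1) \<in> laurent_pos"
      using m by (intro laurent_pos_mult quantum_integer_pos) auto
    then show ?thesis using True by (simp add: mult_ac)
  next
    case False
    then show ?thesis using rational_binomial2_pos[of m b] by (simp add: mult_ac)
  qed
  then obtain e12 where e12: "laurent_sum e12 = ?x12"
    using ex by blast
  have "br (m * b) * br (m * b - 1) * br (m * b - 2) / (br 1 * br 2 * br 3 * br m) * br (if 3 dvd m then 3 else 1) \<in> laurent_pos" (is "?x13 \<in> _")
  proof (cases "3 dvd m")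
    case True
    have "br (m * b) / br m * (br (1 * (m * b - 1)) * br (1 * (m * b - 1 - 1)) / (br 1 * br (2 * 1))) \<in> laurent_pos"
      using m by (intro laurent_pos_mult quantum_integer_pos quantum_binomial2_pos) auto
    then show ?thesis using True by (simp add: mult_ac numeral_2_eq_2)
  next
    case False
    then show ?thesis using rational_binomial3_pos[of m b] by (simp add: mult_ac)
  qed
  then obtain e13 where e13: "laurent_sum e13 = ?x13"
    using ex by blast
  have "0 < m * b" using m b by simp
  \<comment> \<open>By \<open>quantum_square_identity\<close> the correction equals the quantum
    binomial itself, hence the factor [2c - 1] - 1 with c = \<open>m * b\<close>.\<close>
  then have "br (m * b) * br (m * (b - 1)) / (br m * br (2 * m)) * (br (2 * (m * b) - 1) / br 1 - 1) \<in> laurent_pos"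
    by (intro laurent_pos_mult quantum_binomial2_pos quantum_odd_minus_one_pos m)
  then obtain e22 where "laurent_sum e22 = br (m * b) * br (m * (b - 1)) / (br m * br (2 * m)) * (br (2 * (m * b) - 1) / br 1 - 1)"
    using ex by blast
  also have "\<dots> = br (m * b) * br (m * (b - 1)) / (br m * br (2 * m)) * br (2 * (m * b) - 1) / br 1 -
        ((br (m * b) / br m) ^ 2 - br (2 * m * b) / br (2 * m)) / 2" (is "_ = ?x22")
    unfolding quantum_square_identity[OF m b] by (simp add: right_diff_distrib)
  finally have e22: "laurent_sum e22 = ?x22" .
  define E where "E a c = (if (a, c) = (1, 1) then e11 else if (a, c) = (2, 1) then e21 else
    if (a, c) = (3, 1) then e31 else if (a, c) = (1, 2) then e12 else if (a, c) = (1, 3) then e13 else e22)"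
    for a c :: nat
  have E: "E 1 1 = e11" "E 2 1 = e21" "E 3 1 = e31" "E 1 2 = e12" "E 1 3 = e13" "E 2 2 = e22"
    by (simp_all add: E_def)
  show ?thesis
    by (rule that[of E]; unfold E, rule e11 e21 e31 e12 e13 e22)
qed

end

section \<open>The multiplier delta(n) in coordinates\<close>

definition min_multiple :: "nat \<Rightarrow> nat \<Rightarrow> int \<Rightarrow> int \<Rightarrow> rat" where
  "min_multiple D E a b = (LEAST d. 0 < d \<and> (\<exists>x y. int D dvd x \<and> int E dvd y \<and> of_int x = d * of_int a \<and> of_int y = d * of_int b))"

lemma min_multiple_swap: "min_multiple D E a b = min_multiple E D b a"
proof -
  have "(\<exists>x y. int D dvd x \<and> int E dvd y \<and> of_int x = d * of_int a \<and> of_int y = d * of_int b) \<longleftrightarrow>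
    (\<exists>x y. int E dvd x \<and> int D dvd y \<and> of_int x = d * of_int b \<and> of_int y = d * of_int a)" for d :: rat by blast
  then show ?thesis unfolding min_multiple_def by simp
qed

lemma min_multiple_eqI:
  assumes "0 < d" "int D dvd x" "int E dvd y" "of_int x = d * of_int a" "of_int y = d * of_int b"
    and "\<And>d' x y. 0 < d' \<Longrightarrow> int D dvd x \<Longrightarrow> int E dvd y \<Longrightarrow> of_int x = d' * of_int a \<Longrightarrow> of_int y = d' * of_int b \<Longrightarrow> d \<le> d'"
  shows "min_multiple D E a b = d"
  unfolding min_multiple_def using assms by (intro Least_equality) blast+

lemma dvd_pos_rat_le:
  assumes "int E dvd y" "of_int y = d" "0 < (d::rat)"
  shows "of_nat E \<le> d"
proof -
  have "0 < y" using assms by simp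
  then have "int E \<le> y" using assms(1) zdvd_imp_le by blast
  then show ?thesis using assms(2) by (metis of_int_le_iff of_int_of_nat_eq)
qed

text \<open>A second coordinate 1 forces a multiple of \<open>E\<close>. For (1, p) the multiplier
  is an integer multiple of \<open>D\<close> whose p-fold is divisible by \<open>E\<close>, so a
  factor \<open>p\<close> is saved exactly when it divides \<open>E div D\<close>.\<close>

lemma min_multiple_values:
  assumes DE: "D dvd E" and D: "0 < D" "0 < E"
  shows "min_multiple D E a 1 = of_nat E"
    "min_multiple D E 2 2 = of_nat E / 2"
    "min_multiple D E' 1 0 = of_nat D"
    "prime p \<Longrightarrow> min_multiple D E 1 (int p) = of_nat E / of_nat (if p dvd E div D then p else 1)"
proof -
  show "min_multiple D E a 1 = of_nat E"
    by (rule min_multiple_eqI[of _ _ "int E * a" _ "int E"]) (use assms dvd_pos_rat_le in auto)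
  show "min_multiple D E 2 2 = of_nat E / 2"
  proof (rule min_multiple_eqI[of _ _ "int E" _ "int E"])
    fix d' :: rat and x y assume "0 < d'" "int E dvd y" "of_int y = d' * of_int 2"
    then show "of_nat E / 2 \<le> d'" using dvd_pos_rat_le[of E y "d' * 2"] by simp
  qed (use assms in auto)
  show "min_multiple D E' 1 0 = of_nat D"
    by (rule min_multiple_eqI[of _ _ "int D" _ 0]) (use assms dvd_pos_rat_le in auto)
  assume p: "prime p"
  obtain m where m: "E = D * m" using DE by blast
  have Em: "E div D = m" using m D by simp
  show "min_multiple D E 1 (int p) = of_nat E / of_nat (if p dvd E div D then p else 1)"
  proof (cases "p dvd m")
    case True
    then obtain m' where m': "m = p * m'" by blast
    have p0: "0 < p" using p prime_gt_0_nat by blast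
    have "min_multiple D E 1 (int p) = of_nat E / of_nat p"
    proof (rule min_multiple_eqI[of _ _ "int (D * m')" _ "int E"])
      fix d' :: rat and x y assume "0 < d'" "int E dvd y" "of_int y = d' * of_int (int p)"
      then show "of_nat E / of_nat p \<le> d'" using dvd_pos_rat_le[of E y "d' * of_nat p"] p0 by (simp add: field_simps)
    qed (use assms m m' p0 in auto)
    then show ?thesis using True Em by simp
  next
    case False
    have "min_multiple D E 1 (int p) = of_nat E"
    proof (rule min_multiple_eqI[of _ _ "int E" _ "int E * int p"])
      fix d' :: rat and x y assume d: "0 < d'" "int D dvd x" "int E dvd y" "of_int x = d' * of_int 1" "of_int y = d' * of_int (int p)"
      obtain c where c: "x = int D * c" using d(2) by blast
      have "y = x * int p" using d(4,5) by (metis mult.right_neutral of_int_1 of_int_eq_iff of_int_mult)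
      then have "int D * int m dvd int D * (c * int p)" using d(3) m c by (simp add: mult.assoc)
      then have "int m dvd c * int p" using D by simp
      moreover have "coprime (int m) (int p)"
        using False p by (metis coprime_commute coprime_int_iff prime_imp_coprime)
      ultimately have "int m dvd c" using coprime_dvd_mult_left_iff by blast
      then have "int E dvd x" using m c by simp
      then show "of_nat E \<le> d'" using d(1,4) dvd_pos_rat_le by simp
    qed (use assms in auto)
    then show ?thesis using False Em by simp
  qed
qed

context rank2_data
begin

lemma ndelta_mk: "ndelta (mk a b) = min_multiple (\<delta> i) (\<delta> j) a b"
proof -
  have "(\<exists>m\<in>Ncirc \<delta>. \<forall>k. of_int (m $ k) = d * of_int (mk a b $ k)) \<longleftrightarrow>
    (\<exists>x y. int (\<delta> i) dvd x \<and> int (\<delta> j) dvd y \<and> of_int x = d * of_int a \<and> of_int y = d * of_int b)" for d :: rat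
    unfolding Ncirc_def Bex_def mem_Collect_eq all_ij mk_nth
    by (metis mk_nth)
  then show ?thesis unfolding ndelta_def min_multiple_def by simp
qed

lemma ndelta_seed: "ndelta (seed k) = of_nat (\<delta> k)"
proof -
  have "ndelta (seed i) = of_nat (\<delta> i)" "ndelta (seed j) = of_nat (\<delta> j)"
    unfolding seed_mk ndelta_mk using min_multiple_values(3)[OF dvd_refl] min_multiple_swap[of "\<delta> i" "\<delta> j" 0 1] \<delta>_pos by auto
  then show ?thesis using index_cases[of k] by auto
qed

text \<open>Joint element of the parallel walls that an exponent list stands for, one wall per
  entry.\<close>

definition psum :: "int ^ 2 \<Rightarrow> int list \<Rightarrow> 2 lie" where
  "psum n es m = (\<Sum>e\<leftarrow>es. Psi (1 / ndelta n) (of_int e / of_nat \<delta>\<^sub>0) n m)"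

lemma psum_not_multiple: "(\<And>k. 1 \<le> k \<Longrightarrow> m \<noteq> int k *s n) \<Longrightarrow> psum n es m = 0"
  by (simp add: psum_def Psi_not_multiple)

lemma psum_mk:
  assumes xy: "x \<noteq> 0 \<or> y \<noteq> 0" and k: "1 \<le> k" and m: "m = mk (int k * x) (int k * y)"
    and G: "ndelta (mk x y) = of_nat \<delta>\<^sub>0 / of_nat G" "0 < G"
  shows "psum (mk x y) es m = (- 1) ^ (k + 1) * kap / (of_nat k * qbr (k * G)) * (\<Sum>e\<leftarrow>es. tvar powi (int k * e))"
proof -
  have "qnum (of_nat k * (1 / ndelta (mk x y))) = qbr (k * G) / kap"
    using G delta0_pos by (subst qnum_eq[of _ "k * G"]) (simp_all add: kap_def)
  moreover have "qpow (of_nat k * (of_int e / of_nat \<delta>\<^sub>0)) = tvar powi (int k * e)" for e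
    using delta0_pos by (intro qpow_eq) simp
  ultimately have "Psi (1 / ndelta (mk x y)) (of_int e / of_nat \<delta>\<^sub>0) (mk x y) m =
      (- 1) ^ (k + 1) * kap / (of_nat k * qbr (k * G)) * tvar powi (int k * e)" for e
    unfolding Psi_mk[OF xy k m] by simp
  then show ?thesis unfolding psum_def by (simp only: sum_list_const_mult)
qed

text \<open>\<open>G\<close> is the numerator in 1/\<delta>(n) = G/\<delta>_0, so that
  [1/\<delta>(n)]_q is \<open>qbr G / kap\<close>.\<close>

definition level :: "int \<Rightarrow> int \<Rightarrow> nat \<Rightarrow> bool" where
  "level x y G \<longleftrightarrow> x \<noteq> 0 \<and> 0 < G \<and> ndelta (mk x y) = of_nat \<delta>\<^sub>0 / of_nat G"

lemma psum_level:
  assumes "level x y G"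
  shows "psum (mk x y) es (mk x y) = kap / qbr G * tq.laurent_sum es"
    "psum (mk x y) es (mk (2 * x) (2 * y)) = - kap / (2 * qbr (2 * G)) * (\<Sum>e\<leftarrow>es. tvar powi (2 * e))"
  using psum_mk[of x y 1 _ G es] psum_mk[of x y 2 _ G es] assms by (simp_all add: level_def tq.laurent_sum_def)

lemma delta0_eq: "\<delta> i dvd \<delta> j \<Longrightarrow> \<delta>\<^sub>0 = \<delta> j" "\<delta> j dvd \<delta> i \<Longrightarrow> \<delta>\<^sub>0 = \<delta> i"
  by (simp_all add: \<delta>\<^sub>0_def UNIV_ij lcm_proj2_if_dvd_nat lcm_proj1_if_dvd_nat)

lemma outgoing_positive:
  assumes q: "qcsd I W" and dvd: "\<delta> i dvd \<delta> j \<or> \<delta> j dvd \<delta> i"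
  defines "F \<equiv> \<lambda>a b. outgoing_sum I W (mk a b)"
  obtains e11 e21 e31 e12 e13 e22 where
    "F 1 1 = psum (mk 1 1) e11 (mk 1 1)" "F 2 1 = psum (mk 2 1) e21 (mk 2 1)" "F 3 1 = psum (mk 3 1) e31 (mk 3 1)"
    "F 1 2 = psum (mk 1 2) e12 (mk 1 2)" "F 1 3 = psum (mk 1 3) e13 (mk 1 3)"
    "F 2 2 = psum (mk 1 1) e11 (mk 2 2) + psum (mk 2 2) e22 (mk 2 2)"
proof -
  note ov = outgoing_values[OF q]
  have p23: "prime (2::nat)" "prime (3::nat)" by simp_all
  from dvd show ?thesis
  proof
    assume d: "\<delta> i dvd \<delta> j"
    have d0: "\<delta>\<^sub>0 = \<delta> j" by (rule delta0_eq(1)[OF d])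
    \<comment> \<open>The parameter \<open>tvar\<close> itself is q^(1/\<delta>_j), so every quantum
      integer below is one in \<open>tvar\<close> or in \<open>tvar ^ m\<close>.\<close>
    have Aj1: "Aj = 1" using Aj \<delta>_pos[of j] d0 by simp
    define m where "m = \<delta> j div \<delta> i"
    have Aim: "Ai = m" using d0 by (simp add: Ai_def m_def)
    have m0: "0 < m" using Ai(2) Aim by simp
    have wnm: "wn = m * bi" "bj = m * bi" using wn_alt Aj1 by (simp_all add: wn_def Aim)
    note mv = min_multiple_values[OF d \<delta>_pos \<delta>_pos, folded m_def]
    have G: "level 1 1 1" "level 2 1 1"
      "level 3 1 1" "level 2 2 2"
      "level 1 2 (if 2 dvd m then 2 else 1)"
      "level 1 3 (if 3 dvd m then 3 else 1)"
      using mv(1)[of 1] mv(1)[of 2] mv(1)[of 3] mv(2) mv(4)[OF p23(1)] mv(4)[OF p23(2)]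
      unfolding level_def ndelta_mk d0 by simp_all
    show ?thesis
    proof (rule tq.positive_expansions[OF m0 bi(1)], goal_cases)
      case (1 E)
      note es = this
      note ps = G[THEN psum_level(1)] psum_level(2)[OF G(1), unfolded mult_1_right]
      have br0: "qbr (if 2 dvd m then 2 else 1) \<noteq> 0" "qbr (if 3 dvd m then 3 else 1) \<noteq> 0" by simp_all
      show ?thesis
      proof (rule that)
        show "F 1 1 = psum (mk 1 1) (E 1 1) (mk 1 1)" "F 2 1 = psum (mk 2 1) (E 2 1) (mk 2 1)" "F 3 1 = psum (mk 3 1) (E 3 1) (mk 3 1)"
          unfolding F_def ov(1-3) ps es Aim Aj1 wnm by (simp_all add: mult_ac)
        show "F 1 2 = psum (mk 1 2) (E 1 2) (mk 1 2)" "F 1 3 = psum (mk 1 3) (E 1 3) (mk 1 3)"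
          unfolding F_def ov(4,5) ps es Aim Aj1 wnm using br0 by (simp_all add: mult_ac del: br0)
        show "F 2 2 = psum (mk 1 1) (E 1 1) (mk 2 2) + psum (mk 2 2) (E 2 2) (mk 2 2)"
          unfolding F_def ov(6) ps es Aim Aj1 wnm by (simp add: algebra_simps diff_divide_distrib add_divide_distrib del: One_nat_def)
      qed
    qed
  next
    assume d: "\<delta> j dvd \<delta> i"
    have d0: "\<delta>\<^sub>0 = \<delta> i" by (rule delta0_eq(2)[OF d])
    have Ai1: "Ai = 1" using Ai \<delta>_pos[of i] d0 by simp
    define m where "m = \<delta> i div \<delta> j"
    have Ajm: "Aj = m" using d0 by (simp add: Aj_def m_def)
    have m0: "0 < m" using Aj(2) Ajm by simp
    have wnm: "wn = m * bj" "bi = m * bj" using wn_alt Ai1 Ajm by (simp_all add: wn_def)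
    note mv = min_multiple_values[OF d \<delta>_pos \<delta>_pos, folded m_def, unfolded min_multiple_swap[of "\<delta> j" "\<delta> i"]]
    have G: "level 1 1 1" "level 1 2 1"
      "level 1 3 1" "level 2 2 2"
      "level 2 1 (if 2 dvd m then 2 else 1)"
      "level 3 1 (if 3 dvd m then 3 else 1)"
      using mv(1)[of 1] mv(1)[of 2] mv(1)[of 3] mv(2) mv(4)[OF p23(1)] mv(4)[OF p23(2)]
      unfolding level_def ndelta_mk d0 by simp_all
    show ?thesis
    proof (rule tq.positive_expansions[OF m0 bj(1)], goal_cases)
      case (1 E)
      note es = this
      note ps = G[THEN psum_level(1)] psum_level(2)[OF G(1), unfolded mult_1_right]
      have br0: "qbr (if 2 dvd m then 2 else 1) \<noteq> 0" "qbr (if 3 dvd m then 3 else 1) \<noteq> 0" by simp_all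
      show ?thesis
      proof (rule that)
        \<comment> \<open>The expansions of the first case serve with their indices exchanged, and
          (2,2) uses the second form of its value.\<close>
        show "F 1 1 = psum (mk 1 1) (E 1 1) (mk 1 1)" "F 1 2 = psum (mk 1 2) (E 2 1) (mk 1 2)" "F 1 3 = psum (mk 1 3) (E 3 1) (mk 1 3)"
          unfolding F_def ov(1,4,5) ps es Ajm Ai1 wnm by (simp_all add: mult_ac)
        show "F 2 1 = psum (mk 2 1) (E 1 2) (mk 2 1)" "F 3 1 = psum (mk 3 1) (E 1 3) (mk 3 1)"
          unfolding F_def ov(2,3) ps es Ajm Ai1 wnm using br0 by (simp_all add: mult_ac del: br0)
        show "F 2 2 = psum (mk 1 1) (E 1 1) (mk 2 2) + psum (mk 2 2) (E 2 2) (mk 2 2)"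
          unfolding F_def ov(7) ps es Ajm Ai1 wnm by (simp add: algebra_simps diff_divide_distrib add_divide_distrib del: One_nat_def)
      qed
    qed
  qed
qed

end

section \<open>Construction of the positive diagram\<close>

lemma primitive_if_nth_1: "n $ k = 1 \<Longrightarrow> primitive n"
  unfolding primitive_def by (metis abs_1 abs_zmult_eq_1 mult.commute vector_smult_component)

lemma subspace_perp: "subspace (perp n)"
  using linear_pairing[of n] by (auto simp: perp_def subspace_def linear_0 linear_add linear_cmul)

context rank2_data
begin

text \<open>An integral generator of the outgoing ray, as rationality of the cone demands;
  \<open>- pstar n\<close> is \<open>wr\<close> times it.\<close>

definition ray_gen :: "int ^ 2 \<Rightarrow> real ^ 2" where
  "ray_gen n = of_int (- (n $ j)) *\<^sub>R axis i 1 + of_int (n $ i) *\<^sub>R axis j 1"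

text \<open>\<open>n0\<close> is meant as the primitive normal and \<open>n\<close> as a positive
  multiple of it; the two differ for the elements Psi[(2,2)].\<close>

definition outwall :: "int ^ 2 \<Rightarrow> int ^ 2 \<Rightarrow> int \<Rightarrow> 2 wall" where
  "outwall n0 n e = \<lparr>wcone = convex_cone hull {ray_gen n0},
     welt = Psi (1 / ndelta n) (of_int e / of_nat \<delta>\<^sub>0) n, wnormal = n0\<rparr>"

lemma ray_gen_nth: "ray_gen n $ i = - of_int (n $ j)" "ray_gen n $ j = of_int (n $ i)"
  unfolding ray_gen_def axis_nth_ij by simp_all

lemma minus_pstar_in_ray:
  assumes "0 \<le> k"
  shows "- pstar (k *s n0) \<in> convex_cone hull {ray_gen n0}"
proof -
  have "- pstar (k *s n0) = (of_int k * wr) *\<^sub>R ray_gen n0"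
    by (simp add: vec_eq_ij pstar_nth ray_gen_nth)
  then show ?thesis
    using convex_cone_hull_mul[of "ray_gen n0" "{ray_gen n0}" "of_int k * wr"] assms wr_pos by (simp add: hull_inc)
qed

lemma outwall_is_wall:
  assumes n0: "n0 \<in> Nplus_pr" and n: "n = int c *s n0" "1 \<le> c"
  shows "is_wall (outwall n0 n e)"
proof -
  let ?v = "ray_gen n0"
  have "n0 $ i \<noteq> 0 \<or> n0 $ j \<noteq> 0" using n0 Nplus_nth by (fastforce simp: Nplus_pr_def)
  then have v0: "?v \<noteq> 0" by (auto simp: vec_eq_ij ray_gen_nth)
  have "?v $ k \<in> \<int>" for k using index_cases[of k] by (auto simp: ray_gen_nth)
  then have "rational_polyhedral_cone (convex_cone hull {?v})"
    unfolding rational_polyhedral_cone_def by (intro exI[of _ "{?v}"]) auto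
  moreover have "convex_cone hull {?v} \<subseteq> perp n0"
    by (rule hull_minimal, simp add: perp_def pairing_ij ray_gen_nth, rule subspace_imp_convex_cone[OF subspace_perp])
  moreover have "aff_dim (convex_cone hull {?v}) = 1"
  proof (rule antisym)
    have "convex_cone hull {?v} \<subseteq> span {?v}"
      by (rule hull_minimal) (auto simp: convex_cone_span span_base)
    then have "aff_dim (convex_cone hull {?v}) \<le> aff_dim (span {?v})" by (rule aff_dim_subset)
    also have "\<dots> \<le> 1" using v0 by (simp add: aff_dim_subspace dim_singleton)
    finally show "aff_dim (convex_cone hull {?v}) \<le> 1" .
    have "{0, ?v} \<subseteq> convex_cone hull {?v}" by (simp add: convex_cone_hull_contains_0 hull_inc)
    then have "aff_dim {0, ?v} \<le> aff_dim (convex_cone hull {?v})" by (rule aff_dim_subset)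
    then show "1 \<le> aff_dim (convex_cone hull {?v})" using v0 by (simp add: aff_dim_2)
  qed
  moreover have "Psi (1 / ndelta n) (of_int e / of_nat \<delta>\<^sub>0) n \<in> G_par n0"
    unfolding G_par_def
  proof (intro CollectI allI impI Psi_not_multiple)
    fix m k assume a: "\<nexists>k. 1 \<le> k \<and> m = int k *s n0" and k: "1 \<le> (k::nat)"
    have "int k *s n = int (k * c) *s n0" "1 \<le> k * c" using n k by (auto simp: vec_eq_iff)
    then show "m \<noteq> int k *s n" using a by metis
  qed
  ultimately show ?thesis using n0 by (simp add: is_wall_def outwall_def)
qed

text \<open>\<open>pstar n0\<close> has a negative \<open>j\<close>-coordinate, the ray only
  non-negative ones.\<close>

lemma outwall_not_incoming:
  assumes "0 < n0 $ i"
  shows "\<not> incoming (outwall n0 n e)"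
proof
  assume "incoming (outwall n0 n e)"
  then have a: "pstar n0 \<in> convex_cone hull {ray_gen n0}" by (simp add: incoming_def outwall_def)
  have "convex_cone hull {ray_gen n0} \<subseteq> {x. axis j 1 \<bullet> x \<ge> 0}"
    using assms by (intro hull_minimal convex_cone_halfspace_ge) (auto simp: inner_axis' ray_gen_nth)
  then have "0 \<le> pstar n0 $ j" using a by (auto simp: inner_axis')
  then show False using assms wr_pos by (simp add: pstar_nth mult_le_0_iff)
qed

lemma outgoing_sum_list:
  fixes ws :: "2 wall list"
  assumes "deg m \<le> 4" "\<And>u. u \<in> set ws \<Longrightarrow> welt u m \<noteq> 0 \<Longrightarrow> - pstar m \<in> wcone u"
  shows "outgoing_sum {..<length ws} (\<lambda>l. ws ! l) m = (\<Sum>u\<leftarrow>ws. welt u m)"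
proof -
  have "outgoing_sum {..<length ws} (\<lambda>l. ws ! l) m = (\<Sum>l<length ws. welt (ws ! l) m)"
    unfolding outgoing_sum_def direction_sum_def
  proof (rule sum.mono_neutral_left)
    show "\<forall>l\<in>{..<length ws} - {l. l \<in> {..<length ws} \<and> welt (ws ! l) \<notin> G_gt 4 \<and> - pstar m \<in> wcone (ws ! l)}. welt (ws ! l) m = 0"
      using assms nth_mem by (fastforce simp: G_gt_def)
  qed auto
  then show ?thesis by (simp add: sum_list_sum_nth atLeast0LessThan)
qed

text \<open>A nonzero \<open>v\<close> in \<open>perp m\<close> is a positive multiple of
  \<open>pstar m\<close> or of \<open>- pstar m\<close>. On the former the initial walls decide, on
  the latter the hypothesis \<open>out\<close>.\<close>

lemma direction_sums_agree:
  assumes D: "diagram I W" "diagram I' W'"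
    and out: "\<And>a b. 0 < a + b \<Longrightarrow> a + b \<le> 4 \<Longrightarrow>
        outgoing_sum I W (nvec a b) = outgoing_sum I' W' (nvec a b)"
    and v: "v \<noteq> 0" and ab: "a + b \<le> 4"
  shows "direction_sum 4 I W v (nvec a b) = direction_sum 4 I' W' v (nvec a b)"
proof -
  define m where "m = nvec a b"
  have sd: "scattering_diagram I W" "scattering_diagram I' W'" using D by auto
  have "direction_sum 4 I W v m = direction_sum 4 I' W' v m"
  proof (cases "m \<in> Nplus \<and> v \<in> perp m")
    case False
    then show ?thesis using direction_sum_off_Nplus direction_sum_off_perp sd by metis
  next
    case True
    have ab0: "0 < a + b" using True unfolding m_def mk_Nplus by linarith
    then have "m \<noteq> 0" by (auto simp: m_def vec_eq_ij)
    then obtain s where s: "v = s *\<^sub>R pstar m" using perp_multiple_pstar True by blast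
    show ?thesis
    proof (cases "0 < s")
      case True
      then show ?thesis unfolding s direction_sum_scale[OF sd(1) True] direction_sum_scale[OF sd(2) True]
        using direction_sum_incoming[OF D(1)] direction_sum_incoming[OF D(2)] ab by (simp add: m_def)
    next
      case False
      then have ns: "0 < - s" using s v by (cases "s = 0") auto
      have v': "v = (- s) *\<^sub>R (- pstar m)" using s by simp
      show ?thesis unfolding v' direction_sum_scale[OF sd(1) ns] direction_sum_scale[OF sd(2) ns]
        using out[OF ab0 ab] by (simp add: m_def outgoing_sum_def)
    qed
  qed
  then show ?thesis by (simp add: m_def)
qed

theorem positive_up_to_degree_4:
  fixes I :: "'i set" and W :: "'i \<Rightarrow> 2 wall"
  assumes q: "qcsd I W" and dvd: "\<delta> i dvd \<delta> j \<or> \<delta> j dvd \<delta> i"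
  shows "\<exists>(I' :: nat set) (W' :: nat \<Rightarrow> 2 wall). scattering_diagram I' W' \<and> initial_incoming I' W' \<and>
     (\<forall>l\<in>I'. positive_element (welt (W' l))) \<and>
     (\<forall>\<gamma>. admissible I' W' \<gamma> \<and> admissible I W \<gamma> \<longrightarrow> gcong 4 (path_prod I' W' \<gamma>) (path_prod I W \<gamma>))"
proof -
  have D: "diagram I W" using q by (simp add: qcsd_def)
  obtain e11 e21 e31 e12 e13 e22 where F:
    "outgoing_sum I W (mk 1 1) = psum (mk 1 1) e11 (mk 1 1)" "outgoing_sum I W (mk 2 1) = psum (mk 2 1) e21 (mk 2 1)"
    "outgoing_sum I W (mk 3 1) = psum (mk 3 1) e31 (mk 3 1)" "outgoing_sum I W (mk 1 2) = psum (mk 1 2) e12 (mk 1 2)"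
    "outgoing_sum I W (mk 1 3) = psum (mk 1 3) e13 (mk 1 3)"
    "outgoing_sum I W (mk 2 2) = psum (mk 1 1) e11 (mk 2 2) + psum (mk 2 2) e22 (mk 2 2)"
    using outgoing_positive[OF q dvd] by metis
  \<comment> \<open>Entries consist of primitive normal, multiple and exponents; the last one puts
    the elements Psi[(2,2)] on walls with normal (1,1).\<close>
  define os where "os = [(mk 1 1, 1, e11), (mk 2 1, 1, e21), (mk 3 1, 1, e31), (mk 1 2, 1, e12), (mk 1 3, 1, e13), (mk 1 1, 2::nat, e22)]"
  define outs where "outs = concat (map (\<lambda>(n0, c, es). map (outwall n0 (int c *s n0)) es) os)"
  define ws where "ws = initial_wall i # initial_wall j # outs"
  let ?I = "{..<length ws}" and ?W = "\<lambda>l. ws ! l"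
  have os: "n0 \<in> Nplus_pr \<and> 0 < n0 $ i \<and> 1 \<le> c" if "(n0, c, es) \<in> set os" for n0 c es
    using that primitive_if_nth_1[of n0 i] primitive_if_nth_1[of n0 j] by (auto simp: os_def Nplus_pr_def)
  have outs: "\<exists>n0 c e. u = outwall n0 (int c *s n0) e \<and> n0 \<in> Nplus_pr \<and> 0 < n0 $ i \<and> 1 \<le> c" if u: "u \<in> set outs" for u
  proof -
    obtain n0 c es e where "(n0, c, es) \<in> set os" "u = outwall n0 (int c *s n0) e"
      using u by (auto simp: outs_def)
    then show ?thesis using os by blast
  qed
  \<comment> \<open>The initial walls occur in the given diagram, so they satisfy
    \<open>is_wall\<close>.\<close>
  have init: "is_wall (initial_wall k)" for k
  proof -
    have "initial_wall k \<in> W ` {l \<in> I. incoming (W l)}" using D by (simp add: initial_incoming_def bij_betw_def)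
    then show ?thesis using D by (auto simp: scattering_diagram_def)
  qed
  have inc: "incoming (initial_wall k)" for k
    by (simp add: incoming_def initial_wall_def perp_def pairing_ij pstar_nth)
  have ninc: "\<not> incoming u" if "u \<in> set outs" for u using outs[OF that] outwall_not_incoming by blast
  have wall: "is_wall u" if "u \<in> set ws" for u
    using that init outs outwall_is_wall by (auto simp: ws_def) metis
  have sd: "scattering_diagram ?I ?W" using wall by (auto simp: scattering_diagram_def)
  have ne: "initial_wall i \<noteq> initial_wall j" using inj_initial_wall ij by (auto dest: injD)
  have ii: "initial_incoming ?I ?W"
  proof -
    have "{l \<in> ?I. incoming (?W l)} = {0, 1}"
    proof (rule set_eqI)
      fix l show "l \<in> {l \<in> ?I. incoming (?W l)} \<longleftrightarrow> l \<in> {0, 1}"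
      proof (cases "l < 2")
        case True
        then have "l = 0 \<or> l = 1" by auto
        then show ?thesis using inc by (auto simp: ws_def)
      next
        case False
        then obtain k where k: "l = Suc (Suc k)" by (metis add_2_eq_Suc le_Suc_ex not_less)
        then show ?thesis using ninc nth_mem[of k outs] by (auto simp: ws_def)
      qed
    qed
    moreover have "bij_betw ?W {0, 1} (range initial_wall)"
      using ne by (auto simp: bij_betw_def UNIV_ij ws_def inj_on_def)
    ultimately show ?thesis by (simp add: initial_incoming_def)
  qed
  have pos: "positive_element (welt u)" if "u \<in> set ws" for u
  proof -
    have 1: "gpow 1 x = x" for x :: "2 lie" by (simp add: gpow_def)
    consider k where "u = initial_wall k" | "u \<in> set outs" using \<open>u \<in> set ws\<close> by (auto simp: ws_def)
    then show ?thesis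
    proof cases
      case (1 k)
      have "seed k \<in> Nplus" using index_cases[of k] by (auto simp: seed_mk)
      moreover have "welt u = gpow 1 (Psi (1 / ndelta (seed k)) 0 (seed k))"
        using 1 by (simp add: initial_wall_def ndelta_seed gpow_def)
      moreover have "0 \<in> frac_lattice" by (simp add: frac_lattice_def)
      ultimately show ?thesis unfolding positive_element_def by (metis zero_less_one)
    next
      case 2
      then obtain n0 c e where u: "u = outwall n0 (int c *s n0) e" "n0 \<in> Nplus_pr" "1 \<le> c" using outs by blast
      have "int c *s n0 \<in> Nplus" using u Nplus_zsmult by (auto simp: Nplus_pr_def)
      moreover have "of_int e / of_nat \<delta>\<^sub>0 \<in> frac_lattice" using delta0_pos by (simp add: frac_lattice_def)
      moreover have "welt u = gpow 1 (Psi (1 / ndelta (int c *s n0)) (of_int e / of_nat \<delta>\<^sub>0) (int c *s n0))"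
        using u by (simp add: outwall_def gpow_def)
      ultimately show ?thesis unfolding positive_element_def by (metis zero_less_one)
    qed
  qed
  have cone: "- pstar m \<in> wcone u" if u: "u \<in> set ws" "welt u m \<noteq> 0" for u m
  proof -
    obtain k where k: "m = int k *s wnormal u" using welt_multiple[OF wall[OF u(1)] u(2)] by blast
    consider l where "u = initial_wall l" | n0 n e where "u = outwall n0 n e"
      using u(1) outs[of u] by (auto simp: ws_def)
    then show ?thesis
    proof cases
      case (1 l)
      then show ?thesis using k by (simp add: initial_wall_def perp_def pairing_ij pstar_nth)
    next
      case (2 n0 n e)
      then show ?thesis using k minus_pstar_in_ray[of "int k" n0] by (simp add: outwall_def)
    qed
  qed
  have sum: "outgoing_sum ?I ?W m = Psi_i m + Psi_j m + psum (mk 1 1) e11 m + psum (mk 2 1) e21 m + psum (mk 3 1) e31 m +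
      psum (mk 1 2) e12 m + psum (mk 1 3) e13 m + psum (mk 2 2) e22 m" if "deg m \<le> 4" for m
  proof -
    have "(\<Sum>u\<leftarrow>map (outwall n0 n) es. welt u m) = psum n es m" for n0 n es
      by (simp add: psum_def outwall_def o_def)
    then have "(\<Sum>u\<leftarrow>outs. welt u m) = (\<Sum>(n0, c, es)\<leftarrow>os. psum (int c *s n0) es m)"
      unfolding outs_def by (simp add: os_def)
    then show ?thesis
      using outgoing_sum_list[of m ws, OF that cone]
      by (simp add: ws_def os_def initial_wall_def)
  qed
  have agree: "outgoing_sum I W (nvec a b) = outgoing_sum ?I ?W (nvec a b)"
    if ab: "0 < a + b" "a + b \<le> 4" for a b
  proof -
    have S: "outgoing_sum ?I ?W (nvec a b) = Psi_i (nvec a b) + Psi_j (nvec a b) +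
      psum (mk 1 1) e11 (nvec a b) + psum (mk 2 1) e21 (nvec a b) + psum (mk 3 1) e31 (nvec a b) +
      psum (mk 1 2) e12 (nvec a b) + psum (mk 1 3) e13 (nvec a b) + psum (mk 2 2) e22 (nvec a b)"
      using ab by (intro sum) simp
    have z: "psum (mk x y) es (nvec a b) = 0" if "int a * y \<noteq> int b * x" for x y es
      using that by (intro psum_not_multiple) auto
    \<comment> \<open>This covers the parallel case: (1,1) receives nothing from the walls of
      (2,2).\<close>
    have z': "psum (mk x y) es (nvec a b) = 0" if "int a < x" for x y es
    proof (rule psum_not_multiple, rule notI)
      fix k assume "1 \<le> (k::nat)" "nvec a b = int k *s mk x y"
      then have "int a = int k * x" "1 * x \<le> int k * x" using \<open>int a < x\<close> by (auto intro!: mult_right_mono)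
      then show False using \<open>int a < x\<close> by simp
    qed
    have zi: "Psi_i (nvec a b) = 0" if "0 < b" using that by (intro Psi_not_multiple) (auto simp: seed_mk)
    have zj: "Psi_j (nvec a b) = 0" if "0 < a" using that by (intro Psi_not_multiple) (auto simp: seed_mk)
    consider "b = 0" "0 < a" | "a = 0" "0 < b" | "0 < a" "0 < b" using ab by auto
    then show ?thesis
    proof cases
      case 1
      then show ?thesis unfolding S using loop_components(1)[OF q, of a] ab zj z by simp
    next
      case 2
      then show ?thesis unfolding S using loop_components(2)[OF q, of b] ab zi z by simp
    next
      case 3
      then have "a = 1 \<or> a = 2 \<or> a = 3" "b = 1 \<or> b = 2 \<or> b = 3" using ab by auto
      then have "(a = 1 \<and> b = 1) \<or> (a = 2 \<and> b = 2) \<or> (a = 2 \<and> b = 1) \<or> (a = 3 \<and> b = 1) \<or> (a = 1 \<and> b = 2) \<or> (a = 1 \<and> b = 3)"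
        using ab by (elim disjE) simp_all
      then show ?thesis unfolding S using zi zj F z z' 3 by (elim disjE) simp_all
    qed
  qed
  have "gcong 4 (path_prod ?I ?W \<gamma>) (path_prod I W \<gamma>)" if "admissible ?I ?W \<gamma>" "admissible I W \<gamma>" for \<gamma>
    using gcong_4_if_direction_sums_agree[OF D _ that(2,1) direction_sums_agree[OF D _ agree]] sd ii by blast
  then show ?thesis using sd ii pos by (intro exI[of _ ?I] exI[of _ ?W]) auto
qed

end

theorem proposition5p15:
  fixes \<omega> :: "int ^ 2 \<Rightarrow> int ^ 2 \<Rightarrow> rat"
    and \<delta> :: "2 \<Rightarrow> nat"
    and I :: "'i set"
    and W :: "'i \<Rightarrow> 2 wall"
  assumes "fixed_data \<omega> \<delta>"
    and "fixed_data.qcsd \<omega> \<delta> I W"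
    and "fixed_data.bmat \<omega> \<delta> 1 2 \<noteq> 0"
    and "\<delta> 1 dvd \<delta> 2 \<or> \<delta> 2 dvd \<delta> 1"
  shows "\<exists>(I' :: nat set) (W' :: nat \<Rightarrow> 2 wall).
     scattering_diagram I' W' \<and>
     fixed_data.initial_incoming \<omega> \<delta> I' W' \<and>
     (\<forall>l\<in>I'. fixed_data.positive_element \<delta> (welt (W' l))) \<and>
     (\<forall>\<gamma>. admissible I' W' \<gamma> \<and> admissible I W \<gamma> \<longrightarrow>
        fixed_data.gcong \<omega> \<delta> 4 (fixed_data.path_prod \<omega> \<delta> I' W' \<gamma>)
          (fixed_data.path_prod \<omega> \<delta> I W \<gamma>))"
proof -
  interpret fixed_data \<omega> \<delta> by (rule assms(1))
  have nz: "\<omega> (seed 1) (seed 2) \<noteq> 0"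
    using assms(3) by (auto simp: bmat_def omega_zsmult)
  show ?thesis
  \<comment> \<open>The form is skew, so one of the two orderings of the indices makes it
    positive.\<close>
  proof (cases "0 < \<omega> (seed 1) (seed 2)")
    case True
    then interpret rank2_data \<omega> \<delta> 1 2 by unfold_locales auto
    show ?thesis by (rule positive_up_to_degree_4[OF assms(2,4)])
  next
    case False
    then have "0 < \<omega> (seed 2) (seed 1)" using nz skew[of "seed 1" "seed 2"] by simp
    then interpret rank2_data \<omega> \<delta> 2 1 by unfold_locales auto
    show ?thesis using assms(4) by (intro positive_up_to_degree_4[OF assms(2)]) auto
  qed
qed

end
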